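(* Let $\Omega\subset\mathbb{R}^2$ be the planar domain bounded by an ellipse. Then $\Omega$ is a bounded star-shaped domain with smooth boundary which has an admissible family of periodic billiard trajectories.
   Context: **Billiard ball map.** For a bounded planar domain $\Omega$ with smooth boundary let $B^*\partial\Omega=\{(q,\xi)\in T^*\partial\Omega:\ |\xi|<1\}$ be the open co-ball bundle of the boundary; the glancing set is $S^*\partial\Omega=\{|\xi|=1\}$. The map $\zeta(q,\xi)=(q,\xi+\sqrt{1-|\xi|^2}\,\nu_q^+)$, with $\nu_q^+$ the inner unit normal at $q$, identifies $B^*\partial\Omega$ with the set of inward-pointing unit (co)vectors at boundary points. The billiard ball map $\beta$ on $B^*\partial\Omega$ sends $(q,\xi)$ to $(q',\xi')$, where $q'$ is the next point at which the straight line from $q$ in the direction $\zeta(q,\xi)$ hits $\partial\Omega$, and $\xi'$ is the tangential component at $q'$ of the direction of this line. A point fixed by $\beta^k$ determines a periodic billiard trajectory, whose length (period) is the total length of its $k$ segments. A billiard trajectory is viewed as a trajectory of the billiard flow on the unit cotangent bundle $S^*\Omega$. **Clean fixed point sets.** A submanifold $Z$ of fixed points of a diffeomorphism $\Phi:M\to M$ is clean if for every $z\in Z$ the kernel of $d\Phi_z-I:T_zM\to T_zM$ equals $T_zZ$. **Admissible family.** Suppose $\beta$ possesses a smooth invariant circle $\Lambda_T\subset B^*\partial\Omega$ consisting of fixed points of $\beta^k$ for some $k\ge2$, and let $\tilde\Lambda_T\subset S^*\Omega$ be the corresponding family of periodic billiard trajectories of length $T$. This family is admissible if: (i) there exists $\varepsilon>0$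 such that there are no periodic billiard trajectories of period $t\in[T-\varepsilon,T+\varepsilon]$ other than those in $\tilde\Lambda_T\cup\tilde\Lambda_T^{-1}$, where $\tilde\Lambda_T^{-1}$ is the family of the same trajectories traversed in the opposite direction; (ii) $\Lambda_T$ is a clean submanifold of fixed points of $\beta^k$; (iii) $\Lambda_T$ lies in the interior of $B^*\partial\Omega$, i.e. it stays away from the glancing set. *)

theory Defs
  imports "HOL-Analysis.Analysis"
begin

type_synonym plane = "real^2"

text \<open>The function \<open>F n\<close> is the \<open>n\<close>-th derivative; the notion is used for open \<open>S\<close> only.\<close>

definition smooth_fun_on :: "real set \<Rightarrow> (real \<Rightarrow> 'a::real_normed_vector) \<Rightarrow> bool" where
  "smooth_fun_on S f \<longleftrightarrow>
     (\<exists>F. F 0 = f \<and> (\<forall>n::nat. \<forall>t\<in>S. (F n has_vector_derivative F (Suc n) t) (at t)))"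

text \<open>
  All manifolds below are embedded submanifolds of Euclidean spaces; a tangent vector is the
  velocity of a smooth curve that runs inside the submanifold.
\<close>

definition tangent_space :: "'a::real_normed_vector set \<Rightarrow> 'a \<Rightarrow> 'a set" where
  "tangent_space S z =
     {v. \<exists>\<gamma> e. e > 0 \<and> smooth_fun_on {-e<..<e} \<gamma> \<and> (\<forall>t\<in>{-e<..<e}. \<gamma> t \<in> S) \<and>
           \<gamma> 0 = z \<and> (\<gamma> has_vector_derivative v) (at 0)}"

text \<open>Embedded smooth circles, given by a regular parametrization of period 1.\<close>

definition smooth_circle :: "'a::real_normed_vector set \<Rightarrow> bool" where
  "smooth_circle \<Lambda> \<longleftrightarrow>
     (\<exists>c. smooth_fun_on UNIV c \<and> (\<forall>t. vector_derivative c (at t) \<noteq> 0) \<and>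
          (\<forall>s t. c s = c t \<longleftrightarrow> s - t \<in> \<int>) \<and> range c = \<Lambda>)"

text \<open>
  The derivative \<open>D\<close> relative to \<open>M\<close> is determined only on the tangent space of \<open>M\<close> at \<open>z\<close>,
  where it is the differential of \<open>\<Phi>\<close>; the kernel is therefore taken inside the tangent space.
\<close>

definition clean_fixed_set :: "'a::real_normed_vector set \<Rightarrow> ('a \<Rightarrow> 'a) \<Rightarrow> 'a set \<Rightarrow> bool" where
  "clean_fixed_set M \<Phi> Z \<longleftrightarrow>
     Z \<subseteq> M \<and> (\<forall>z\<in>Z. \<Phi> z = z) \<and>
     (\<forall>z\<in>Z. \<exists>D. (\<Phi> has_derivative D) (at z within M) \<and>
        {v \<in> tangent_space M z. D v - v = 0} = tangent_space Z z)"

text \<open>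
  Near each boundary point the domain is, in suitable orthonormal coordinates along \<open>u\<close> and
  \<open>n\<close>, the region above the graph of a smooth function.
\<close>

definition smooth_boundary :: "plane set \<Rightarrow> bool" where
  "smooth_boundary \<Omega> \<longleftrightarrow>
     (\<forall>p\<in>frontier \<Omega>. \<exists>u n r. \<exists>f :: real \<Rightarrow> real.
        norm u = 1 \<and> norm n = 1 \<and> u \<bullet> n = 0 \<and> r > 0 \<and>
        smooth_fun_on {p \<bullet> u - r<..<p \<bullet> u + r} f \<and>
        \<Omega> \<inter> ball p r = {x \<in> ball p r. f (x \<bullet> u) < x \<bullet> n})"

text \<open>A sum of distances to two foci; equal foci are allowed, so circles are ellipses.\<close>

definition is_ellipse :: "plane set \<Rightarrow> bool" where
  "is_ellipse E \<longleftrightarrow>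
     (\<exists>f\<^sub>1 f\<^sub>2 a. dist f\<^sub>1 f\<^sub>2 < 2 * a \<and> E = {x. dist x f\<^sub>1 + dist x f\<^sub>2 = 2 * a})"

text \<open>
  Covectors on the boundary are identified with tangent vectors by the Euclidean metric, so that
  the cotangent bundle of the boundary is a subset of the product of two planes.
\<close>

definition coball_bundle :: "plane set \<Rightarrow> (plane \<times> plane) set" where
  "coball_bundle \<Omega> =
     {(q, \<xi>). q \<in> frontier \<Omega> \<and> \<xi> \<in> tangent_space (frontier \<Omega>) q \<and> norm \<xi> < 1}"

definition inner_normal :: "plane set \<Rightarrow> plane \<Rightarrow> plane" where
  "inner_normal \<Omega> q =
     (THE \<nu>. norm \<nu> = 1 \<and> (\<forall>v\<in>tangent_space (frontier \<Omega>) q. \<nu> \<bullet> v = 0) \<and>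
        (\<exists>e>0. \<forall>t\<in>{0<..<e}. q + t *\<^sub>R \<nu> \<in> \<Omega>))"

definition inward_vector :: "plane set \<Rightarrow> plane \<times> plane \<Rightarrow> plane" where
  "inward_vector \<Omega> = (\<lambda>(q, \<xi>). \<xi> + sqrt (1 - (norm \<xi>)\<^sup>2) *\<^sub>R inner_normal \<Omega> q)"

definition exit_time :: "plane set \<Rightarrow> plane \<Rightarrow> plane \<Rightarrow> real" where
  "exit_time \<Omega> q v = Inf {t. t > 0 \<and> q + t *\<^sub>R v \<in> frontier \<Omega>}"

definition billiard_map :: "plane set \<Rightarrow> plane \<times> plane \<Rightarrow> plane \<times> plane" where
  "billiard_map \<Omega> z =
     (let v = inward_vector \<Omega> z;
          q' = fst z + exit_time \<Omega> (fst z) v *\<^sub>R v;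
          \<nu> = inner_normal \<Omega> q'
      in (q', v - (v \<bullet> \<nu>) *\<^sub>R \<nu>))"

text \<open>
  For a domain that is not convex the line may hit the boundary tangentially, outside the open
  co-ball bundle; periodic points are required never to do so.
\<close>

definition periodic_point :: "plane set \<Rightarrow> nat \<Rightarrow> plane \<times> plane \<Rightarrow> bool" where
  "periodic_point \<Omega> k z \<longleftrightarrow>
     k \<ge> 1 \<and> (\<forall>i. (billiard_map \<Omega> ^^ i) z \<in> coball_bundle \<Omega>) \<and> (billiard_map \<Omega> ^^ k) z = z"

definition orbit_length :: "plane set \<Rightarrow> nat \<Rightarrow> plane \<times> plane \<Rightarrow> real" where
  "orbit_length \<Omega> k z =
     (\<Sum>i<k. dist (fst ((billiard_map \<Omega> ^^ i) z)) (fst ((billiard_map \<Omega> ^^ Suc i) z)))"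

text \<open>
  The orbit of the billiard flow through \<open>z\<close>, as a set of pairs of a point of the domain and a
  unit vector. Forward iterates suffice because only periodic \<open>z\<close> are considered.
\<close>

definition trajectory :: "plane set \<Rightarrow> plane \<times> plane \<Rightarrow> (plane \<times> plane) set" where
  "trajectory \<Omega> z =
     (\<Union>i. open_segment (fst ((billiard_map \<Omega> ^^ i) z)) (fst ((billiard_map \<Omega> ^^ Suc i) z))
            \<times> {inward_vector \<Omega> ((billiard_map \<Omega> ^^ i) z)})"

definition trajectory_family ::
    "plane set \<Rightarrow> (plane \<times> plane) set \<Rightarrow> (plane \<times> plane) set" where
  "trajectory_family \<Omega> \<Lambda> = (\<Union>z\<in>\<Lambda>. trajectory \<Omega> z)"

definition reversed :: "(plane \<times> plane) set \<Rightarrow> (plane \<times> plane) set" where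
  "reversed A = (\<lambda>(x, v). (x, - v)) ` A"

definition admissible_family ::
    "plane set \<Rightarrow> nat \<Rightarrow> real \<Rightarrow> (plane \<times> plane) set \<Rightarrow> bool" where
  "admissible_family \<Omega> k T \<Lambda> \<longleftrightarrow>
     k \<ge> 2 \<and> smooth_circle \<Lambda> \<and> \<Lambda> \<subseteq> coball_bundle \<Omega> \<and> billiard_map \<Omega> ` \<Lambda> = \<Lambda> \<and>
     (\<forall>z\<in>\<Lambda>. periodic_point \<Omega> k z \<and> orbit_length \<Omega> k z = T) \<and>
     (\<exists>\<epsilon>>0. \<forall>j z. periodic_point \<Omega> j z \<and> orbit_length \<Omega> j z \<in> {T - \<epsilon>..T + \<epsilon>} \<longrightarrow>
        trajectory \<Omega> z \<subseteq> trajectory_family \<Omega> \<Lambda> \<union> reversed (trajectory_family \<Omega> \<Lambda>)) \<and>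
     clean_fixed_set (coball_bundle \<Omega>) (billiard_map \<Omega> ^^ k) \<Lambda> \<and>
     (\<exists>\<delta><1. \<forall>(q, \<xi>)\<in>\<Lambda>. norm \<xi> \<le> \<delta>)"

end

theory Submission
  imports Defs "HOL-Computational_Algebra.Polynomial"
begin

text \<open>
  The admissible families are the inscribed polygons that wind once around the ellipse and are
  circumscribed about a confocal ellipse. On a billiard orbit Joachimsthal's quantity \<open>J\<close> is
  conserved. On a level of \<open>J\<close> the billiard map, written in the eccentric angle, commutes with the
  flow of a pendulum; uniqueness of solutions of the pendulum equation gives Poncelet's porism,
  together with the constancy of the length along the orbits of the flow.

  For each small \<open>J\<close> the level with counterclockwise orientation is a circle on which the map is
  monotone in \<open>J\<close> (twist), so for every large \<open>k\<close> there is exactly one level \<open>J\<^sub>k\<close> whose orbits close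
  up after \<open>k\<close> segments and one turn. A calibration argument shows that their lengths \<open>T\<^sub>k\<close> increase
  strictly, and that orbits with two or more turns and small \<open>J\<close> are longer than the perimeter,
  hence longer than every \<open>T\<^sub>k\<close>. Orbits with \<open>J\<close> bounded below and length at most the perimeter plus
  one have boundedly many segments. Their lengths form a finite set: by Poncelet such an orbit may
  be started at a vertex of the minor axis (except for orbits along an axis or a diameter), and
  from there the orbit is a rational function of the initial direction that is not constant.
  Hence some \<open>T\<^sub>k\<close> is isolated in the length spectrum. Cleanness is the strict monotonicity in \<open>J\<close>
  at the infinitesimal level.
\<close>

section \<open>Billiards in an ellipse in terms of the eccentric angle\<close>

text \<open>In the coordinates \<open>(t, z)\<close> the billiard map is symplectic: the length
  \<open>l\<close> of the chord from \<open>(t1, z1)\<close> to \<open>(t2, z2)\<close> satisfies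
  \<open>dl = z2 dt2 - z1 dt1\<close>. The function \<open>(z^2 - P t) / 2\<close> equals
  \<open>- a^2 b^2 J^2 / 2\<close>, so it is an integral of the map, and the map must commute with
  its Hamiltonian flow \<open>dt = z\<close>, \<open>dz = (a^2 - b^2) sin t cos t\<close>; this is
  the origin of the pendulum. The formula for \<open>dl\<close> also governs lengths: along the flow
  it telescopes, and two levels are compared by integrating it against a primitive of
  \<open>z dt\<close>. Angles stay on the real line throughout, so that the number of turns of a
  closed orbit is part of the data.

  The obstacle is isolation in the length spectrum. The lengths of the one-turn orbits accumulate at
  the perimeter, and any of them might coincide with the length of an orbit on a level with large
  \<open>J\<close>. So no particular \<open>k\<close> is named: the finite set of competing lengths
  is fixed before \<open>k\<close>, and infinitely many distinct lengths cannot all lie in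
  it.\<close>

locale ellipse_axes =
  fixes a b :: real
  assumes b_pos: "0 < b" and b_le_a: "b \<le> a"
begin

text \<open>
  A state \<open>(t, z)\<close> consists of the eccentric angle \<open>t\<close> of the boundary point
  \<open>q t = (a cos t, b sin t)\<close> and the momentum \<open>z = \<xi> \<bullet> q' t\<close>; here \<open>P t\<close> is the square of the speed
  of \<open>q\<close>. If \<open>\<theta>\<close> is the angle between the ray and the tangent, then \<open>z = \<surd>(P t) cos \<theta>\<close> and Joachimsthal's
  invariant is \<open>J = \<surd>(P t) sin \<theta> / (a b)\<close>. Levels with \<open>J a < 1\<close> belong to elliptic caustics. A chord
  from \<open>t\<close> to \<open>t + 2 d\<close> with \<open>m = t + d\<close> satisfies \<open>J\<^sup>2 P m = sin\<^sup>2 d\<close>; solving this for \<open>d\<close> gives the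
  formula for \<open>cot d\<close>.
\<close>

definition P :: "real \<Rightarrow> real" where
  "P t = a\<^sup>2 * (sin t)\<^sup>2 + b\<^sup>2 * (cos t)\<^sup>2"

definition cot_half :: "real \<Rightarrow> real \<Rightarrow> real \<Rightarrow> real" where
  "cot_half J t z = (z / J - (a\<^sup>2 - b\<^sup>2) * (sin t * cos t)) / P t"

definition half :: "real \<Rightarrow> real \<Rightarrow> real \<Rightarrow> real" where
  "half J t z = pi / 2 - arctan (cot_half J t z)"

text \<open>The momentum at the end of the chord with midpoint angle \<open>m\<close>: its unit
  direction is \<open>J / sin d\<close> times \<open>q' m\<close>, and the inner product with
  \<open>q' (m + d)\<close> is this expression.\<close>

definition next_mom :: "real \<Rightarrow> real \<Rightarrow> real \<Rightarrow> real" where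
  "next_mom J m d = sin d * cos d / J + J * (a\<^sup>2 - b\<^sup>2) * (sin m * cos m)"

definition step :: "real \<Rightarrow> real \<times> real \<Rightarrow> real \<times> real" where
  "step J = (\<lambda>(t, z). (t + 2 * half J t z, next_mom J (t + half J t z) (half J t z)))"

text \<open>The endpoints differ by \<open>2 sin d\<close> times \<open>q' m\<close>, which has norm
  \<open>2 sin d sqrt (P m)\<close>, and \<open>sqrt (P m) = sin d / J\<close>.\<close>

definition chord :: "real \<Rightarrow> real \<times> real \<Rightarrow> real" where
  "chord J = (\<lambda>(t, z). 2 * (sin (half J t z))\<^sup>2 / J)"

definition level :: "real \<Rightarrow> real \<times> real \<Rightarrow> bool" where
  "level J = (\<lambda>(t, z). 0 < J \<and> z\<^sup>2 + a\<^sup>2 * b\<^sup>2 * J\<^sup>2 = P t)"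

section \<open>Chords, their midpoints and the conservation of \<open>J\<close>\<close>

lemma a_pos: "0 < a"
  using b_pos b_le_a by linarith

lemma P_alt: "P t = b\<^sup>2 + (a\<^sup>2 - b\<^sup>2) * (sin t)\<^sup>2"
  by (simp add: P_def cos_squared_eq algebra_simps)

lemma P_ge: "b\<^sup>2 \<le> P t" and P_le: "P t \<le> a\<^sup>2"
proof -
  have "b\<^sup>2 \<le> a\<^sup>2" using b_pos b_le_a by (simp add: power_mono)
  then show "b\<^sup>2 \<le> P t" by (simp add: P_alt)
  have "(sin t)\<^sup>2 \<le> 1" by (simp add: abs_square_le_1)
  then have "(a\<^sup>2 - b\<^sup>2) * (sin t)\<^sup>2 \<le> (a\<^sup>2 - b\<^sup>2) * 1"
    using \<open>b\<^sup>2 \<le> a\<^sup>2\<close> by (intro mult_left_mono) auto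
  then show "P t \<le> a\<^sup>2" by (simp add: P_alt)
qed

lemma P_pos: "0 < P t"
  using P_ge[of t] b_pos by (smt (verit) zero_less_power)

lemma half_pos: "0 < half J t z" and half_less_pi: "half J t z < pi"
  using arctan_bounded[of "cot_half J t z"] by (auto simp: half_def)

lemma sin_half_pos: "0 < sin (half J t z)"
  using half_pos half_less_pi by (intro sin_gt_zero)

lemma cos_half: "cos (half J t z) = cot_half J t z * sin (half J t z)"
  by (simp add: half_def cos_diff sin_diff cos_arctan sin_arctan)

lemma sin_half_sq: "(sin (half J t z))\<^sup>2 * (1 + (cot_half J t z)\<^sup>2) = 1"
proof -
  have "(sin (half J t z))\<^sup>2 + (cos (half J t z))\<^sup>2 = 1" by simp
  then show ?thesis by (simp add: cos_half algebra_simps power_mult_distrib)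
qed

text \<open>Lagrange's identity for the vectors \<open>q' t\<close> and \<open>q'' t\<close>, whose
  inner product is \<open>(a^2 - b^2) sin t cos t\<close> and whose determinant is
  \<open>a b\<close>.\<close>

lemma P_mult: "P t * (a\<^sup>2 * (cos t)\<^sup>2 + b\<^sup>2 * (sin t)\<^sup>2)
    = ((a\<^sup>2 - b\<^sup>2) * (sin t * cos t))\<^sup>2 + a\<^sup>2 * b\<^sup>2"
proof -
  have "(sin t)\<^sup>2 + (cos t)\<^sup>2 = 1" by simp
  then show ?thesis unfolding P_def by algebra
qed

lemma cot_half_eq:
  assumes "level J (t, z)"
  shows "P t * cot_half J t z = z / J - (a\<^sup>2 - b\<^sup>2) * (sin t * cos t)"
  using P_pos[of t] by (simp add: cot_half_def)

text \<open>Division of \<open>J^2 P (t + d) = sin^2 d\<close> by \<open>sin^2 d\<close> leaves a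
  quadratic equation for \<open>X = cot d\<close>. Multiplication by \<open>P t\<close> completes
  the square, \<open>P_mult\<close> supplies the constant term, and the square is
  \<open>(z / J)^2\<close> by the definition of \<open>cot_half\<close>.\<close>

lemma level_quadratic:
  assumes "level J (t, z)"
  shows "J\<^sup>2 * (a\<^sup>2 * (cot_half J t z * sin t + cos t)\<^sup>2 + b\<^sup>2 * (cot_half J t z * cos t - sin t)\<^sup>2) = 1"
    (is "J\<^sup>2 * ?R = 1")
proof -
  have J: "J > 0" and e: "z\<^sup>2 + a\<^sup>2 * b\<^sup>2 * J\<^sup>2 = P t" using assms by (auto simp: level_def)
  define X where "X = cot_half J t z"
  have 1: "P t * X + (a\<^sup>2 - b\<^sup>2) * (sin t * cos t) = z / J"
    using cot_half_eq[OF assms] by (simp add: X_def)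
  have "P t * ?R = (P t * X + (a\<^sup>2 - b\<^sup>2) * (sin t * cos t))\<^sup>2 + a\<^sup>2 * b\<^sup>2"
    using P_mult[of t] unfolding X_def[symmetric] P_def by algebra
  then have "P t * (J\<^sup>2 * ?R) = z\<^sup>2 + a\<^sup>2 * b\<^sup>2 * J\<^sup>2"
    using J unfolding 1 by (simp add: field_simps power_divide)
  then show ?thesis using e P_pos[of t] by simp
qed

lemma sin_mid: "sin (t + half J t z) = sin (half J t z) * (cot_half J t z * sin t + cos t)"
  and cos_mid: "cos (t + half J t z) = sin (half J t z) * (cot_half J t z * cos t - sin t)"
  by (simp_all add: sin_add cos_add cos_half algebra_simps)

lemma level_mid:
  assumes "level J (t, z)"
  shows "J\<^sup>2 * P (t + half J t z) = (sin (half J t z))\<^sup>2"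
proof -
  have "J\<^sup>2 * P (t + half J t z) = (sin (half J t z))\<^sup>2 *
     (J\<^sup>2 * (a\<^sup>2 * (cot_half J t z * sin t + cos t)\<^sup>2 + b\<^sup>2 * (cot_half J t z * cos t - sin t)\<^sup>2))"
    unfolding P_def sin_mid cos_mid by algebra
  then show ?thesis using level_quadratic[OF assms] by simp
qed

text \<open>The momentum at the start is \<open>- next_mom J m (- d)\<close>. With
  \<open>A = sin d cos d / J\<close> and \<open>B = J (a^2 - b^2) sin m cos m\<close>, the momenta
  at the two ends of a chord are \<open>A - B\<close> and \<open>A + B\<close>; sums, differences
  and products of consecutive momenta are all read off from this.\<close>

lemma level_mom:
  assumes "level J (t, z)"
  defines "d \<equiv> half J t z" 
  shows "z = sin d * cos d / J - J * (a\<^sup>2 - b\<^sup>2) * (sin (t + d) * cos (t + d))"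
proof -
  have J: "J > 0" using assms by (auto simp: level_def)
  define X where "X = cot_half J t z"
  define R where "R = a\<^sup>2 * (X * sin t + cos t)\<^sup>2 + b\<^sup>2 * (X * cos t - sin t)\<^sup>2"
  have R: "J\<^sup>2 * R = 1" using level_quadratic[OF assms(1)] by (simp add: R_def X_def)
  have zJ: "z = J * (P t * X + (a\<^sup>2 - b\<^sup>2) * (sin t * cos t))"
    using cot_half_eq[OF assms(1)] J by (simp add: X_def field_simps)
  have S: "(sin d)\<^sup>2 * (1 + X\<^sup>2) = 1" using sin_half_sq by (simp add: d_def X_def)
  have cd: "cos d = X * sin d" using cos_half by (simp add: d_def X_def)
  have m: "sin (t + d) = sin d * (X * sin t + cos t)" "cos (t + d) = sin d * (X * cos t - sin t)"
    using sin_mid cos_mid by (simp_all add: d_def X_def)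
  have sc: "(sin t)\<^sup>2 + (cos t)\<^sup>2 = 1" by simp
  \<comment> \<open>A polynomial identity valid for every \<open>X\<close>; the level enters only
    afterwards, through \<open>J^2 R = 1\<close>.\<close>
  have id: "(P t * X + (a\<^sup>2 - b\<^sup>2) * (sin t * cos t)) * (1 + X\<^sup>2)
     = X * R - (a\<^sup>2 - b\<^sup>2) * ((X * sin t + cos t) * (X * cos t - sin t))"
    unfolding P_def R_def by algebra
  have "sin d * cos d / J = J * ((sin d)\<^sup>2 * X * R)"
    using R J by (simp add: cd field_simps power2_eq_square)
  then have "sin d * cos d / J - J * (a\<^sup>2 - b\<^sup>2) * (sin (t + d) * cos (t + d))
     = J * ((sin d)\<^sup>2 * (X * R - (a\<^sup>2 - b\<^sup>2) * ((X * sin t + cos t) * (X * cos t - sin t))))"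
    unfolding m by (simp add: algebra_simps power2_eq_square)
  also have "\<dots> = J * ((P t * X + (a\<^sup>2 - b\<^sup>2) * (sin t * cos t)) * ((sin d)\<^sup>2 * (1 + X\<^sup>2)))"
    unfolding id[symmetric] by (simp add: algebra_simps)
  also have "\<dots> = z" unfolding S zJ by simp
  finally show ?thesis by simp
qed

text \<open>Converse of \<open>level_mid\<close> and \<open>level_mom\<close>: the two equations
  determine \<open>d\<close> in \<open>(0, pi)\<close>. It serves where a chord is known by symmetry
  and its half-angle has to be recognized.\<close>

lemma half_eqI:
  assumes J: "J > 0" and d: "0 < d" "d < pi" and e: "J\<^sup>2 * P (t + d) = (sin d)\<^sup>2"
    and z: "z = sin d * cos d / J - J * (a\<^sup>2 - b\<^sup>2) * (sin (t + d) * cos (t + d))"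
  shows "half J t z = d"
proof -
  have sd: "sin d > 0" using d by (simp add: sin_gt_zero)
  define m where "m = t + d"
  have t: "t = m - d" by (simp add: m_def)
  have sm: "(sin m)\<^sup>2 + (cos m)\<^sup>2 = 1" "(sin d)\<^sup>2 + (cos d)\<^sup>2 = 1" by simp_all
  have z': "z * J = sin d * cos d - J\<^sup>2 * (a\<^sup>2 - b\<^sup>2) * (sin m * cos m)"
    using J by (simp add: z m_def field_simps power2_eq_square)
  have e': "J\<^sup>2 * (a\<^sup>2 * (sin m)\<^sup>2 + b\<^sup>2 * (cos m)\<^sup>2) = (sin d)\<^sup>2"
    using e by (simp add: m_def P_def)
  have st: "sin t = sin m * cos d - cos m * sin d" "cos t = cos m * cos d + sin m * sin d"
    by (simp_all add: t sin_diff cos_diff)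
  have "J\<^sup>2 * (P t * cos d) * 1 = (z * J - J\<^sup>2 * (a\<^sup>2 - b\<^sup>2) * (sin t * cos t)) * sin d"
    unfolding z' P_def st using sm e' by algebra
  also have "z * J - J\<^sup>2 * (a\<^sup>2 - b\<^sup>2) * (sin t * cos t) = J\<^sup>2 * (z / J - (a\<^sup>2 - b\<^sup>2) * (sin t * cos t))"
    using J by (simp add: field_simps power2_eq_square)
  finally have "P t * cos d = (z / J - (a\<^sup>2 - b\<^sup>2) * (sin t * cos t)) * sin d"
    using J by simp
  then have "cot_half J t z = cot d"
    using sd P_pos[of t] by (simp add: cot_half_def cot_def field_simps)
  also have "cot d = tan (pi / 2 - d)" by (simp add: tan_cot')
  finally have "arctan (cot_half J t z) = pi / 2 - d"
    using d by (simp add: arctan_tan)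
  then show ?thesis by (simp add: half_def)
qed

text \<open>\<open>J\<close> is conserved because the midpoint equation looks the same from either
  end. The sign of \<open>d\<close> is free: \<open>- d\<close> describes the start of the
  chord.\<close>

lemma level_end:
  assumes J: "J > 0" and e: "J\<^sup>2 * P m = (sin d)\<^sup>2"
  shows "level J (m + d, next_mom J m d)"
proof -
  have sm: "(sin m)\<^sup>2 + (cos m)\<^sup>2 = 1" "(sin d)\<^sup>2 + (cos d)\<^sup>2 = 1" by simp_all
  have e': "J\<^sup>2 * (a\<^sup>2 * (sin m)\<^sup>2 + b\<^sup>2 * (cos m)\<^sup>2) = (sin d)\<^sup>2"
    using e by (simp add: P_def)
  define z where "z = next_mom J m d"
  have z': "z * J = sin d * cos d + J\<^sup>2 * (a\<^sup>2 - b\<^sup>2) * (sin m * cos m)"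
    using J by (simp add: z_def next_mom_def field_simps power2_eq_square)
  have "(z * J)\<^sup>2 + a\<^sup>2 * b\<^sup>2 * (J\<^sup>2)\<^sup>2 = J\<^sup>2 * P (m + d)"
    unfolding z' P_def sin_add cos_add using sm e' by algebra
  then have "J\<^sup>2 * (z\<^sup>2 + a\<^sup>2 * b\<^sup>2 * J\<^sup>2) = J\<^sup>2 * P (m + d)" by algebra
  then show ?thesis using J by (simp add: level_def z_def)
qed

lemma level_step:
  assumes "level J w"
  shows "level J (step J w)"
proof -
  obtain t z where w: "w = (t, z)" by (cases w)
  have J: "J > 0" using assms by (auto simp: level_def w)
  have "level J (t + half J t z + half J t z, next_mom J (t + half J t z) (half J t z))"
    using level_mid assms J by (intro level_end) (auto simp: w)
  then show ?thesis by (simp add: step_def w algebra_simps)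
qed

lemma chord_alt:
  assumes "level J (t, z)"
  shows "chord J (t, z) = 2 * J * P (t + half J t z)"
  using level_mid[OF assms] assms by (auto simp: chord_def level_def field_simps power2_eq_square)

lemma chord_bounds:
  assumes "level J w"
  shows "2 * J * b\<^sup>2 \<le> chord J w" "chord J w \<le> 2 * J * a\<^sup>2"
proof -
  obtain t z where w: "w = (t, z)" by (cases w)
  show "2 * J * b\<^sup>2 \<le> chord J w" "chord J w \<le> 2 * J * a\<^sup>2"
    using assms P_ge[of "t + half J t z"] P_le[of "t + half J t z"] chord_alt[of J t z]
    by (auto simp: w level_def)
qed

lemma sin_half_bounds:
  assumes "level J (t, z)"
  shows "J * b \<le> sin (half J t z)" "sin (half J t z) \<le> J * a"
proof -
  have J: "J > 0" using assms by (auto simp: level_def)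
  have "(J * b)\<^sup>2 \<le> (sin (half J t z))\<^sup>2" "(sin (half J t z))\<^sup>2 \<le> (J * a)\<^sup>2"
    using level_mid[OF assms] P_ge[of "t + half J t z"] P_le[of "t + half J t z"]
    by (auto simp: power_mult_distrib mult_left_mono simp flip: level_mid[OF assms])
  then show "J * b \<le> sin (half J t z)" "sin (half J t z) \<le> J * a"
    using sin_half_pos[of J t z] J a_pos by (auto intro: power2_le_imp_le)
qed

text \<open>The product is \<open>(A - B) (A + B)\<close> in the notation of
  \<open>level_mom\<close>. For \<open>J a < 1\<close> both coefficients are positive, so on
  elliptic levels the momentum never changes sign and an orbit keeps its orientation.\<close>

lemma mom_product:
  assumes "level J (t, z)"
  defines "m \<equiv> t + half J t z"
  shows "z * snd (step J (t, z)) = a\<^sup>2 * (sin m)\<^sup>2 * (1 - J\<^sup>2 * a\<^sup>2) + b\<^sup>2 * (cos m)\<^sup>2 * (1 - J\<^sup>2 * b\<^sup>2)"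
proof -
  define d where "d = half J t z"
  have J: "J > 0" using assms by (auto simp: level_def)
  have sm: "(sin m)\<^sup>2 + (cos m)\<^sup>2 = 1" "(sin d)\<^sup>2 + (cos d)\<^sup>2 = 1" by simp_all
  have e': "J\<^sup>2 * (a\<^sup>2 * (sin m)\<^sup>2 + b\<^sup>2 * (cos m)\<^sup>2) = (sin d)\<^sup>2"
    using level_mid[OF assms(1)] by (simp add: P_def m_def d_def)
  define y where "y = snd (step J (t, z))"
  have y: "y * J = sin d * cos d + J\<^sup>2 * (a\<^sup>2 - b\<^sup>2) * (sin m * cos m)"
    using J by (simp add: y_def step_def next_mom_def m_def d_def field_simps power2_eq_square)
  have z: "z * J = sin d * cos d - J\<^sup>2 * (a\<^sup>2 - b\<^sup>2) * (sin m * cos m)"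
    using J by (subst level_mom[OF assms(1)]) (simp add: m_def d_def field_simps power2_eq_square)
  have "(z * J) * (y * J) = J\<^sup>2 * (a\<^sup>2 * (sin m)\<^sup>2 * (1 - J\<^sup>2 * a\<^sup>2) + b\<^sup>2 * (cos m)\<^sup>2 * (1 - J\<^sup>2 * b\<^sup>2))"
    unfolding y z using sm e' by algebra
  then have "J\<^sup>2 * (z * y) = J\<^sup>2 * (a\<^sup>2 * (sin m)\<^sup>2 * (1 - J\<^sup>2 * a\<^sup>2) + b\<^sup>2 * (cos m)\<^sup>2 * (1 - J\<^sup>2 * b\<^sup>2))"
    by algebra
  then show ?thesis using J by (simp add: y_def)
qed

lemma mom_product_pos:
  assumes "level J (t, z)" "J * a < 1"
  shows "0 < z * snd (step J (t, z))"
proof -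
  define m where "m = t + half J t z"
  have J: "J > 0" using assms by (auto simp: level_def)
  have Jb: "J * b < 1" using assms J b_le_a mult_left_mono[of b a J] by linarith
  have 1: "1 - J\<^sup>2 * a\<^sup>2 > 0" "1 - J\<^sup>2 * b\<^sup>2 > 0"
    using assms(2) Jb J a_pos b_pos
    by (auto simp: power_mult_distrib[symmetric] power_strict_mono abs_square_less_1)
  have "0 < a\<^sup>2 * (sin m)\<^sup>2 * (1 - J\<^sup>2 * a\<^sup>2) + b\<^sup>2 * (cos m)\<^sup>2 * (1 - J\<^sup>2 * b\<^sup>2)"
  proof (cases "sin m = 0")
    case True
    then have "(cos m)\<^sup>2 = 1" using sin_cos_squared_add[of m] by simp
    then show ?thesis using True 1 b_pos by simp
  next
    case False
    then have "0 < a\<^sup>2 * (sin m)\<^sup>2 * (1 - J\<^sup>2 * a\<^sup>2)" using 1 a_pos by simp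
    moreover have "0 \<le> b\<^sup>2 * (cos m)\<^sup>2 * (1 - J\<^sup>2 * b\<^sup>2)" using 1 by simp
    ultimately show ?thesis by linarith
  qed
  then show ?thesis using mom_product[OF assms(1)] by (simp add: m_def)
qed

end

section \<open>Poncelet porism\<close>

context ellipse_axes
begin

text \<open>
  The factor \<open>\<omega>\<close> is a change of time. It allows explicit parametrizations of the level curves in
  place of solutions of the pendulum equation in its natural time.
\<close>

definition pendulum :: "(real \<Rightarrow> real) \<Rightarrow> (real \<Rightarrow> real) \<Rightarrow> (real \<Rightarrow> real) \<Rightarrow> bool" where
  "pendulum \<omega> t z \<longleftrightarrow> (\<forall>x. (t has_real_derivative \<omega> x * z x) (at x) \<and>
     (z has_real_derivative \<omega> x * ((a\<^sup>2 - b\<^sup>2) * (sin (t x) * cos (t x)))) (at x))"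

definition total_length :: "real \<Rightarrow> nat \<Rightarrow> real \<times> real \<Rightarrow> real" where
  "total_length J n w = (\<Sum>i<n. chord J ((step J ^^ i) w))"

text \<open>The integer \<open>p\<close> counts turns of the lifted angle; in the plane an orbit
  closes up when some \<open>p\<close> exists.\<close>

definition closes :: "real \<Rightarrow> nat \<Rightarrow> int \<Rightarrow> real \<times> real \<Rightarrow> bool" where
  "closes J n p w \<longleftrightarrow> (step J ^^ n) w = (fst w + 2 * pi * of_int p, snd w)"

text \<open>If both ends of a chord move by the pendulum equation, then \<open>d\<close> must change
  at the rate \<open>(z2 - z1) / 2 = J (a^2 - b^2) sin m cos m\<close>. That this is the actual
  derivative of \<open>half\<close> is what makes the map commute with the flow.\<close>

lemma half_has_derivative:
  assumes t: "(t has_real_derivative w * z x) (at x)"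
    and z: "(z has_real_derivative w * ((a\<^sup>2 - b\<^sup>2) * (sin (t x) * cos (t x)))) (at x)"
    and lev: "level J (t x, z x)"
  defines "d \<equiv> half J (t x) (z x)"
  shows "((\<lambda>x. half J (t x) (z x)) has_real_derivative
     w * (J * (a\<^sup>2 - b\<^sup>2) * (sin (t x + d) * cos (t x + d)))) (at x)"
proof -
  have J: "J > 0" and e: "(z x)\<^sup>2 + a\<^sup>2 * b\<^sup>2 * J\<^sup>2 = P (t x)" using lev by (auto simp: level_def)
  define C where "C = a\<^sup>2 - b\<^sup>2"
  define s where "s = sin (t x)"
  define c where "c = cos (t x)"
  define N where "N = z x / J - C * (s * c)"
  define X where "X = cot_half J (t x) (z x)"
  define Q where "Q = P (t x)"
  have Q: "Q > 0" "Q = a\<^sup>2 * s\<^sup>2 + b\<^sup>2 * c\<^sup>2" by (simp_all add: Q_def P_pos) (simp add: P_def s_def c_def)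
  have XQ: "X = N / Q" by (simp add: X_def cot_half_def N_def C_def s_def c_def Q_def)
  define D where "D = ((C * (s * c) / J - C * (c\<^sup>2 - s\<^sup>2) * z x) * Q - N * (2 * C * (s * c) * z x)) / Q\<^sup>2"
  have dX: "((\<lambda>x. cot_half J (t x) (z x)) has_real_derivative w * D) (at x)"
  proof -
    have 1: "((\<lambda>x. z x / J - C * (sin (t x) * cos (t x))) has_real_derivative
        w * (C * (s * c)) / J - C * (w * z x * (c\<^sup>2 - s\<^sup>2))) (at x)"
      by (rule derivative_eq_intros DERIV_cdivide[OF z] t refl)+
         (simp add: s_def c_def C_def algebra_simps power2_eq_square)
    have 2: "((\<lambda>x. P (t x)) has_real_derivative 2 * C * (s * c) * (w * z x)) (at x)"
      unfolding P_def
      by (rule derivative_eq_intros t refl)+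
         (simp add: s_def c_def C_def algebra_simps power2_eq_square)
    have "w * D = ((w * (C * (s * c)) / J - C * (w * z x * (c\<^sup>2 - s\<^sup>2))) * P (t x) -
        (z x / J - C * (sin (t x) * cos (t x))) * (2 * C * (s * c) * (w * z x))) / (P (t x) * P (t x))"
      unfolding D_def N_def Q_def s_def c_def by (simp add: algebra_simps power2_eq_square)
    then show ?thesis
      unfolding cot_half_def C_def[symmetric] using DERIV_divide[OF 1 2] P_pos[of "t x"] by simp
  qed
  have dd: "((\<lambda>x. half J (t x) (z x)) has_real_derivative - (w * D / (1 + X\<^sup>2))) (at x)"
    unfolding half_def
    by (rule derivative_eq_intros dX refl)+ (simp add: X_def field_simps)
  have sc: "s\<^sup>2 + c\<^sup>2 = 1" by (simp add: s_def c_def)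
  have J2: "J * N = z x - J * C * (s * c)" using J by (simp add: N_def field_simps)
  have J3: "J * (C * (s * c) / J) = C * (s * c)" using J by simp
  \<comment> \<open>The factors \<open>J\<close> clear the divisions inside \<open>N\<close> and
    \<open>D\<close>; what remains follows polynomially from the level equation \<open>e\<close> and
    from \<open>sc\<close>.\<close>
  have "J * (J * ((N * s + Q * c) * (N * c - Q * s))) =
     (J * N * s + J * Q * c) * (J * N * c - J * Q * s)" by algebra
  also have "\<dots> = - ((s * c - J * (c\<^sup>2 - s\<^sup>2) * z x) * Q - (J * N) * (2 * (s * c) * z x))"
    using e sc unfolding J2 Q_def[symmetric] Q(2) C_def by algebra
  finally have "J * (J * (C * ((N * s + Q * c) * (N * c - Q * s)))) =
     - ((J * (C * (s * c) / J) - J * C * (c\<^sup>2 - s\<^sup>2) * z x) * Q - J * N * (2 * C * (s * c) * z x))"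
    unfolding J3 by algebra
  also have "\<dots> = J * - (D * Q\<^sup>2)"
  proof -
    have DQ: "D * Q\<^sup>2 = (C * (s * c) / J - C * (c\<^sup>2 - s\<^sup>2) * z x) * Q - N * (2 * C * (s * c) * z x)"
      using Q(1) by (simp add: D_def)
    show ?thesis unfolding DQ by algebra
  qed
  finally have eq: "J * (J * (C * ((N * s + Q * c) * (N * c - Q * s)))) = J * - (D * Q\<^sup>2)" .
  have "J \<noteq> 0" using J by simp
  then have "J * (C * ((N * s + Q * c) * (N * c - Q * s))) = - (D * Q\<^sup>2)"
    using eq by (rule iffD1[OF mult_left_cancel])
  moreover have "N = X * Q" using Q(1) by (simp add: XQ)
  ultimately have eq2: "Q\<^sup>2 * - D = Q\<^sup>2 * (J * C * ((X * s + c) * (X * c - s)))" by algebra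
  have "Q\<^sup>2 \<noteq> 0" using Q(1) by simp
  from iffD1[OF mult_left_cancel[OF this] eq2]
  have D: "- D = J * C * ((X * s + c) * (X * c - s))" .
  have S: "(sin d)\<^sup>2 * (1 + X\<^sup>2) = 1" using sin_half_sq by (simp add: d_def X_def)
  have m: "sin (t x + d) = sin d * (X * s + c)" "cos (t x + d) = sin d * (X * c - s)"
    using sin_mid cos_mid by (simp_all add: d_def X_def s_def c_def)
  have "1 + X\<^sup>2 > 0" by (simp add: add_pos_nonneg)
  then have "1 / (1 + X\<^sup>2) = (sin d)\<^sup>2" using S by (simp add: field_simps)
  then have "- (w * D / (1 + X\<^sup>2)) = w * (- D) * (sin d)\<^sup>2"
    by (simp flip: \<open>1 / (1 + X\<^sup>2) = (sin d)\<^sup>2\<close>)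
  also have "\<dots> = w * (J * C * (sin (t x + d) * cos (t x + d)))"
    unfolding m D by (simp add: power2_eq_square)
  finally show ?thesis using dd by (simp add: C_def)
qed

text \<open>The image of a solution solves the same equation with the same time change. The third
  claim is the first variation of length: the two ends contribute \<open>Z\<close> and
  \<open>- z\<close> times their speeds, in total \<open>w (Z^2 - z^2)\<close>, and
  \<open>Z^2 - z^2 = P T - P t\<close> on a common level.\<close>

lemma step_has_derivative:
  assumes t: "(t has_real_derivative w * z x) (at x)"
    and z: "(z has_real_derivative w * ((a\<^sup>2 - b\<^sup>2) * (sin (t x) * cos (t x)))) (at x)"
    and lev: "level J (t x, z x)"
  defines "T \<equiv> \<lambda>x. fst (step J (t x, z x))" and "Z \<equiv> \<lambda>x. snd (step J (t x, z x))"
  shows "(T has_real_derivative w * Z x) (at x)"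
    and "(Z has_real_derivative w * ((a\<^sup>2 - b\<^sup>2) * (sin (T x) * cos (T x)))) (at x)"
    and "((\<lambda>x. chord J (t x, z x)) has_real_derivative w * (P (T x) - P (t x))) (at x)"
proof -
  have J: "J > 0" using lev by (auto simp: level_def)
  define C where "C = a\<^sup>2 - b\<^sup>2"
  define h where "h = (\<lambda>x. half J (t x) (z x))"
  define d where "d = h x"
  define m where "m = t x + d"
  have dh: "(h has_real_derivative w * (J * C * (sin m * cos m))) (at x)"
    using half_has_derivative[OF t z lev] by (simp add: h_def C_def m_def d_def)
  have zx: "z x = sin d * cos d / J - J * C * (sin m * cos m)"
    using level_mom[OF lev] by (simp add: m_def d_def h_def C_def)
  have T: "T = (\<lambda>x. t x + 2 * h x)" by (simp add: T_def step_def h_def)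
  have Z: "Z = (\<lambda>x. sin (h x) * cos (h x) / J + J * C * (sin (t x + h x) * cos (t x + h x)))"
    by (simp add: Z_def step_def h_def next_mom_def C_def)
  have Zx: "Z x = sin d * cos d / J + J * C * (sin m * cos m)" by (simp add: Z d_def m_def)
  show "(T has_real_derivative w * Z x) (at x)"
    unfolding T by (rule derivative_eq_intros t dh refl)+ (simp add: Zx zx algebra_simps)
  have Tx: "T x = m + d" by (simp add: T m_def d_def)
  have dm: "((\<lambda>x. t x + h x) has_real_derivative w * (sin d * cos d / J)) (at x)"
    by (rule derivative_eq_intros t dh refl)+ (simp add: zx algebra_simps)
  have 1: "w * (C * (sin (m + d) * cos (m + d))) =
     w * C * (((cos d)\<^sup>2 - (sin d)\<^sup>2) * (sin m * cos m) + ((cos m)\<^sup>2 - (sin m)\<^sup>2) * (sin d * cos d))"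
    unfolding sin_add cos_add by algebra
  have "(Z has_real_derivative w * (C * (sin (m + d) * cos (m + d)))) (at x)"
  proof -
    have 2: "((\<lambda>x. sin (h x) * cos (h x)) has_real_derivative
        w * (J * C * (sin m * cos m)) * ((cos d)\<^sup>2 - (sin d)\<^sup>2)) (at x)"
      by (rule derivative_eq_intros dh refl)+ (simp add: d_def algebra_simps power2_eq_square)
    have 3: "((\<lambda>x. sin (t x + h x) * cos (t x + h x)) has_real_derivative
        w * (sin d * cos d / J) * ((cos m)\<^sup>2 - (sin m)\<^sup>2)) (at x)"
      by (rule derivative_eq_intros dm refl)+ (simp add: m_def d_def algebra_simps power2_eq_square)
    show ?thesis
      unfolding Z 1
      by (rule derivative_eq_intros DERIV_cdivide[OF 2] 3 refl)+ (use J in \<open>simp add: field_simps\<close>)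
  qed
  then show "(Z has_real_derivative w * ((a\<^sup>2 - b\<^sup>2) * (sin (T x) * cos (T x)))) (at x)"
    by (simp add: Tx C_def)
  have 2: "P (m + d) - P (m - d) = 4 * C * (sin m * cos m) * (sin d * cos d)"
    unfolding P_def sin_add cos_add sin_diff cos_diff C_def by algebra
  have "((\<lambda>x. 2 * (sin (h x))\<^sup>2 / J) has_real_derivative w * (P (m + d) - P (m - d))) (at x)"
  proof -
    have 3: "((\<lambda>x. 2 * (sin (h x))\<^sup>2) has_real_derivative
        4 * (sin d * cos d) * (w * (J * C * (sin m * cos m)))) (at x)"
      by (rule derivative_eq_intros dh refl)+ (simp add: d_def algebra_simps)
    show ?thesis using DERIV_cdivide[OF 3, of J] J unfolding 2 by (simp add: field_simps)
  qed
  then show "((\<lambda>x. chord J (t x, z x)) has_real_derivative w * (P (T x) - P (t x))) (at x)"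
    by (simp add: Tx chord_def h_def) (simp add: m_def)
qed

lemma level_iterate: "level J w \<Longrightarrow> level J ((step J ^^ n) w)"
  by (induction n) (auto intro: level_step)

lemma pendulum_iterate:
  assumes "pendulum \<omega> t z" "\<And>x. level J (t x, z x)"
  shows "pendulum \<omega> (\<lambda>x. fst ((step J ^^ n) (t x, z x))) (\<lambda>x. snd ((step J ^^ n) (t x, z x)))"
proof (induction n)
  case 0
  then show ?case using assms(1) by simp
next
  case (Suc n)
  show ?case
    unfolding pendulum_def
  proof
    fix x
    let ?t = "\<lambda>x. fst ((step J ^^ n) (t x, z x))"
    let ?z = "\<lambda>x. snd ((step J ^^ n) (t x, z x))"
    have lev: "level J (?t x, ?z x)" using level_iterate[OF assms(2)] by simp
    note step_has_derivative[of ?t "\<omega> x" ?z x, OF _ _ lev]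
    then show "((\<lambda>x. fst ((step J ^^ Suc n) (t x, z x))) has_real_derivative
          \<omega> x * snd ((step J ^^ Suc n) (t x, z x))) (at x) \<and>
         ((\<lambda>x. snd ((step J ^^ Suc n) (t x, z x))) has_real_derivative
          \<omega> x * ((a\<^sup>2 - b\<^sup>2) * (sin (fst ((step J ^^ Suc n) (t x, z x))) * cos (fst ((step J ^^ Suc n) (t x, z x)))))) (at x)"
      using Suc unfolding pendulum_def by simp
  qed
qed

lemma total_length_has_derivative:
  assumes "pendulum \<omega> t z" "\<And>x. level J (t x, z x)"
  shows "((\<lambda>x. total_length J n (t x, z x)) has_real_derivative
     \<omega> x * (P (fst ((step J ^^ n) (t x, z x))) - P (t x))) (at x)"
proof (induction n)
  case 0
  then show ?case by (simp add: total_length_def)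
next
  case (Suc n)
  let ?t = "\<lambda>x. fst ((step J ^^ n) (t x, z x))"
  let ?z = "\<lambda>x. snd ((step J ^^ n) (t x, z x))"
  have lev: "level J (?t x, ?z x)" using level_iterate[OF assms(2)] by simp
  have "((\<lambda>x. chord J ((step J ^^ n) (t x, z x))) has_real_derivative
     \<omega> x * (P (fst ((step J ^^ Suc n) (t x, z x))) - P (fst ((step J ^^ n) (t x, z x))))) (at x)"
    using step_has_derivative(3)[of ?t "\<omega> x" ?z x, OF _ _ lev] pendulum_iterate[OF assms, of n]
    by (simp add: pendulum_def)
  from DERIV_add[OF Suc this] show ?case
    by (simp add: total_length_def algebra_simps)
qed

section \<open>Uniqueness for the pendulum equation and periodicity in the angle\<close>

lemma sin_cos_lipschitz: "\<bar>sin x * cos x - sin y * cos y\<bar> \<le> \<bar>x - y\<bar>" for x y :: real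
proof -
  have "sin x * cos x - sin y * cos y = sin (x - y) * cos (x + y)"
  proof -
    have "(sin x)\<^sup>2 + (cos x)\<^sup>2 = 1" "(sin y)\<^sup>2 + (cos y)\<^sup>2 = 1" by simp_all
    then show ?thesis unfolding sin_diff cos_add by algebra
  qed
  moreover have "\<bar>sin (x - y)\<bar> * \<bar>cos (x + y)\<bar> \<le> \<bar>x - y\<bar> * 1"
    using abs_sin_x_le_abs_x[of "x - y"] by (intro mult_mono) auto
  ultimately show ?thesis by (simp add: abs_mult)
qed

text \<open>Gronwall's inequality for the squared distance \<open>E\<close> of the two solutions.
  Since \<open>\<bar>F x\<bar> \<le> K * E x\<close> for the derivative \<open>F\<close>, the
  function \<open>E x * exp (- K * x)\<close> decreases and \<open>E x * exp (K * x)\<close>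
  increases, so \<open>E\<close> cannot leave the value \<open>0\<close> in either direction. The
  bound \<open>W\<close> makes \<open>K\<close> uniform in \<open>x\<close>.\<close>

lemma pendulum_unique:
  assumes p: "pendulum \<omega> t z" "pendulum \<omega> t' z'" and W: "\<And>x. \<bar>\<omega> x\<bar> \<le> W"
    and eq: "t x0 = t' x0" "z x0 = z' x0"
  shows "t x = t' x \<and> z x = z' x"
proof -
  define C where "C = a\<^sup>2 - b\<^sup>2"
  define K where "K = W * (1 + \<bar>C\<bar>)"
  define E where "E = (\<lambda>x. (t x - t' x)\<^sup>2 + (z x - z' x)\<^sup>2)"
  define F where "F = (\<lambda>x. 2 * \<omega> x * ((t x - t' x) * (z x - z' x) +
      C * (z x - z' x) * (sin (t x) * cos (t x) - sin (t' x) * cos (t' x))))"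
  have dE: "(E has_real_derivative F x) (at x)" for x
  proof -
    have d: "(t has_real_derivative \<omega> x * z x) (at x)" "(t' has_real_derivative \<omega> x * z' x) (at x)"
      "(z has_real_derivative \<omega> x * (C * (sin (t x) * cos (t x)))) (at x)"
      "(z' has_real_derivative \<omega> x * (C * (sin (t' x) * cos (t' x)))) (at x)"
      using p by (auto simp: pendulum_def C_def)
    show ?thesis unfolding E_def
      by (rule derivative_eq_intros d refl)+ (simp add: F_def algebra_simps)
  qed
  have bound: "\<bar>F x\<bar> \<le> K * E x" for x
  proof -
    let ?u = "\<bar>t x - t' x\<bar>" and ?v = "\<bar>z x - z' x\<bar>"
    have "\<bar>F x\<bar> \<le> 2 * W * (?u * ?v + \<bar>C\<bar> * ?v * ?u)"
      unfolding F_def abs_mult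
    proof (intro mult_mono)
      show "\<bar>(t x - t' x) * (z x - z' x) + C * (z x - z' x) * (sin (t x) * cos (t x) - sin (t' x) * cos (t' x))\<bar>
         \<le> ?u * ?v + \<bar>C\<bar> * ?v * ?u"
        by (rule order_trans[OF abs_triangle_ineq])
           (auto simp: abs_mult intro!: add_mono mult_left_mono sin_cos_lipschitz)
      show "0 \<le> 2 * W" using W[of x] by linarith
    qed (use W in auto)
    also have "\<dots> = K * (2 * ?u * ?v)" by (simp add: K_def algebra_simps)
    also have "\<dots> \<le> K * E x"
    proof (intro mult_left_mono)
      show "2 * ?u * ?v \<le> E x" using sum_squares_bound[of ?u ?v] by (simp add: E_def)
      have "0 \<le> W" using W[of x] by linarith
      then show "0 \<le> K" by (simp add: K_def)
    qed
    finally show ?thesis .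
  qed
  have E0: "E x0 = 0" "E x \<ge> 0" by (simp_all add: E_def eq)
  have "E x = 0"
  proof (cases "x0 \<le> x")
    case True
    have "E x * exp (- K * x) \<le> E x0 * exp (- K * x0)"
    proof (rule DERIV_nonpos_imp_nonincreasing[OF True])
      fix y
      have "((\<lambda>y. E y * exp (- K * y)) has_real_derivative (F y - K * E y) * exp (- K * y)) (at y)"
        by (rule derivative_eq_intros dE refl)+ (simp add: algebra_simps)
      moreover have "(F y - K * E y) * exp (- K * y) \<le> 0"
        using bound[of y] by (intro mult_nonpos_nonneg) auto
      ultimately show "\<exists>D. ((\<lambda>y. E y * exp (- K * y)) has_real_derivative D) (at y) \<and> D \<le> 0" by blast
    qed
    then show ?thesis using E0 by (simp add: mult_le_0_iff)
  next
    case False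
    then have "x \<le> x0" by simp
    have "E x * exp (K * x) \<le> E x0 * exp (K * x0)"
    proof (rule DERIV_nonneg_imp_nondecreasing[OF \<open>x \<le> x0\<close>])
      fix y
      have "((\<lambda>y. E y * exp (K * y)) has_real_derivative (F y + K * E y) * exp (K * y)) (at y)"
        by (rule derivative_eq_intros dE refl)+ (simp add: algebra_simps)
      moreover have "(F y + K * E y) * exp (K * y) \<ge> 0"
        using bound[of y] by (intro mult_nonneg_nonneg) auto
      ultimately show "\<exists>D. ((\<lambda>y. E y * exp (K * y)) has_real_derivative D) (at y) \<and> D \<ge> 0" by blast
    qed
    then show ?thesis using E0 by (simp add: mult_le_0_iff)
  qed
  then show ?thesis by (simp add: E_def sum_power2_eq_zero_iff)
qed

text \<open>The force depends on \<open>2 t\<close> only, so half turns are symmetries. Shifts by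
  \<open>pi\<close> rather than \<open>2 pi\<close> allow the two vertices of the minor axis to be
  identified later.\<close>

lemma sin_cos_shift: "sin (t + pi * of_int n) * cos (t + pi * of_int n) = sin t * cos t"
proof -
  have "sin (2 * (t + pi * of_int n)) = sin (2 * t + 2 * pi * of_int n)" by (simp add: algebra_simps)
  also have "\<dots> = sin (2 * t)" by (simp only: sin_add sin_int_2pin cos_int_2pin mult_1_right mult_zero_right add_0_right)
  finally show ?thesis unfolding sin_double[of "t + pi * of_int n"] sin_double[of t] by simp
qed

lemma P_shift: "P (t + pi * of_int n) = P t"
proof -
  have P: "P t = (a\<^sup>2 + b\<^sup>2) / 2 - (a\<^sup>2 - b\<^sup>2) / 2 * cos (2 * t)" for t
    unfolding P_alt cos_double_sin by (simp add: field_simps)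
  have "cos (2 * (t + pi * of_int n)) = cos (2 * t + 2 * pi * of_int n)" by (simp add: algebra_simps)
  also have "\<dots> = cos (2 * t)" by (simp only: cos_add sin_int_2pin cos_int_2pin mult_1_right mult_zero_right diff_zero)
  finally show ?thesis by (simp add: P)
qed

lemma P_shift_2pi: "P (t + 2 * pi * of_int n) = P t"
  using P_shift[of t "2 * n"] by (simp add: algebra_simps)

lemma step_shift: "step J (t + pi * of_int n, z) = (fst (step J (t, z)) + pi * of_int n, snd (step J (t, z)))"
  and chord_shift: "chord J (t + pi * of_int n, z) = chord J (t, z)"
proof -
  have h: "half J (t + pi * of_int n) z = half J t z"
    by (simp only: half_def cot_half_def P_shift sin_cos_shift)
  show "chord J (t + pi * of_int n, z) = chord J (t, z)" by (simp add: chord_def h)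
  have eq: "t + pi * of_int n + half J t z = (t + half J t z) + pi * of_int n" by simp
  show "step J (t + pi * of_int n, z) = (fst (step J (t, z)) + pi * of_int n, snd (step J (t, z)))"
    unfolding step_def split h next_mom_def eq sin_cos_shift by simp
qed

lemma iterate_shift: "(step J ^^ k) (t + pi * of_int n, z) =
   (fst ((step J ^^ k) (t, z)) + pi * of_int n, snd ((step J ^^ k) (t, z)))"
proof (induction k)
  case (Suc k)
  then show ?case
    using step_shift[of J "fst ((step J ^^ k) (t, z))" n "snd ((step J ^^ k) (t, z))"] by simp
qed simp

lemma total_length_shift: "total_length J k (t + pi * of_int n, z) = total_length J k (t, z)"
  unfolding total_length_def iterate_shift using chord_shift by simp

lemma level_shift: "level J (t + pi * of_int n, z) \<longleftrightarrow> level J (t, z)"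
  by (simp add: level_def P_shift)

lemma closes_shift: "closes J k p (t + pi * of_int n, z) \<longleftrightarrow> closes J k p (t, z)"
  by (auto simp: closes_def iterate_shift prod_eq_iff)

lemma pendulum_shift:
  assumes "pendulum \<omega> t z" shows "pendulum \<omega> (\<lambda>x. t x + pi * of_int n) z"
  using assms unfolding pendulum_def sin_cos_shift
  by (auto intro!: derivative_eq_intros)

text \<open>The \<open>n\<close>-th iterate of a solution and its translate by \<open>2 pi p\<close>
  are both solutions; they agree at \<open>x0\<close>, hence everywhere. The derivative of the
  length is then a difference of values of \<open>P\<close> at angles that differ by full turns, so
  it vanishes.\<close>

lemma poncelet:
  assumes p: "pendulum \<omega> t z" and W: "\<And>x. \<bar>\<omega> x\<bar> \<le> W" and lev: "\<And>x. level J (t x, z x)"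
    and cl: "closes J n p (t x0, z x0)"
  shows "closes J n p (t x, z x)" and "total_length J n (t x, z x) = total_length J n (t x0, z x0)"
proof -
  have cl': "closes J n p (t x, z x)" for x
  proof -
    have "pendulum \<omega> (\<lambda>x. t x + 2 * pi * of_int p) z"
      using pendulum_shift[OF p, of "2 * p"] by (simp add: algebra_simps)
    from pendulum_unique[OF pendulum_iterate[OF p lev, of n] this W, where ?x0.0 = x0 and ?x = x]
    show ?thesis using cl by (simp add: closes_def prod_eq_iff)
  qed
  show "closes J n p (t x, z x)" by (rule cl')
  have "((\<lambda>x. total_length J n (t x, z x)) has_real_derivative 0) (at x)" for x
    using total_length_has_derivative[OF p lev, of n x] cl'[of x]
    by (simp add: closes_def P_shift_2pi)
  then show "total_length J n (t x, z x) = total_length J n (t x0, z x0)"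
    by (intro DERIV_isconst_all) auto
qed

section \<open>Explicit parametrizations of the level curves\<close>

definition mom :: "real \<Rightarrow> real \<Rightarrow> real" where
  "mom J t = sqrt (P t - a\<^sup>2 * b\<^sup>2 * J\<^sup>2)"

lemma P_has_derivative: "(P has_real_derivative 2 * ((a\<^sup>2 - b\<^sup>2) * (sin t * cos t))) (at t)"
  unfolding P_def[abs_def] by (rule derivative_eq_intros refl)+ (simp add: algebra_simps)

lemma mom_radicand: "b\<^sup>2 * (1 - a\<^sup>2 * J\<^sup>2) \<le> P t - a\<^sup>2 * b\<^sup>2 * J\<^sup>2"
  using P_ge[of t] by (simp add: algebra_simps)

lemma mom_radicand_pos:
  assumes "0 < J" "J * a < 1"
  shows "0 < b\<^sup>2 * (1 - a\<^sup>2 * J\<^sup>2)"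
proof -
  have "(J * a)\<^sup>2 < 1" using assms a_pos by (simp add: abs_square_less_1)
  then show ?thesis using b_pos by (simp add: power_mult_distrib mult.commute)
qed

lemma mom_sq:
  assumes "0 < J" "J * a < 1" shows "(mom J t)\<^sup>2 = P t - a\<^sup>2 * b\<^sup>2 * J\<^sup>2"
  using mom_radicand[of J t] mom_radicand_pos[OF assms] by (simp add: mom_def)

lemma mom_lower: "sqrt (b\<^sup>2 * (1 - a\<^sup>2 * J\<^sup>2)) \<le> mom J t"
  using mom_radicand[of J t] by (simp add: mom_def)

lemma mom_pos:
  assumes "0 < J" "J * a < 1" shows "0 < mom J t"
  using mom_lower[of J t] mom_radicand_pos[OF assms] by (meson less_le_trans real_sqrt_gt_zero)

lemma level_mom_iff:
  assumes "0 < J" "J * a < 1" 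
  shows "level J (t, z) \<longleftrightarrow> z = mom J t \<or> z = - mom J t"
proof -
  have "level J (t, z) \<longleftrightarrow> z\<^sup>2 = (mom J t)\<^sup>2" using mom_sq[OF assms, of t] assms by (auto simp: level_def)
  then show ?thesis by (simp add: power2_eq_iff)
qed

lemma mom_has_derivative:
  assumes "0 < J" "J * a < 1"
  shows "(mom J has_real_derivative (a\<^sup>2 - b\<^sup>2) * (sin t * cos t) / mom J t) (at t)"
proof -
  have 1: "0 < P t - a\<^sup>2 * b\<^sup>2 * J\<^sup>2"
    using mom_radicand[of J t] mom_radicand_pos[OF assms] by linarith
  have 2: "((\<lambda>t. P t - a\<^sup>2 * b\<^sup>2 * J\<^sup>2) has_real_derivative 2 * ((a\<^sup>2 - b\<^sup>2) * (sin t * cos t))) (at t)"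
    by (rule DERIV_cong[OF DERIV_diff[OF P_has_derivative DERIV_const]]) simp
  have eq: "inverse q / 2 * (2 * x) = x / q" for q x :: real by (simp add: divide_simps)
  show ?thesis unfolding mom_def[abs_def]
    by (rule DERIV_cong[OF DERIV_chain2[OF DERIV_real_sqrt[OF 1] 2]]) (simp only: eq)
qed

text \<open>On an elliptic level the momentum never vanishes, so the angle itself can be the
  parameter; the sign \<open>\<sigma>\<close> is the orientation.\<close>

lemma pendulum_elliptic:
  assumes "0 < J" "J * a < 1" "\<sigma>\<^sup>2 = 1"
  shows "pendulum (\<lambda>x. 1 / (\<sigma> * mom J x)) (\<lambda>x. x) (\<lambda>x. \<sigma> * mom J x)"
    and "\<bar>1 / (\<sigma> * mom J x)\<bar> \<le> 1 / sqrt (b\<^sup>2 * (1 - a\<^sup>2 * J\<^sup>2))"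
proof -
  have \<sigma>: "\<sigma> = 1 \<or> \<sigma> = -1" using assms(3) by (simp add: power2_eq_1_iff)
  have m: "mom J x > 0" for x by (rule mom_pos[OF assms(1,2)])
  show "pendulum (\<lambda>x. 1 / (\<sigma> * mom J x)) (\<lambda>x. x) (\<lambda>x. \<sigma> * mom J x)"
    unfolding pendulum_def
  proof (intro allI conjI)
    fix x
    show "((\<lambda>x. x) has_real_derivative 1 / (\<sigma> * mom J x) * (\<sigma> * mom J x)) (at x)"
      using m[of x] \<sigma> by (auto intro!: derivative_eq_intros)
    show "((\<lambda>x. \<sigma> * mom J x) has_real_derivative
        1 / (\<sigma> * mom J x) * ((a\<^sup>2 - b\<^sup>2) * (sin x * cos x))) (at x)"
      by (rule DERIV_cong[OF DERIV_cmult[OF mom_has_derivative[OF assms(1,2)]]]) (use \<sigma> in auto)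
  qed
  have "\<bar>1 / (\<sigma> * mom J x)\<bar> = 1 / mom J x" using \<sigma> m[of x] by auto
  also have "\<dots> \<le> 1 / sqrt (b\<^sup>2 * (1 - a\<^sup>2 * J\<^sup>2))"
    using mom_lower[of J x] mom_radicand_pos[OF assms(1,2)] m[of x]
    by (intro divide_left_mono) auto
  finally show "\<bar>1 / (\<sigma> * mom J x)\<bar> \<le> 1 / sqrt (b\<^sup>2 * (1 - a\<^sup>2 * J\<^sup>2))" .
qed

text \<open>For \<open>J a > 1\<close> the level curve consists of ovals
  \<open>z^2 + C cos^2 t = C k^2\<close> around the angles \<open>pi / 2 + n pi\<close>. In the
  coordinates \<open>(cos t, z)\<close> they are ellipses and are parametrized as such; up to the
  factor \<open>1 / sqrt C\<close> the time change is the integrand of the elliptic integral of the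
  first kind with modulus \<open>k\<close>.\<close>

lemma pendulum_libration:
  assumes "0 < C" "C = a\<^sup>2 - b\<^sup>2" "0 \<le> k" "k < 1"
  defines "r \<equiv> \<lambda>x. sqrt (1 - k\<^sup>2 * (sin x)\<^sup>2)"
  shows "pendulum (\<lambda>x. 1 / (sqrt C * r x)) (\<lambda>x. pi / 2 + arcsin (k * sin x)) (\<lambda>x. sqrt C * k * cos x)"
    and "\<bar>1 / (sqrt C * r x)\<bar> \<le> 1 / (sqrt C * sqrt (1 - k\<^sup>2))"
proof -
  have k2: "k\<^sup>2 < 1" using assms by (simp add: abs_square_less_1)
  have le: "k\<^sup>2 * (sin x)\<^sup>2 \<le> k\<^sup>2" for x
    by (rule mult_left_le) (auto simp: abs_square_le_1)
  have r: "sqrt (1 - k\<^sup>2) \<le> r x" "r x > 0" "sqrt (1 - k\<^sup>2) > 0" for x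
    using le[of x] k2 by (auto simp: r_def)
  have kx: "-1 < k * sin x \<and> k * sin x < 1" for x
  proof -
    have "(k * sin x)\<^sup>2 < 1" using le[of x] k2 by (simp add: power_mult_distrib)
    then show ?thesis by (simp add: abs_square_less_1) linarith
  qed
  have rx: "r x = sqrt (1 - (k * sin x)\<^sup>2)" for x by (simp add: r_def power_mult_distrib)
  show "pendulum (\<lambda>x. 1 / (sqrt C * r x)) (\<lambda>x. pi / 2 + arcsin (k * sin x)) (\<lambda>x. sqrt C * k * cos x)"
    unfolding pendulum_def
  proof (intro allI conjI)
    fix x
    have "((\<lambda>x. arcsin (k * sin x)) has_real_derivative inverse (sqrt (1 - (k * sin x)\<^sup>2)) * (k * cos x)) (at x)"
      using kx[of x] by (intro DERIV_chain2[of arcsin] DERIV_arcsin) (auto intro!: derivative_eq_intros)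
    then have "((\<lambda>x. arcsin (k * sin x)) has_real_derivative k * cos x / r x) (at x)"
      unfolding rx[symmetric] by (simp add: field_simps)
    then show "((\<lambda>x. pi / 2 + arcsin (k * sin x)) has_real_derivative 1 / (sqrt C * r x) * (sqrt C * k * cos x)) (at x)"
      using DERIV_add[OF DERIV_const] assms(1) by fastforce
    have sc: "sin (pi / 2 + arcsin (k * sin x)) = r x" "cos (pi / 2 + arcsin (k * sin x)) = - (k * sin x)"
      using kx[of x] by (auto simp: sin_add cos_add cos_arcsin rx)
    have "((\<lambda>x. sqrt C * k * cos x) has_real_derivative - (sqrt C * k * sin x)) (at x)"
      by (auto intro!: derivative_eq_intros)
    moreover have "- (sqrt C * k * sin x) = 1 / (sqrt C * r x) * (C * (r x * - (k * sin x)))"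
      using assms(1) r(2)[of x] by (simp add: real_div_sqrt field_simps)
    ultimately show "((\<lambda>x. sqrt C * k * cos x) has_real_derivative
        1 / (sqrt C * r x) * ((a\<^sup>2 - b\<^sup>2) *
         (sin (pi / 2 + arcsin (k * sin x)) * cos (pi / 2 + arcsin (k * sin x))))) (at x)"
      unfolding sc assms(2)[symmetric] by simp
  qed
  show "\<bar>1 / (sqrt C * r x)\<bar> \<le> 1 / (sqrt C * sqrt (1 - k\<^sup>2))"
  proof -
    have "0 < sqrt C * r x" "0 < sqrt C * sqrt (1 - k\<^sup>2)"
      using r(2)[of x] r(3) assms(1) by (intro mult_pos_pos; simp)+
    moreover have "sqrt C * sqrt (1 - k\<^sup>2) \<le> sqrt C * r x"
      using r(1)[of x] assms(1) by (intro mult_left_mono) auto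
    ultimately show ?thesis by (simp add: frac_le)
  qed
qed

text \<open>For \<open>J a = 1\<close> the curve is \<open>z = r sin t\<close>, which joins the
  equilibria at the angles \<open>0\<close> and \<open>pi\<close>. Here the equation reduces to
  \<open>dt = r sin t\<close> and has an elementary solution in the natural time.\<close>

lemma pendulum_separatrix:
  assumes "r\<^sup>2 = a\<^sup>2 - b\<^sup>2"
  shows "pendulum (\<lambda>x. 1) (\<lambda>x. 2 * arctan (exp (r * x))) (\<lambda>x. r * sin (2 * arctan (exp (r * x))))"
proof -
  define y where "y = (\<lambda>x. 2 * arctan (exp (r * x)))"
  have dy: "(y has_real_derivative r * sin (y x)) (at x)" for x
  proof -
    have s: "sin (2 * arctan u) = 2 * u / (1 + u\<^sup>2)" for u :: real
    proof -
      have "sin (2 * arctan u) = 2 * (u / sqrt (1 + u\<^sup>2)) * (1 / sqrt (1 + u\<^sup>2))"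
        by (simp only: sin_double sin_arctan cos_arctan)
      then show ?thesis by (simp add: real_sqrt_mult_self)
    qed
    show ?thesis unfolding y_def s
      by (rule derivative_eq_intros refl)+ (simp add: field_simps)
  qed
  have "((\<lambda>x. r * sin (y x)) has_real_derivative 1 * ((a\<^sup>2 - b\<^sup>2) * (sin (y x) * cos (y x)))) (at x)" for x
    by (rule derivative_eq_intros dy refl)+ (use assms in algebra)
  with dy show ?thesis by (simp add: pendulum_def y_def)
qed

text \<open>The excluded states are the equilibria of the pendulum: orbits along an axis, or along
  any diameter of a circle. The target is a vertex of the minor axis because the ovals with
  \<open>J a > 1\<close> surround these vertices and avoid those of the major axis.\<close>

lemma curve_to_vertex:
  assumes lev: "level J (t0, z0)" and ne: "\<not> (z0 = 0 \<and> (a\<^sup>2 - b\<^sup>2) * (sin t0 * cos t0) = 0)"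
  obtains \<omega> t z W x0 x1 and k :: int where "pendulum \<omega> t z" "\<And>x. \<bar>\<omega> x\<bar> \<le> W" "\<And>x. level J (t x, z x)"
    "t x0 = t0" "z x0 = z0" "t x1 = pi / 2 + pi * of_int k"
proof -
  have J: "J > 0" and e: "z0\<^sup>2 + a\<^sup>2 * b\<^sup>2 * J\<^sup>2 = P t0" using lev by (auto simp: level_def)
  define C where "C = a\<^sup>2 - b\<^sup>2"
  have C0: "C \<ge> 0" using b_pos b_le_a by (simp add: C_def power_mono)
  consider "J * a < 1" | "J * a = 1" | "J * a > 1" by linarith
  then show thesis
  proof cases
    case 1
    define \<sigma> where "\<sigma> = (if z0 = mom J t0 then 1 else -1 :: real)"
    have \<sigma>: "\<sigma>\<^sup>2 = 1" "z0 = \<sigma> * mom J t0" using lev level_mom_iff[OF J 1, of t0 z0] by (auto simp: \<sigma>_def)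
    have "level J (x, \<sigma> * mom J x)" for x
      unfolding level_mom_iff[OF J 1] by (simp add: \<sigma>_def)
    then show thesis
      using that[OF pendulum_elliptic[OF J 1 \<sigma>(1)], where ?x0.0 = t0 and ?x1.0 = "pi / 2" and k = 0] \<sigma>(2)
      by simp
  next
    case 2
    have zz: "z0\<^sup>2 = C * (sin t0)\<^sup>2"
    proof -
      have "a\<^sup>2 * b\<^sup>2 * J\<^sup>2 = (J * a)\<^sup>2 * b\<^sup>2" by algebra
      then have "a\<^sup>2 * b\<^sup>2 * J\<^sup>2 = b\<^sup>2" unfolding 2 by simp
      then show ?thesis using e unfolding P_alt C_def by linarith
    qed
    define n where "n = \<lfloor>t0 / pi\<rfloor>"
    define u where "u = t0 - pi * of_int n"
    have t0: "t0 = u + pi * of_int n" by (simp add: u_def)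
    have "C \<noteq> 0" "sin t0 \<noteq> 0" using ne zz by (auto simp: C_def)
    then have C: "C > 0" using C0 by simp
    have u: "0 \<le> u" "u < pi"
      using floor_divide_lower[of pi t0] floor_divide_upper[of pi t0] unfolding u_def n_def
      by (auto simp: algebra_simps)
    have su2: "(sin t0)\<^sup>2 = (sin u)\<^sup>2"
      using P_shift[of u n] C by (simp add: t0 P_alt C_def)
    have "u \<noteq> 0" using \<open>sin t0 \<noteq> 0\<close> su2 by (intro notI) simp
    then have u0: "0 < u" "sin u > 0" using u by (auto intro: sin_gt_zero)
    define r where "r = (if z0 > 0 then sqrt C else - sqrt C)"
    have r: "r\<^sup>2 = C" "r \<noteq> 0" using C by (auto simp: r_def)
    have "z0\<^sup>2 = (r * sin u)\<^sup>2" using zz r su2 by (simp add: power_mult_distrib)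
    moreover have "z0 \<noteq> 0" using zz C \<open>sin t0 \<noteq> 0\<close> by auto
    ultimately have z0: "z0 = r * sin u"
    proof -
      assume h: "z0\<^sup>2 = (r * sin u)\<^sup>2" "z0 \<noteq> 0"
      have "sqrt C * sin u > 0" using C u0 by simp
      then show ?thesis using h unfolding power2_eq_iff r_def by (auto split: if_splits)
    qed
    define x0 where "x0 = ln (tan (u / 2)) / r"
    have "tan (u / 2) > 0" using u0 u by (intro tan_gt_zero) auto
    then have x0: "2 * arctan (exp (r * x0)) = u"
      using r u u0 by (simp add: x0_def arctan_tan)
    let ?t = "\<lambda>x. 2 * arctan (exp (r * x)) + pi * of_int n"
    let ?z = "\<lambda>x. r * sin (2 * arctan (exp (r * x)))"
    have "level J (?t x, ?z x)" for x
    proof -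
      have "level J (2 * arctan (exp (r * x)), ?z x)"
        using J 2 r unfolding level_def P_alt 
        by (auto simp: C_def power_mult_distrib) (metis mult.commute mult.left_neutral power_mult_distrib power_one)
      then show ?thesis by (simp add: level_shift)
    qed
    moreover have "pendulum (\<lambda>x. 1) ?t ?z"
      using pendulum_shift[OF pendulum_separatrix] r by (simp add: C_def)
    ultimately show thesis
      using x0 z0 t0
      by (intro that[of "\<lambda>x. 1" ?t ?z 1 x0 0 n]) (auto simp: arctan_one)
  next
    case 3
    have "b\<^sup>2 * 1 < b\<^sup>2 * (J * a)\<^sup>2" using 3 b_pos by (intro mult_strict_left_mono) auto
    then have JJ: "b\<^sup>2 < a\<^sup>2 * b\<^sup>2 * J\<^sup>2" by (simp add: power_mult_distrib mult_ac)
    then have "a\<^sup>2 - a\<^sup>2 * b\<^sup>2 * J\<^sup>2 < C" by (simp add: C_def)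
    have zz: "z0\<^sup>2 + C * (cos t0)\<^sup>2 = a\<^sup>2 - a\<^sup>2 * b\<^sup>2 * J\<^sup>2"
      using e unfolding P_alt sin_squared_eq by (simp add: C_def algebra_simps)
    define E where "E = a\<^sup>2 - a\<^sup>2 * b\<^sup>2 * J\<^sup>2"
    have E: "0 \<le> E" "E < C" 
    proof -
      show "0 \<le> E" unfolding E_def zz[symmetric] using C0 by simp
      show "E < C" using JJ by (simp add: E_def C_def)
    qed
    have C: "C > 0" using E by linarith
    \<comment> \<open>The amplitude of the oval, from
      \<open>z0^2 + C cos^2 t0 = E = C k^2\<close>.\<close>
    define k where "k = sqrt (E / C)"
    have k2: "k\<^sup>2 = E / C" using E C by (simp add: k_def)
    have "k < 1" "k \<ge> 0" using E C by (auto simp: k_def)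
    have "E \<noteq> 0"
    proof
      assume "E = 0"
      then have "z0\<^sup>2 + C * (cos t0)\<^sup>2 = 0" using zz by (simp add: E_def)
      moreover have "C * (cos t0)\<^sup>2 \<ge> 0" using C by simp
      ultimately have "z0\<^sup>2 = 0" "C * (cos t0)\<^sup>2 = 0" using zero_le_power2[of z0] by linarith+
      then show False using ne C by auto
    qed
    then have k0: "k > 0" using E C by (simp add: k_def)
    define n where "n = \<lfloor>t0 / pi\<rfloor>"
    define u where "u = t0 - pi * of_int n - pi / 2"
    have t0: "t0 = pi / 2 + u + pi * of_int n" by (simp add: u_def)
    have u: "- (pi / 2) \<le> u" "u \<le> pi / 2"
      using floor_divide_lower[of pi t0] floor_divide_upper[of pi t0] unfolding u_def n_def
      by (auto simp: algebra_simps)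
    have "P t0 = P (pi / 2 + u)" using P_shift[of "pi / 2 + u" n] by (simp add: t0)
    then have "(sin t0)\<^sup>2 = (cos u)\<^sup>2"
      using C by (simp add: P_alt C_def sin_add)
    then have c2: "(cos t0)\<^sup>2 = (sin u)\<^sup>2"
      using sin_cos_squared_add[of t0] sin_cos_squared_add[of u] by linarith
    have "(sin u / k)\<^sup>2 + (z0 / (sqrt C * k))\<^sup>2 = (C * (sin u)\<^sup>2 + z0\<^sup>2) / E"
      using E C k0 \<open>E \<noteq> 0\<close> by (simp add: power_divide power_mult_distrib k2 field_simps)
    also have "\<dots> = 1" using zz c2 \<open>E \<noteq> 0\<close> by (simp add: E_def)
    finally obtain x0 where x0: "sin u / k = sin x0" "z0 / (sqrt C * k) = cos x0"
      using sincos_total_2pi[of "z0 / (sqrt C * k)" "sin u / k"] by (metis add.commute)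
    have x0': "k * sin x0 = sin u" "sqrt C * k * cos x0 = z0"
      using k0 C x0 by (auto simp: field_simps simp flip: x0)
    let ?t = "\<lambda>x. pi / 2 + arcsin (k * sin x) + pi * of_int n"
    let ?z = "\<lambda>x. sqrt C * k * cos x"
    note L = pendulum_libration[OF C C_def less_imp_le[OF k0] \<open>k < 1\<close>]
    have "level J (?t x, ?z x)" for x
    proof -
      have "(k * sin x)\<^sup>2 \<le> 1"
        using \<open>k < 1\<close> k0 by (simp add: power_mult_distrib abs_square_le_1 mult_le_one)
      then have kx: "-1 \<le> k * sin x" "k * sin x \<le> 1" by (auto simp: abs_square_le_1 abs_le_iff)
      have "sin (pi / 2 + arcsin (k * sin x)) = sqrt (1 - (k * sin x)\<^sup>2)"
        using kx by (simp add: sin_add cos_arcsin)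
      then have "P (pi / 2 + arcsin (k * sin x)) = b\<^sup>2 + C * (1 - (k * sin x)\<^sup>2)"
        using \<open>(k * sin x)\<^sup>2 \<le> 1\<close> by (simp add: P_alt C_def)
      also have "\<dots> = b\<^sup>2 + C - E * (sin x)\<^sup>2"
        using C by (simp add: power_mult_distrib k2 field_simps)
      also have "\<dots> = (sqrt C * k * cos x)\<^sup>2 + a\<^sup>2 * b\<^sup>2 * J\<^sup>2"
      proof -
        have "(sqrt C * k * cos x)\<^sup>2 = E * (1 - (sin x)\<^sup>2)"
          using C by (simp add: power_mult_distrib k2 cos_squared_eq)
        then show ?thesis by (simp add: E_def C_def algebra_simps)
      qed
      finally have "level J (pi / 2 + arcsin (k * sin x), ?z x)" using J by (simp add: level_def)
      then show ?thesis by (simp add: level_shift)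
    qed
    moreover have "?t x0 = t0" using u by (simp add: x0' arcsin_sin t0)
    moreover have "?t 0 = pi / 2 + pi * of_int n" by simp
    ultimately show thesis
      using that[OF pendulum_shift[OF L(1)] L(2)] x0'(2) by blast
  qed
qed

end

section \<open>Finiteness of the lengths of closed orbits with a given number of segments\<close>

text \<open>One pair of polynomials has to serve all of \<open>S\<close>; this makes the zero set
  finite as soon as a single value differs from \<open>0\<close>.\<close>

definition rational_on :: "real set \<Rightarrow> (real \<Rightarrow> real) \<Rightarrow> bool" where
  "rational_on S f \<longleftrightarrow> (\<exists>p q. \<forall>s\<in>S. poly q s \<noteq> 0 \<and> f s = poly p s / poly q s)"

lemma rational_on_const: "rational_on S (\<lambda>s. c)"
  unfolding rational_on_def by (rule exI[of _ "[:c:]"], rule exI[of _ "[:1:]"]) simp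

lemma rational_on_id: "rational_on S (\<lambda>s. s)"
  unfolding rational_on_def by (rule exI[of _ "[:0, 1:]"], rule exI[of _ "[:1:]"]) simp

lemma rational_on_add:
  assumes "rational_on S f" "rational_on S g" shows "rational_on S (\<lambda>s. f s + g s)"
proof -
  obtain p q p' q' where "\<forall>s\<in>S. poly q s \<noteq> 0 \<and> f s = poly p s / poly q s"
    "\<forall>s\<in>S. poly q' s \<noteq> 0 \<and> g s = poly p' s / poly q' s"
    using assms unfolding rational_on_def by blast
  then show ?thesis unfolding rational_on_def
    by (intro exI[of _ "p * q' + p' * q"] exI[of _ "q * q'"]) (auto simp: add_frac_eq)
qed

lemma rational_on_mult:
  assumes "rational_on S f" "rational_on S g" shows "rational_on S (\<lambda>s. f s * g s)"
proof -
  obtain p q p' q' where "\<forall>s\<in>S. poly q s \<noteq> 0 \<and> f s = poly p s / poly q s"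
    "\<forall>s\<in>S. poly q' s \<noteq> 0 \<and> g s = poly p' s / poly q' s"
    using assms unfolding rational_on_def by blast
  then show ?thesis unfolding rational_on_def
    by (intro exI[of _ "p * p'"] exI[of _ "q * q'"]) auto
qed

lemma rational_on_diff:
  assumes "rational_on S f" "rational_on S g" shows "rational_on S (\<lambda>s. f s - g s)"
  using rational_on_add[OF assms(1) rational_on_mult[OF rational_on_const[of S "-1"] assms(2)]] by simp

lemma rational_on_divide:
  assumes "rational_on S f" "rational_on S g" "\<And>s. s \<in> S \<Longrightarrow> g s \<noteq> 0"
  shows "rational_on S (\<lambda>s. f s / g s)"
proof -
  obtain p q p' q' where "\<forall>s\<in>S. poly q s \<noteq> 0 \<and> f s = poly p s / poly q s"
    "\<forall>s\<in>S. poly q' s \<noteq> 0 \<and> g s = poly p' s / poly q' s"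
    using assms unfolding rational_on_def by blast
  then show ?thesis using assms(3) unfolding rational_on_def
    by (intro exI[of _ "p * q'"] exI[of _ "q * p'"]) auto
qed

lemma rational_on_power: "rational_on S f \<Longrightarrow> rational_on S (\<lambda>s. f s ^ n)"
  by (induction n) (auto intro: rational_on_const rational_on_mult)

lemmas rational_on_intros = rational_on_const rational_on_id rational_on_add rational_on_mult
  rational_on_diff rational_on_divide rational_on_power

lemma rational_on_finite_zeros:
  assumes "rational_on S f" "s0 \<in> S" "f s0 \<noteq> 0"
  shows "finite {s \<in> S. f s = 0}"
proof -
  obtain p q where pq: "\<forall>s\<in>S. poly q s \<noteq> 0 \<and> f s = poly p s / poly q s"
    using assms(1) unfolding rational_on_def by blast
  then have "p \<noteq> 0" using assms(2,3) by auto
  then have "finite {s. poly p s = 0}" by (rule poly_roots_finite)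
  moreover have "{s \<in> S. f s = 0} \<subseteq> {s. poly p s = 0}" using pq by auto
  ultimately show ?thesis by (rule rev_finite_subset)
qed

context ellipse_axes
begin

section \<open>The counterclockwise component of an elliptic level as a lifted circle map\<close>

definition fwd :: "real \<Rightarrow> real \<Rightarrow> real" where
  "fwd J t = t + 2 * half J t (mom J t)"

lemma level_mom_pos: "0 < J \<Longrightarrow> J * a < 1 \<Longrightarrow> level J (t, mom J t)"
  by (simp add: level_mom_iff)

text \<open>The momentum keeps its sign, so the image is again on the branch \<open>mom\<close>. The
  sum of the two momenta is \<open>2 sin d cos d / J > 0\<close>, which forces
  \<open>d < pi / 2\<close>; only then does the bound \<open>sin d \<le> J * a\<close> control
  \<open>d\<close> itself.\<close>

lemma step_elliptic:
  assumes "0 < J" "J * a < 1"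
  shows "step J (t, mom J t) = (fwd J t, mom J (fwd J t))"
    and "half J t (mom J t) < pi / 2"
proof -
  note lev = level_mom_pos[OF assms, of t]
  define d where "d = half J t (mom J t)"
  define z2 where "z2 = snd (step J (t, mom J t))"
  have st: "step J (t, mom J t) = (fwd J t, z2)" by (simp add: z2_def step_def fwd_def)
  have "mom J t > 0" by (rule mom_pos[OF assms])
  then have z2: "z2 > 0" using mom_product_pos[OF lev assms(2)] by (simp add: z2_def zero_less_mult_iff)
  have "level J (fwd J t, z2)" using level_step[OF lev] st by simp
  then have "z2 = mom J (fwd J t)"
    using z2 mom_pos[OF assms, of "fwd J t"] by (auto simp: level_mom_iff[OF assms])
  then show "step J (t, mom J t) = (fwd J t, mom J (fwd J t))" using st by simp
  have "mom J t + z2 = 2 * (sin d * cos d / J)"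
    using level_mom[OF lev] by (simp add: z2_def step_def next_mom_def d_def)
  then have "0 < sin d * cos d" using z2 \<open>mom J t > 0\<close> assms(1)
    by (smt (verit) divide_le_0_iff)
  then have "0 < cos d" using sin_half_pos[of J t "mom J t"] by (simp add: d_def zero_less_mult_iff)
  then have "\<not> pi / 2 \<le> d"
    using cos_monotone_0_pi_le[of "pi / 2" d] half_less_pi[of J t "mom J t"] by (auto simp: d_def)
  then show "half J t (mom J t) < pi / 2" by (simp add: d_def)
qed

lemma iterate_elliptic:
  assumes "0 < J" "J * a < 1"
  shows "(step J ^^ n) (t, mom J t) = ((fwd J ^^ n) t, mom J ((fwd J ^^ n) t))"
  by (induction n) (simp_all add: step_elliptic(1)[OF assms])

lemma half_elliptic_bounds:
  assumes "0 < J" "J * a < 1"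
  shows "J * b \<le> half J t (mom J t)" "half J t (mom J t) \<le> arcsin (J * a)"
proof -
  define d where "d = half J t (mom J t)"
  have s: "J * b \<le> sin d" "sin d \<le> J * a"
    using sin_half_bounds[OF level_mom_pos[OF assms]] by (auto simp: d_def)
  have d: "0 < d" "d < pi / 2" using half_pos step_elliptic(2)[OF assms] by (auto simp: d_def)
  have "sin d \<le> d" using d by (intro sin_x_le_x) auto
  then show "J * b \<le> half J t (mom J t)" using s by (simp add: d_def)
  have "arcsin (sin d) \<le> arcsin (J * a)"
    using s assms d by (intro arcsin_le_arcsin) (auto intro: order_trans[OF _ sin_ge_zero])
  then show "half J t (mom J t) \<le> arcsin (J * a)" using d by (simp add: d_def arcsin_sin)
qed

lemma fwd_iterate_bounds:
  assumes "0 < J" "J * a < 1"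
  shows "t + 2 * real n * (J * b) \<le> (fwd J ^^ n) t"
    and "(fwd J ^^ n) t \<le> t + 2 * real n * arcsin (J * a)"
proof (induction n)
  case (Suc n)
  { case 1 show ?case using Suc(1) half_elliptic_bounds(1)[OF assms, of "(fwd J ^^ n) t"]
        fwd_def[of J "(fwd J ^^ n) t"] by (simp add: algebra_simps) }
  { case 2 show ?case using Suc(2) half_elliptic_bounds(2)[OF assms, of "(fwd J ^^ n) t"]
        fwd_def[of J "(fwd J ^^ n) t"] by (simp add: algebra_simps) }
qed auto

text \<open>
  The half-angle parametrization of the inward directions at the vertex \<open>t = \<pi> / 2\<close>.
\<close>

definition vertex_J :: "real \<Rightarrow> real" where "vertex_J s = 2 * s / (1 + s\<^sup>2) / b"
definition vertex_mom :: "real \<Rightarrow> real" where "vertex_mom s = a * (1 - s\<^sup>2) / (1 + s\<^sup>2)"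

lemma level_vertex_param:
  assumes "0 < s" shows "0 < vertex_J s" "level (vertex_J s) (pi / 2, vertex_mom s)"
proof -
  have s: "1 + s\<^sup>2 > 0" by (simp add: add_pos_nonneg)
  show "0 < vertex_J s" using s assms b_pos by (simp add: vertex_J_def)
  have "(vertex_mom s)\<^sup>2 + a\<^sup>2 * b\<^sup>2 * (vertex_J s)\<^sup>2 = a\<^sup>2 * ((1 - s\<^sup>2)\<^sup>2 + (2 * s)\<^sup>2) / (1 + s\<^sup>2)\<^sup>2"
  proof -
    have "b * vertex_J s = 2 * s / (1 + s\<^sup>2)" using b_pos by (simp add: vertex_J_def)
    then have "a\<^sup>2 * b\<^sup>2 * (vertex_J s)\<^sup>2 = a\<^sup>2 * (2 * s / (1 + s\<^sup>2))\<^sup>2"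
      by (simp flip: power_mult_distrib add: mult.assoc)
    then show ?thesis
      by (simp add: vertex_mom_def power_divide power_mult_distrib add_divide_distrib distrib_left)
  qed
  also have "(1 - s\<^sup>2)\<^sup>2 + (2 * s)\<^sup>2 = (1 + s\<^sup>2)\<^sup>2" by algebra
  finally show "level (vertex_J s) (pi / 2, vertex_mom s)"
    using \<open>0 < vertex_J s\<close> s by (simp add: level_def P_alt)
qed

lemma vertex_param_surj:
  assumes "level J (pi / 2, z)"
  obtains s where "0 < s" "J = vertex_J s" "z = vertex_mom s"
proof -
  have J: "J > 0" and e: "z\<^sup>2 + a\<^sup>2 * b\<^sup>2 * J\<^sup>2 = a\<^sup>2" using assms by (auto simp: level_def P_alt)
  define y where "y = b * J"
  define c where "c = z / a"
  have y: "y > 0" using J b_pos by (simp add: y_def)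
  have zc: "z = a * c" using a_pos by (simp add: c_def)
  have "a\<^sup>2 * (c\<^sup>2 + y\<^sup>2) = a\<^sup>2 * 1" using e unfolding zc y_def by algebra
  then have cy: "c\<^sup>2 + y\<^sup>2 = 1" using a_pos by simp
  then have "c\<^sup>2 < 1" using y by (smt (verit) zero_less_power)
  then have c: "1 + c > 0" by (simp add: abs_square_less_1)
  \<comment> \<open>If \<open>\<theta>\<close> is the angle with \<open>c = cos \<theta>\<close> and
    \<open>y = sin \<theta>\<close>, then \<open>s = tan (\<theta> / 2)\<close>.\<close>
  define s where "s = y / (1 + c)"
  have s2: "1 + s\<^sup>2 = 2 / (1 + c)"
  proof -
    have "1 + s\<^sup>2 = ((1 + c)\<^sup>2 + y\<^sup>2) / (1 + c)\<^sup>2" using c by (simp add: s_def power_divide field_simps)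
    also have "(1 + c)\<^sup>2 + y\<^sup>2 = 2 * (1 + c)" using cy by algebra
    also have "2 * (1 + c) / (1 + c)\<^sup>2 = 2 / (1 + c)"
      using c by (simp add: power2_eq_square del: distrib_left_numeral)
    finally show ?thesis .
  qed
  have "2 * s / (1 + s\<^sup>2) = y" unfolding s2 using c by (simp add: s_def)
  then have "J = vertex_J s" unfolding vertex_J_def using b_pos by (simp add: y_def)
  moreover have "(1 - s\<^sup>2) / (1 + s\<^sup>2) = c"
  proof -
    have "1 - s\<^sup>2 = 2 - (1 + s\<^sup>2)" by simp
    then show ?thesis unfolding s2 using c by (simp add: field_simps)
  qed
  then have "z = vertex_mom s" by (simp add: vertex_mom_def zc flip: times_divide_eq_right)
  moreover have "s > 0" using y c by (simp add: s_def)
  ultimately show thesis using that by blast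
qed

text \<open>Neither the angle nor \<open>sin d\<close> is rational in \<open>s\<close>. The
  induction carries only the sine and cosine of the angle and the momentum, and the step involves
  \<open>d\<close> only through \<open>2 d\<close>, \<open>sin d cos d\<close> and
  \<open>sin m cos m\<close>. These are rational in \<open>X = cot d\<close> because
  \<open>sin^2 d = 1 / (1 + X^2)\<close>.\<close>

lemma vertex_orbit_rational:
  defines "w \<equiv> \<lambda>n s. (step (vertex_J s) ^^ n) (pi / 2, vertex_mom s)"
  shows "rational_on {0<..} (\<lambda>s. sin (fst (w n s))) \<and> rational_on {0<..} (\<lambda>s. cos (fst (w n s))) \<and>
    rational_on {0<..} (\<lambda>s. snd (w n s))"
proof (induction n)
  case 0
  have "1 + s\<^sup>2 \<noteq> 0" for s :: real by (simp add: add_nonneg_eq_0_iff)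
  then show ?case unfolding w_def vertex_mom_def by (auto intro!: rational_on_intros)
next
  case (Suc n)
  define t where "t = (\<lambda>s. fst (w n s))"
  define z where "z = (\<lambda>s. snd (w n s))"
  define X where "X = (\<lambda>s. cot_half (vertex_J s) (t s) (z s))"
  define d where "d = (\<lambda>s. half (vertex_J s) (t s) (z s))"
  have r: "rational_on {0<..} (\<lambda>s. sin (t s))" "rational_on {0<..} (\<lambda>s. cos (t s))" "rational_on {0<..} z"
    using Suc by (auto simp: t_def z_def)
  have n0: "1 + s\<^sup>2 \<noteq> 0" for s :: real by (simp add: add_nonneg_eq_0_iff)
  have rJ: "rational_on {0<..} vertex_J"
    unfolding vertex_J_def[abs_def] using n0 b_pos by (auto intro!: rational_on_intros)
  have J0: "vertex_J s \<noteq> 0" if "s \<in> {0<..}" for s using level_vertex_param(1)[of s] that by simp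
  have P0: "a\<^sup>2 * (sin x)\<^sup>2 + b\<^sup>2 * (cos x)\<^sup>2 \<noteq> 0" for x using P_pos[of x] by (simp add: P_def)
  have rX: "rational_on {0<..} X"
    unfolding X_def cot_half_def P_def using J0 P0 by (intro rational_on_intros r rJ) auto
  have step: "w (Suc n) s = (t s + 2 * d s, next_mom (vertex_J s) (t s + d s) (d s))" for s
    by (simp add: w_def step_def t_def z_def d_def split: prod.splits)
  have s2: "(sin (d s))\<^sup>2 = 1 / (1 + (X s)\<^sup>2)" for s
    using sin_half_sq[of "vertex_J s" "t s" "z s"] n0[of "X s"] by (simp add: d_def X_def field_simps)
  have c: "cos (d s) = X s * sin (d s)" for s using cos_half by (simp add: d_def X_def)
  have sc: "sin (d s) * cos (d s) = X s / (1 + (X s)\<^sup>2)" for s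
  proof -
    have "sin (d s) * cos (d s) = X s * (sin (d s))\<^sup>2" by (simp add: c power2_eq_square)
    then show ?thesis by (simp add: s2)
  qed
  have c2d: "cos (2 * d s) = ((X s)\<^sup>2 - 1) / (1 + (X s)\<^sup>2)" for s
  proof -
    have "cos (2 * d s) = (X s)\<^sup>2 * (sin (d s))\<^sup>2 - (sin (d s))\<^sup>2" by (simp add: cos_double c power_mult_distrib)
    then show ?thesis by (simp add: s2 diff_divide_distrib)
  qed
  have s2d: "sin (2 * d s) = 2 * X s / (1 + (X s)\<^sup>2)" for s
    using sc[of s] by (simp add: sin_double)
  have m: "sin (t s + d s) * cos (t s + d s) =
      (X s * sin (t s) + cos (t s)) * (X s * cos (t s) - sin (t s)) / (1 + (X s)\<^sup>2)" for s
  proof -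
    have "sin (t s + d s) * cos (t s + d s) =
      (sin (d s))\<^sup>2 * ((X s * sin (t s) + cos (t s)) * (X s * cos (t s) - sin (t s)))"
      using sin_mid[of "t s" "vertex_J s" "z s"] cos_mid[of "t s" "vertex_J s" "z s"]
      by (simp add: d_def X_def power2_eq_square)
    then show ?thesis by (simp add: s2)
  qed
  have "rational_on {0<..} (\<lambda>s. sin (t s + 2 * d s))"
    unfolding sin_add c2d s2d using n0 by (intro rational_on_intros r rX) auto
  moreover have "rational_on {0<..} (\<lambda>s. cos (t s + 2 * d s))"
    unfolding cos_add c2d s2d using n0 by (intro rational_on_intros r rX) auto
  moreover have "rational_on {0<..} (\<lambda>s. next_mom (vertex_J s) (t s + d s) (d s))"
    unfolding next_mom_def sc m using n0 J0 by (intro rational_on_intros r rX rJ) auto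
  ultimately show ?case by (simp add: step)
qed

text \<open>A nearly tangential orbit: its first \<open>n\<close> segments turn by a positive angle
  less than \<open>pi\<close>, so it is not back at the vertex. This is the value that keeps the
  rational function from being constant.\<close>

lemma small_vertex_orbit:
  assumes "n \<ge> 1"
  obtains s where "0 < s" "sin (fst ((step (vertex_J s) ^^ n) (pi / 2, vertex_mom s))) \<noteq> 1"
proof -
  \<comment> \<open>Each step turns by at most \<open>2 y\<close>; the \<open>+ 1\<close> in the
    denominator makes \<open>2 n y < pi\<close> strict.\<close>
  define y where "y = pi / (2 * (real n + 1))"
  have y: "0 < y" "y < pi / 2" using pi_gt_zero assms by (auto simp: y_def field_simps)
  define J where "J = sin y / a"
  have Ja: "J * a = sin y" using a_pos by (simp add: J_def)
  have "sin y < 1" using y sin_monotone_2pi[of y "pi / 2"] by simp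
  moreover have "sin y > 0" using y by (intro sin_gt_zero) auto
  ultimately have J: "0 < J" "J * a < 1" using a_pos by (simp_all add: Ja) (simp add: J_def)
  obtain s where s: "0 < s" "J = vertex_J s" "mom J (pi / 2) = vertex_mom s"
    using vertex_param_surj[OF level_mom_pos[OF J]] by blast
  let ?t = "(fwd J ^^ n) (pi / 2)"
  have it: "fst ((step (vertex_J s) ^^ n) (pi / 2, vertex_mom s)) = ?t"
    using iterate_elliptic[OF J, of n "pi / 2"] s by simp
  have "pi / 2 < ?t"
    using fwd_iterate_bounds(1)[OF J, where t = "pi / 2" and n = n] J b_pos assms
    by (smt (verit) mult_pos_pos of_nat_0_less_iff zero_less_one le_less_trans not_one_le_zero not_gr_zero)
  moreover have "?t < pi / 2 + pi"
  proof -
    have "?t \<le> pi / 2 + 2 * real n * y"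
      using fwd_iterate_bounds(2)[OF J, where t = "pi / 2" and n = n] y by (simp add: Ja arcsin_sin)
    also have "2 * real n * y < pi" by (simp add: y_def field_simps)
    finally show ?thesis by simp
  qed
  ultimately have "sin ?t \<noteq> 1"
  proof -
    assume h: "pi / 2 < ?t" "?t < pi / 2 + pi"
    have "cos (?t - pi / 2) < 1" using cos_monotone_0_pi[of 0 "?t - pi / 2"] h by simp
    then show ?thesis by (simp add: cos_diff)
  qed
  then show thesis using that s it by metis
qed

definition closed_lengths :: "nat \<Rightarrow> real set" where
  "closed_lengths n = {l. \<exists>J w p. level J w \<and> closes J n p w \<and> l = total_length J n w}"

text \<open>Bouncing along an axis or a diameter: each step turns by \<open>pi\<close> and has
  length \<open>2 / J\<close> with \<open>J = 1 / a\<close> or \<open>J = 1 / b\<close>. These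
  orbits are rest points of the flow, so Poncelet's porism cannot carry them to the vertex.\<close>

lemma total_length_equilibrium:
  assumes lev: "level J (t, 0)" and e: "(a\<^sup>2 - b\<^sup>2) * (sin t * cos t) = 0"
  shows "total_length J n (t, 0) \<in> {2 * a * real n, 2 * b * real n}"
proof -
  have J: "J > 0" and PJ: "a\<^sup>2 * b\<^sup>2 * J\<^sup>2 = P t" using lev by (auto simp: level_def)
  have st: "step J (t, 0) = (t + pi * of_int 1, 0)" and ch: "chord J (t, 0) = 2 / J"
    using e by (auto simp: step_def chord_def half_def cot_half_def next_mom_def sin_add cos_add)
  have "(step J ^^ k) (t, 0) = (t + pi * of_int (int k), 0)" for k
  proof (induction k)
    case (Suc k)
    then show ?case using step_shift[of J t "int k" 0] st by (simp add: algebra_simps)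
  qed simp
  then have "chord J ((step J ^^ k) (t, 0)) = 2 / J" for k
    using chord_shift[of J t "int k" 0] ch by simp
  then have l: "total_length J n (t, 0) = real n * (2 / J)" by (simp add: total_length_def)
  have "P t = a\<^sup>2 \<or> P t = b\<^sup>2"
  proof -
    consider "a\<^sup>2 = b\<^sup>2" | "sin t = 0" | "cos t = 0" using e by auto
    then show ?thesis
    proof cases
      case 3
      then have "(sin t)\<^sup>2 = 1" using sin_cos_squared_add[of t] by simp
      then show ?thesis by (simp add: P_alt)
    qed (simp_all add: P_alt)
  qed
  then have "(b * J)\<^sup>2 = 1 \<or> (a * J)\<^sup>2 = 1"
    using PJ a_pos b_pos by (auto simp: power_mult_distrib)
  moreover have "b * J > 0" "a * J > 0" using J a_pos b_pos by auto
  ultimately have "b * J = 1 \<or> a * J = 1" by (auto simp: power2_eq_1_iff)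
  then have "1 / J = b \<or> 1 / J = a" using J by (auto simp: field_simps)
  moreover have "real n * (2 / J) = 2 * (1 / J) * real n" by simp
  ultimately show ?thesis unfolding l by auto
qed

text \<open>That the \<open>n\<close>-th angle has sine \<open>1\<close> is only necessary for
  closing up, but it is a single rational equation in \<open>s\<close> that covers all numbers of
  turns \<open>p\<close> at once. Poncelet's porism shows that the orbits started at the vertex
  already account for every remaining length.\<close>

lemma finite_closed_lengths:
  assumes "n \<ge> 1"
  shows "finite (closed_lengths n)"
proof -
  let ?f = "\<lambda>s. sin (fst ((step (vertex_J s) ^^ n) (pi / 2, vertex_mom s))) - 1"
  have "rational_on {0<..} ?f" by (intro rational_on_intros conjunct1[OF vertex_orbit_rational])
  moreover obtain s0 where "0 < s0" "?f s0 \<noteq> 0" using small_vertex_orbit[OF assms] by auto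
  ultimately have fin: "finite {s \<in> {0<..}. ?f s = 0}" by (intro rational_on_finite_zeros) auto
  have "closed_lengths n \<subseteq> {2 * a * real n, 2 * b * real n} \<union>
     (\<lambda>s. total_length (vertex_J s) n (pi / 2, vertex_mom s)) ` {s \<in> {0<..}. ?f s = 0}"
  proof
    fix l assume "l \<in> closed_lengths n"
    then obtain J t0 z0 p where lev: "level J (t0, z0)" and cl: "closes J n p (t0, z0)"
      and l: "l = total_length J n (t0, z0)" by (auto simp: closed_lengths_def)
    show "l \<in> {2 * a * real n, 2 * b * real n} \<union>
     (\<lambda>s. total_length (vertex_J s) n (pi / 2, vertex_mom s)) ` {s \<in> {0<..}. ?f s = 0}"
    proof (cases "z0 = 0 \<and> (a\<^sup>2 - b\<^sup>2) * (sin t0 * cos t0) = 0")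
      case True
      then show ?thesis using total_length_equilibrium[of J t0 n] lev l by auto
    next
      case False
      obtain \<omega> t z W x0 x1 and k :: int where c: "pendulum \<omega> t z" "\<And>x. \<bar>\<omega> x\<bar> \<le> W"
        "\<And>x. level J (t x, z x)" "t x0 = t0" "z x0 = z0" "t x1 = pi / 2 + pi * of_int k"
        using curve_to_vertex[OF lev False] by blast
      have cl1: "closes J n p (pi / 2, z x1)" and l1: "total_length J n (pi / 2, z x1) = l"
        using poncelet[OF c(1-3), of n p x0 x1] cl l closes_shift[of J n p "pi / 2" k "z x1"]
          total_length_shift[of J n "pi / 2" k "z x1"] by (simp_all add: c)
      have "level J (pi / 2, z x1)" using c(3)[of x1] level_shift[of J "pi / 2" k] by (simp add: c)
      then obtain s where s: "0 < s" "J = vertex_J s" "z x1 = vertex_mom s" by (rule vertex_param_surj)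
      have "sin (pi / 2 + 2 * pi * of_int p) = 1"
        by (simp only: sin_add sin_int_2pin cos_int_2pin) simp
      then have "?f s = 0" using cl1 s by (simp add: closes_def)
      then show ?thesis using s l1 by auto
    qed
  qed
  then show ?thesis using fin finite_subset by blast
qed

end

section \<open>Orbits tangent to a confocal ellipse\<close>

context ellipse_axes
begin

lemma elliptic_iff: "0 < J \<and> J * a < 1 \<longleftrightarrow> J \<in> {0<..<1 / a}"
  using a_pos by (auto simp: field_simps)

section \<open>Actions and the chord length as a generating function\<close>

lemma mom_continuous: "continuous_on S (mom J)"
  unfolding mom_def[abs_def] P_def[abs_def] by (intro continuous_intros)

text \<open>
  \<open>action J\<close> generates the invariant curve of level \<open>J\<close>: the length of a chord of a higher elliptic
  level exceeds the increment of \<open>action J\<close> by at most \<open>gap J\<close>, with equality on the level \<open>J\<close>. Level \<open>0\<close> is the boundary itself, so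
  \<open>circ 0\<close> is the perimeter.
\<close>

definition action :: "real \<Rightarrow> real \<Rightarrow> real" where
  "action J = (SOME F. F 0 = 0 \<and> (\<forall>x. (F has_real_derivative mom J x) (at x)))"

lemma action_zero: "action J 0 = 0"
  and action_has_derivative: "(action J has_real_derivative mom J x) (at x)"
proof -
  have "\<exists>F. \<forall>x. -\<infinity> < ereal x \<longrightarrow> ereal x < \<infinity> \<longrightarrow> (F has_vector_derivative mom J x) (at x)"
    by (rule einterval_antiderivative)
       (use mom_continuous[of UNIV J] in \<open>auto simp: continuous_on_eq_continuous_at\<close>)
  then obtain F where F: "\<And>x. (F has_real_derivative mom J x) (at x)"
    by (auto simp: has_real_derivative_iff_has_vector_derivative)
  have "\<exists>F. F 0 = 0 \<and> (\<forall>x. (F has_real_derivative mom J x) (at x))"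
    by (rule exI[of _ "\<lambda>x. F x - F 0"]) (auto intro!: derivative_eq_intros F)
  from someI_ex[OF this, folded action_def]
  show "action J 0 = 0" "(action J has_real_derivative mom J x) (at x)" by auto
qed

text \<open>The integral of \<open>z dt\<close> over one turn; for an elliptic level this is the
  length of the caustic.\<close>

definition circ :: "real \<Rightarrow> real" where
  "circ J = action J (2 * pi)"

lemma mom_nonneg: "J * a \<le> 1 \<Longrightarrow> 0 \<le> J \<Longrightarrow> 0 \<le> mom J t"
proof -
  assume "J * a \<le> 1" "0 \<le> J"
  then have "(J * a)\<^sup>2 \<le> 1" using a_pos by (simp add: abs_square_le_1)
  then have "b\<^sup>2 * (1 - a\<^sup>2 * J\<^sup>2) \<ge> 0" by (simp add: power_mult_distrib mult.commute)
  then show ?thesis using mom_radicand[of J t] by (simp add: mom_def)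
qed

lemma mom_antimono: "0 \<le> J' \<Longrightarrow> J' \<le> J \<Longrightarrow> mom J t \<le> mom J' t"
  unfolding mom_def by (simp add: power_mono mult_left_mono)

lemma action_shift: "action J (t + 2 * pi * real p) = action J t + real p * circ J"
proof -
  have *: "action J (t + 2 * pi) - action J t = circ J" for t
  proof -
    have 1: "((\<lambda>t. action J (t + 2 * pi)) has_real_derivative mom J (t + 2 * pi) * 1) (at t)" for t
      by (rule DERIV_chain2[OF action_has_derivative]) (auto intro!: derivative_eq_intros)
    have 2: "mom J (t + 2 * pi) = mom J t" for t using P_shift_2pi[of t 1] by (simp add: mom_def)
    have "((\<lambda>t. action J (t + 2 * pi) - action J t) has_real_derivative 0) (at t)" for t
      by (rule DERIV_cong[OF DERIV_diff[OF 1 action_has_derivative]]) (simp add: 2)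
    then have "action J (t + 2 * pi) - action J t = action J (0 + 2 * pi) - action J 0"
      by (intro DERIV_isconst_all) auto
    then show ?thesis by (simp add: circ_def action_zero)
  qed
  show ?thesis
  proof (induction p)
    case (Suc p)
    have "t + 2 * pi * real (Suc p) = (t + 2 * pi * real p) + 2 * pi" by (simp add: algebra_simps)
    then show ?case using *[of "t + 2 * pi * real p"] Suc by (simp add: algebra_simps)
  qed simp
qed

lemma action_mono:
  assumes "J * a \<le> 1" "0 \<le> J" "x \<le> y" shows "action J x \<le> action J y"
  using DERIV_nonneg_imp_nondecreasing[OF assms(3), of "action J"] action_has_derivative mom_nonneg[OF assms(1,2)]
  by blast

text \<open>Geometrically the Lazutkin parameter of the caustic: the two tangent segments from a
  boundary point to the caustic minus the arc between their points of contact. By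
  \<open>gap_eq\<close> the base angle \<open>0\<close> stands for any other.\<close>

definition gap :: "real \<Rightarrow> real" where
  "gap J = chord J (0, mom J 0) - (action J (fwd J 0) - action J 0)"

text \<open>By the first variation of length the chord changes by end momentum times end speed minus
  start momentum times start speed, and the difference of the actions changes by the same two
  terms.\<close>

lemma gap_eq:
  assumes "0 < J" "J * a < 1"
  shows "chord J (t, mom J t) - (action J (fwd J t) - action J t) = gap J"
proof -
  let ?g = "\<lambda>t. chord J (t, mom J t) - (action J (fwd J t) - action J t)"
  have "(?g has_real_derivative 0) (at t)" for t
  proof -
    have m: "mom J t > 0" by (rule mom_pos[OF assms])
    have p: "pendulum (\<lambda>x. 1 / mom J x) (\<lambda>x. x) (mom J)"
      using pendulum_elliptic(1)[OF assms, of 1] by simp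
    have lev: "level J (t, mom J t)" by (rule level_mom_pos[OF assms])
    have d: "(fwd J has_real_derivative 1 / mom J t * mom J (fwd J t)) (at t)"
      "((\<lambda>t. chord J (t, mom J t)) has_real_derivative 1 / mom J t * (P (fwd J t) - P t)) (at t)"
      using step_has_derivative(1,3)[of "\<lambda>x. x" "1 / mom J t" "mom J" t J] p lev
      by (simp_all add: pendulum_def step_elliptic(1)[OF assms])
    have 3: "1 / mom J t * (P (fwd J t) - P t) - (mom J (fwd J t) * (1 / mom J t * mom J (fwd J t)) - mom J t) = 0"
    proof -
      have "mom J (fwd J t) * mom J (fwd J t) - mom J t * mom J t = P (fwd J t) - P t"
        using mom_sq[OF assms] by (simp add: power2_eq_square)
      moreover have "1 / u * A - (f * (1 / u * f) - u) = (A - (f * f - u * u)) / u"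
        if "u \<noteq> 0" for u f A :: real using that by (simp add: field_simps)
      ultimately show ?thesis using m by simp
    qed
    show ?thesis
      by (rule DERIV_cong[OF DERIV_diff[OF d(2) DERIV_diff[OF
             DERIV_chain2[OF action_has_derivative d(1)] action_has_derivative]] 3])
  qed
  then have "?g t = ?g 0" by (intro DERIV_isconst_all) auto
  then show ?thesis by (simp add: gap_def)
qed

lemma total_length_elliptic:
  assumes "0 < J" "J * a < 1"
  shows "total_length J n (t, mom J t) = real n * gap J + action J ((fwd J ^^ n) t) - action J t"
proof (induction n)
  case (Suc n)
  then show ?case using gap_eq[OF assms, of "(fwd J ^^ n) t"]
    by (simp add: total_length_def iterate_elliptic[OF assms] algebra_simps)
qed (simp add: total_length_def)

text \<open>As \<open>gap\<close> does not depend on the base angle, it is evaluated on the chord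
  symmetric about the vertex \<open>t = 0\<close>, where all is explicit. Between \<open>- d\<close>
  and \<open>d\<close> the momentum is at most its value \<open>z\<close> at the ends, so the action
  grows by at most \<open>2 d z = 2 d sin d cos d / J\<close>; the chord is
  \<open>2 sin^2 d / J\<close>, and \<open>d cos d < sin d\<close>.\<close>

lemma gap_pos:
  assumes "0 < J" "J * a < 1"
  shows "0 < gap J"
proof -
  have "J * b \<le> J * a" using assms b_le_a by simp
  then have "J * b < 1" using assms by linarith
  then have Jb: "0 < J * b" "J * b < 1" using assms b_pos by auto
  \<comment> \<open>The half-angle of the chord with midpoint angle \<open>0\<close>, where
    \<open>J^2 P 0 = (J b)^2\<close>.\<close>
  define d where "d = arcsin (J * b)"
  have sd: "sin d = J * b" using Jb by (simp add: d_def)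
  have d: "0 < d" "d < pi / 2"
    using Jb arcsin_less_mono[of 0 "J * b"] arcsin_lt_bounded[of "J * b"] by (auto simp: d_def)
  have cd: "cos d > 0" using d by (intro cos_gt_zero_pi) auto
  have e: "J\<^sup>2 * P 0 = (sin d)\<^sup>2" by (simp add: P_def sd power_mult_distrib)
  have "level J (0 + - d, next_mom J 0 (- d))" using assms(1) e by (intro level_end) auto
  moreover define z where "z = sin d * cos d / J"
  ultimately have "level J (- d, z)" by (simp add: next_mom_def level_def)
  moreover have z: "z > 0" using sd Jb cd assms(1) b_pos by (simp add: z_def)
  ultimately have mz: "mom J (- d) = z"
    using mom_pos[OF assms, of "- d"] by (auto simp: level_mom_iff[OF assms])
  have h: "half J (- d) z = d"
    using assms(1) d e by (intro half_eqI) (auto simp: z_def)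
  have fd: "fwd J (- d) = d" by (simp add: fwd_def mz h)
  have ch: "chord J (- d, z) = 2 * (sin d)\<^sup>2 / J" by (simp add: chord_def h)
  obtain x where x: "- d < x" "x < d" "action J d - action J (- d) = (d - - d) * mom J x"
    using MVT2[of "- d" d "action J" "mom J"] action_has_derivative d by auto
  have "\<bar>sin x\<bar> \<le> sin d"
    using sin_monotone_2pi_le[of x d] sin_monotone_2pi_le[of "- d" x] x d by (simp add: abs_le_iff)
  then have "(sin x)\<^sup>2 \<le> (sin d)\<^sup>2" using power_mono[of "\<bar>sin x\<bar>" "sin d" 2] by simp
  then have "P x \<le> P (- d)" unfolding P_alt using b_pos b_le_a
    by (simp add: mult_left_mono power_mono)
  then have "mom J x \<le> z" unfolding mz[symmetric] mom_def by simp
  then have up: "action J d - action J (- d) \<le> 2 * d * z" using x(3) d by simp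
  obtain y where y: "0 < y" "y < d" "sin d - sin 0 = (d - 0) * cos y"
    using MVT2[of 0 d sin cos] d by (auto intro: DERIV_sin)
  have "cos d < cos y" using y d by (intro cos_monotone_0_pi) auto
  then have "d * cos d < sin d" using y d by simp
  then have "sin d / J * (d * cos d) < sin d / J * sin d"
    using sd Jb assms(1) b_pos by (intro mult_strict_left_mono) auto
  moreover have "2 * d * z = 2 * (sin d / J * (d * cos d))" by (simp add: z_def)
  moreover have "2 * (sin d)\<^sup>2 / J = 2 * (sin d / J * sin d)" by (simp add: power2_eq_square)
  ultimately have "2 * d * z < 2 * (sin d)\<^sup>2 / J" by linarith
  with up have "chord J (- d, mom J (- d)) - (action J (fwd J (- d)) - action J (- d)) > 0"
    by (simp add: mz fd ch)
  then show ?thesis unfolding gap_eq[OF assms] .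
qed

text \<open>Implicit differentiation of \<open>J^2 P (x + d) = sin^2 d\<close> in \<open>J\<close>.
  The base point may depend on \<open>J\<close>, as iteration requires. For
  \<open>x' \<ge> 0\<close> the resulting derivative is positive; this is the twist. With a fixed
  base point the chord changes by the end momentum times the displacement of its end.\<close>

lemma fwd_has_derivative:
  assumes J: "0 < J" "J * a < 1" and x: "(x has_real_derivative x') (at J)"
  defines "m \<equiv> x J + half J (x J) (mom J (x J))"
  shows "((\<lambda>J. fwd J (x J)) has_real_derivative
     (2 * P m + mom J (fwd J (x J)) * x') / mom J (x J)) (at J)"
    and "x' = 0 \<Longrightarrow> ((\<lambda>J. chord J (x J, mom J (x J))) has_real_derivative
     mom J (fwd J (x J)) * (2 * P m / mom J (x J))) (at J)"
proof -
  define C where "C = a\<^sup>2 - b\<^sup>2"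
  define h where "h = (\<lambda>J. half J (x J) (mom J (x J)))"
  have pos: "0 < P (x J) - a\<^sup>2 * b\<^sup>2 * J\<^sup>2"
    using mom_radicand[of J "x J"] mom_radicand_pos[OF J] by linarith
  have dP: "((\<lambda>J. P (x J)) has_real_derivative 2 * (C * (sin (x J) * cos (x J))) * x') (at J)"
    using DERIV_chain2[OF P_has_derivative x] by (simp add: C_def)
  \<comment> \<open>Only differentiability is established here; the value of \<open>h'\<close> is
    extracted afterwards from the midpoint equation, which holds on a neighbourhood of
    \<open>J\<close>.\<close>
  have "\<exists>D. ((\<lambda>J. P (x J) - a\<^sup>2 * b\<^sup>2 * J\<^sup>2) has_real_derivative D) (at J)"
    by (rule exI, (rule derivative_eq_intros dP refl)+)
  then obtain D1 where D1: "((\<lambda>J. mom J (x J)) has_real_derivative D1) (at J)"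
    unfolding mom_def
    using DERIV_chain2[where f = sqrt and g = "\<lambda>J. P (x J) - a\<^sup>2 * b\<^sup>2 * J\<^sup>2", OF DERIV_real_sqrt[OF pos]]
    by blast
  have "\<exists>D. ((\<lambda>J. C * (sin (x J) * cos (x J))) has_real_derivative D) (at J)"
    by (rule exI, (rule derivative_eq_intros x refl)+)
  then obtain D3 where D3: "((\<lambda>J. mom J (x J) / J - C * (sin (x J) * cos (x J))) has_real_derivative D3) (at J)"
    using DERIV_diff[OF DERIV_divide[OF D1 DERIV_ident]] J by blast
  then obtain D2 where D2: "((\<lambda>J. cot_half J (x J) (mom J (x J))) has_real_derivative D2) (at J)"
    unfolding cot_half_def C_def[symmetric]
    using DERIV_divide[OF D3 dP less_imp_neq[OF P_pos, symmetric]] by blast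
  have "\<exists>D. (h has_real_derivative D) (at J)"
    unfolding h_def half_def by (rule exI, (rule derivative_eq_intros D2 refl)+)
  then obtain h' where h': "(h has_real_derivative h') (at J)" by blast
  define d where "d = h J"
  have md: "m = x J + d" by (simp add: m_def d_def h_def)
  define z1 where "z1 = mom J (x J)"
  define z2 where "z2 = mom J (fwd J (x J))"
  have z1: "z1 > 0" using mom_pos[OF J] by (simp add: z1_def)
  have lev: "level J (x J, z1)" using level_mom_pos[OF J] by (simp add: z1_def)
  have z1e: "z1 * J = sin d * cos d - J\<^sup>2 * C * (sin m * cos m)"
    using level_mom[OF lev] J by (simp add: d_def h_def z1_def md C_def field_simps power2_eq_square)
  have "z2 = next_mom J m d"
    using step_elliptic(1)[OF J, of "x J"] by (simp add: step_def z2_def m_def d_def h_def)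
  then have z2e: "z2 * J = sin d * cos d + J\<^sup>2 * C * (sin m * cos m)"
    using J by (simp add: next_mom_def C_def field_simps power2_eq_square)
  have Pm: "J\<^sup>2 * P m = (sin d)\<^sup>2" using level_mid[OF lev] by (simp add: md d_def h_def z1_def)
  have dm: "((\<lambda>J. x J + h J) has_real_derivative x' + h') (at J)"
    by (rule DERIV_add[OF x h'])
  have l: "((\<lambda>J. (sin (h J))\<^sup>2) has_real_derivative 2 * (sin d * cos d) * h') (at J)"
    by (rule derivative_eq_intros h' refl)+ (simp add: d_def)
  have r: "((\<lambda>J. J\<^sup>2 * P (x J + h J)) has_real_derivative
      2 * J * P m + J\<^sup>2 * (2 * (C * (sin m * cos m)) * (x' + h'))) (at J)"
    by (rule derivative_eq_intros DERIV_chain2[OF P_has_derivative dm] refl)+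
       (simp add: md d_def C_def)
  have ev: "eventually (\<lambda>J. J \<in> {0<..<1 / a}) (nhds J)"
    by (rule eventually_nhds_in_open) (use J elliptic_iff in auto)
  have "((\<lambda>J. (sin (h J))\<^sup>2) has_real_derivative
      2 * J * P m + J\<^sup>2 * (2 * (C * (sin m * cos m)) * (x' + h'))) (at J)"
  proof (rule iffD1[OF DERIV_cong_ev[OF refl _ refl] r])
    show "eventually (\<lambda>J. J\<^sup>2 * P (x J + h J) = (sin (h J))\<^sup>2) (nhds J)"
      using ev by eventually_elim (use level_mid level_mom_pos elliptic_iff in \<open>force simp: h_def\<close>)
  qed
  from DERIV_unique[OF l this]
  have "J * (h' * z1) = J * (P m + J * C * (sin m * cos m) * x')"
    using z1e by algebra
  then have hz: "h' * z1 = P m + J * C * (sin m * cos m) * x'" using J by simp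
  have z21: "J * (z2 - z1) = J * (2 * J * C * (sin m * cos m))" using z1e z2e by algebra
  then have z21: "z2 - z1 = 2 * J * C * (sin m * cos m)" using J by simp
  have "(x' + 2 * h') * z1 = 2 * P m + z2 * x'" using hz z21 by algebra
  then have "x' + 2 * h' = (2 * P m + z2 * x') / z1" using z1 by (simp add: field_simps)
  moreover have "((\<lambda>J. fwd J (x J)) has_real_derivative x' + 2 * h') (at J)"
    unfolding fwd_def using DERIV_add[OF x DERIV_cmult[OF h', of 2]] by (simp add: h_def)
  ultimately show "((\<lambda>J. fwd J (x J)) has_real_derivative
     (2 * P m + mom J (fwd J (x J)) * x') / mom J (x J)) (at J)"
    by (simp add: z1_def z2_def)
  assume x0: "x' = 0"
  have "((\<lambda>J. 2 * (sin (h J))\<^sup>2 / J) has_real_derivative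
      (2 * (2 * (sin d * cos d) * h') * J - 2 * (sin d)\<^sup>2 * 1) / (J * J)) (at J)"
    unfolding d_def
    by (rule DERIV_divide[OF DERIV_cmult[OF l[unfolded d_def]] DERIV_ident]) (use J in simp)
  moreover have "(2 * (2 * (sin d * cos d) * h') * J - 2 * (sin d)\<^sup>2 * 1) / (J * J) = z2 * (2 * P m / z1)"
  proof -
    have "h' * z1 = P m" using hz x0 by simp
    then have h'e: "P m / z1 = h'" using z1 by (simp add: field_simps)
    have "2 * (2 * (sin d * cos d) * h') * J - 2 * (sin d)\<^sup>2 = (J * J) * (2 * h' * z2)"
      using z1e z2e Pm \<open>h' * z1 = P m\<close> by algebra
    moreover have "z2 * (2 * P m / z1) = 2 * h' * z2" unfolding h'e[symmetric] by simp
    ultimately show ?thesis using J by simp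
  qed
  ultimately show "((\<lambda>J. chord J (x J, mom J (x J))) has_real_derivative
     mom J (fwd J (x J)) * (2 * P m / mom J (x J))) (at J)"
    by (simp add: chord_def h_def z1_def z2_def)
qed

lemma fwd_iterate_has_derivative:
  assumes J: "0 < J" "J * a < 1"
  obtains D where "((\<lambda>J. (fwd J ^^ n) t) has_real_derivative D) (at J)" "0 \<le> D" "n \<ge> 1 \<Longrightarrow> 0 < D"
proof (induction n arbitrary: thesis)
  case 0
  show ?case by (rule 0[of 0]) auto
next
  case (Suc n)
  obtain D where D: "((\<lambda>J. (fwd J ^^ n) t) has_real_derivative D) (at J)" "0 \<le> D"
    using Suc.IH by blast
  define D' where "D' = (2 * P ((fwd J ^^ n) t + half J ((fwd J ^^ n) t) (mom J ((fwd J ^^ n) t)))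
      + mom J (fwd J ((fwd J ^^ n) t)) * D) / mom J ((fwd J ^^ n) t)"
  have "((\<lambda>J. (fwd J ^^ Suc n) t) has_real_derivative D') (at J)"
    using fwd_has_derivative(1)[OF J D(1)] by (simp add: D'_def)
  moreover have "D' > 0" unfolding D'_def using D(2) P_pos mom_pos[OF J]
    by (intro divide_pos_pos add_pos_nonneg mult_nonneg_nonneg) (auto simp: less_imp_le)
  ultimately show ?case by (intro Suc.prems[of D']) auto
qed

lemma fwd_iterate_mono_J:
  assumes "0 < J" "J < J'" "J' * a < 1" "n \<ge> 1"
  shows "(fwd J ^^ n) t < (fwd J' ^^ n) t"
proof (rule DERIV_pos_imp_increasing[OF assms(2), of "\<lambda>J. (fwd J ^^ n) t"])
  fix y assume "J \<le> y" "y \<le> J'"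
  moreover from this have "y * a \<le> J' * a" using a_pos by simp
  ultimately have "0 < y" "y * a < 1" using assms by auto
  then show "\<exists>D. ((\<lambda>J. (fwd J ^^ n) t) has_real_derivative D) (at y) \<and> D > 0"
    using fwd_iterate_has_derivative[of y n t] assms(4) by metis
qed

lemma fwd_greater: "t < fwd J t"
  using half_pos by (simp add: fwd_def)

lemma fwd_iterate_strict_mono: "n < n' \<Longrightarrow> (fwd J ^^ n) t < (fwd J ^^ n') t"
  by (rule lift_Suc_mono_less[of "\<lambda>n. (fwd J ^^ n) t"]) (auto simp: fwd_greater)

lemma chord_comparison:
  assumes J: "0 < J" "J * a < 1" and J': "0 \<le> J'" "J' \<le> J1" "0 < J1" "J1 \<le> J"
  shows "chord J (t, mom J t) - action J' (fwd J t) \<le> chord J1 (t, mom J1 t) - action J' (fwd J1 t)"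
proof (rule DERIV_nonpos_imp_nonincreasing[OF J'(4), of "\<lambda>J. chord J (t, mom J t) - action J' (fwd J t)"])
  fix y assume y: "J1 \<le> y" "y \<le> J"
  moreover from this have "y * a \<le> J * a" using a_pos by simp
  ultimately have y': "0 < y" "y * a < 1" using J J' by auto
  define F where "F = 2 * P (t + half y t (mom y t)) / mom y t"
  note d = fwd_has_derivative[OF y', of "\<lambda>_. t" 0]
  have "((\<lambda>J. fwd J t) has_real_derivative F) (at y)" using d(1) by (simp add: F_def)
  from DERIV_chain2[OF action_has_derivative this]
  have "((\<lambda>J. chord J (t, mom J t) - action J' (fwd J t)) has_real_derivative
      mom y (fwd y t) * F - mom J' (fwd y t) * F) (at y)"
    using d(2) by (intro DERIV_diff) (simp_all add: F_def)
  moreover have "mom y (fwd y t) * F - mom J' (fwd y t) * F \<le> 0"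
  proof -
    have "mom y (fwd y t) \<le> mom J' (fwd y t)" using J' y by (intro mom_antimono) auto
    moreover have "F > 0" unfolding F_def using P_pos mom_pos[OF y'] by simp
    ultimately show ?thesis by (simp add: mult_right_mono)
  qed
  ultimately show "\<exists>D. ((\<lambda>J. chord J (t, mom J t) - action J' (fwd J t)) has_real_derivative D) (at y) \<and> D \<le> 0"
    by blast
qed

lemma total_length_comparison:
  assumes "0 < J'" "J' \<le> J" "J * a < 1"
  shows "total_length J n (t, mom J t) \<le> real n * gap J' + action J' ((fwd J ^^ n) t) - action J' t"
proof (induction n)
  case (Suc n)
  have J: "0 < J" "J * a < 1" using assms by auto
  have "J' * a \<le> J * a" using assms a_pos by simp
  then have J': "0 < J'" "J' * a < 1" using assms by auto
  have "chord J (s, mom J s) \<le> gap J' + action J' (fwd J s) - action J' s" for s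
    using chord_comparison[OF J, of J' J' s] gap_eq[OF J', of s] assms by simp
  from this[of "(fwd J ^^ n) t"] Suc show ?case
    by (simp add: total_length_def iterate_elliptic[OF J] algebra_simps)
qed (simp add: total_length_def)

text \<open>Comparison with the boundary itself, where \<open>action 0\<close> is arc length:
  \<open>chord_comparison\<close> is used for \<open>J' = 0\<close> in the limit
  \<open>J1 \<rightarrow> 0\<close>, in which the shorter chord shrinks to a point.\<close>

lemma chord_le_action0:
  assumes J: "0 < J" "J * a < 1"
  shows "chord J (t, mom J t) \<le> action 0 (fwd J t) - action 0 t"
proof (rule field_le_epsilon)
  fix e :: real assume e: "e > 0"
  define J1 where "J1 = min J (e / (2 * a\<^sup>2))"
  have J1: "0 < J1" "J1 \<le> J" "2 * J1 * a\<^sup>2 \<le> e" 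
    using e J a_pos by (auto simp: J1_def min_def field_simps)
  moreover from this have "J1 * a \<le> J * a" using a_pos by simp
  ultimately have J1': "J1 * a < 1" using J by simp
  have "chord J1 (t, mom J1 t) \<le> e"
    using chord_bounds(2)[OF level_mom_pos[OF J1(1) J1', of t]] J1 by simp
  moreover have "action 0 t \<le> action 0 (fwd J1 t)"
    using fwd_greater[of t J1] by (intro action_mono) auto
  ultimately show "chord J (t, mom J t) \<le> action 0 (fwd J t) - action 0 t + e"
    using chord_comparison[OF J, of 0 J1 t] J1 by simp
qed

lemma total_length_le_action0:
  assumes J: "0 < J" "J * a < 1"
  shows "total_length J n (t, mom J t) \<le> action 0 ((fwd J ^^ n) t) - action 0 t"
proof (induction n)
  case (Suc n)
  then show ?case using chord_le_action0[OF J, of "(fwd J ^^ n) t"]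
    by (simp add: total_length_def iterate_elliptic[OF J])
qed (simp add: total_length_def)

lemma circ0_pos: "0 < circ 0"
proof -
  have "action 0 0 < action 0 (2 * pi)"
  proof (rule DERIV_pos_imp_increasing[of 0 "2 * pi" "action 0"])
    fix x show "\<exists>D. (action 0 has_real_derivative D) (at x) \<and> D > 0"
      using action_has_derivative[of 0 x] P_pos[of x] by (auto simp: mom_def)
  qed simp
  then show ?thesis by (simp add: circ_def action_zero)
qed

text \<open>For \<open>J a \<le> 1 / 2\<close> at least three quarters of \<open>P\<close> remain
  under the root, and \<open>(3 / 4)^2 \<le> 3 / 4\<close>. What matters is a factor above
  \<open>1 / 2\<close>: two turns then cost at least \<open>3 / 2\<close> of the perimeter.\<close>

lemma circ_lower:
  assumes "0 < J" "J * a \<le> 1 / 2"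
  shows "(3 / 4) * circ 0 \<le> circ J"
proof -
  have m: "3 / 4 * mom 0 x \<le> mom J x" for x
  proof -
    have "(J * a)\<^sup>2 \<le> (1 / 2)\<^sup>2" using assms a_pos by (intro power_mono) auto
    then have "a\<^sup>2 * J\<^sup>2 \<le> 1 / 4" by (simp add: power_mult_distrib power_divide mult.commute)
    moreover have "b\<^sup>2 \<le> P x" by (rule P_ge)
    ultimately have "a\<^sup>2 * J\<^sup>2 * b\<^sup>2 \<le> 1 / 4 * P x"
      using P_pos[of x] by (intro mult_mono) auto
    then have "(3 / 4)\<^sup>2 * P x \<le> P x - a\<^sup>2 * b\<^sup>2 * J\<^sup>2"
      using P_pos[of x] by (simp add: power2_eq_square algebra_simps)
    then have "sqrt ((3 / 4)\<^sup>2 * P x) \<le> mom J x" unfolding mom_def by (rule real_sqrt_le_mono)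
    then show ?thesis by (simp add: real_sqrt_mult mom_def)
  qed
  have "action J 0 - 3 / 4 * action 0 0 \<le> action J (2 * pi) - 3 / 4 * action 0 (2 * pi)"
  proof (rule DERIV_nonneg_imp_nondecreasing[of 0 "2 * pi" "\<lambda>x. action J x - 3 / 4 * action 0 x"])
    fix x
    have "((\<lambda>x. action J x - 3 / 4 * action 0 x) has_real_derivative mom J x - 3 / 4 * mom 0 x) (at x)"
      by (intro DERIV_diff DERIV_cmult action_has_derivative)
    then show "\<exists>D. ((\<lambda>x. action J x - 3 / 4 * action 0 x) has_real_derivative D) (at x) \<and> 0 \<le> D"
      using m[of x] by (metis diff_ge_0_iff_ge)
  qed simp
  then show ?thesis by (simp add: circ_def action_zero)
qed

section \<open>Closed orbits of one turn and their lengths\<close>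

lemma closes_elliptic:
  assumes "0 < J" "J * a < 1"
  shows "closes J n p (t, mom J t) \<longleftrightarrow> (fwd J ^^ n) t = t + 2 * pi * of_int p"
proof -
  have "mom J (t + 2 * pi * of_int p) = mom J t" by (simp add: mom_def P_shift_2pi)
  then show ?thesis by (auto simp: closes_def iterate_elliptic[OF assms])
qed

lemma closes_elliptic_all:
  assumes J: "0 < J" "J * a < 1" and cl: "closes J n p (t, mom J t)"
  shows "closes J n p (t', mom J t')"
    and "total_length J n (t', mom J t') = total_length J n (t, mom J t)"
proof -
  have p: "pendulum (\<lambda>x. 1 / (1 * mom J x)) (\<lambda>x. x) (\<lambda>x. 1 * mom J x)"
    by (rule pendulum_elliptic[OF J]) simp
  have W: "\<bar>1 / (1 * mom J x)\<bar> \<le> 1 / sqrt (b\<^sup>2 * (1 - a\<^sup>2 * J\<^sup>2))" for x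
    by (rule pendulum_elliptic[OF J]) simp
  show "closes J n p (t', mom J t')"
    "total_length J n (t', mom J t') = total_length J n (t, mom J t)"
    using poncelet[OF p W, of J n p t t'] level_mom_pos[OF J] cl by auto
qed

text \<open>The bound on \<open>J a\<close> is the one of \<open>circ_lower\<close>; the base angle
  \<open>0\<close> stands for all angles by Poncelet's porism.\<close>

definition once_around :: "nat \<Rightarrow> real \<Rightarrow> bool" where
  "once_around n J \<longleftrightarrow> 0 < J \<and> J * a \<le> 1 / 2 \<and> (fwd J ^^ n) 0 = 2 * pi"

definition once_length :: "nat \<Rightarrow> real \<Rightarrow> real" where
  "once_length n J = real n * gap J + circ J"

lemma once_around_closes: "once_around n J \<Longrightarrow> closes J n 1 (t, mom J t)"
  and once_around_length: "once_around n J \<Longrightarrow> total_length J n (t, mom J t) = once_length n J"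
proof -
  assume o: "once_around n J"
  then have J: "0 < J" "J * a < 1" by (auto simp: once_around_def)
  have 0: "closes J n 1 (0, mom J 0)" using o by (simp add: closes_elliptic[OF J] once_around_def)
  show "closes J n 1 (t, mom J t)" by (rule closes_elliptic_all(1)[OF J 0])
  have "total_length J n (0, mom J 0) = once_length n J"
    using o by (simp add: total_length_elliptic[OF J] once_length_def once_around_def circ_def action_zero)
  then show "total_length J n (t, mom J t) = once_length n J"
    using closes_elliptic_all(2)[OF J 0, of t] by simp
qed

lemma once_around_unique:
  assumes "once_around n J" "once_around n J'" shows "J = J'"
proof -
  have "n \<ge> 1" using assms(1) by (cases n) (auto simp: once_around_def)
  then have "\<not> J < J'" "\<not> J' < J"
    using fwd_iterate_mono_J[of J J' n 0] fwd_iterate_mono_J[of J' J n 0] assms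
    by (auto simp: once_around_def)
  then show ?thesis by simp
qed

text \<open>The polygon with more sides calibrates the other. The twist gives
  \<open>J' \<le> J\<close>, so the \<open>n\<close>-gon has length at most
  \<open>n gap J' + circ J'\<close>, whereas the length of the \<open>n'\<close>-gon equals
  \<open>n' gap J' + circ J'\<close>. The surplus of one \<open>gap J'\<close> gives strict growth
  as well as a definite distance between neighbours.\<close>

lemma once_length_gap:
  assumes o: "once_around n J" "once_around n' J'" and "n < n'"
  shows "once_length n J + gap J' \<le> once_length n' J'"
proof -
  have J: "0 < J" "J * a < 1" "0 < J'" "J' * a < 1" using o by (auto simp: once_around_def)
  have n: "n \<ge> 1" using o by (cases n) (auto simp: once_around_def)
  have "\<not> J \<le> J'"
  proof
    assume "J \<le> J'"
    then have "(fwd J ^^ n) 0 \<le> (fwd J' ^^ n) 0"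
      using fwd_iterate_mono_J[of J J' n 0] J n by (cases "J = J'") auto
    also have "\<dots> < (fwd J' ^^ n') 0" by (rule fwd_iterate_strict_mono[OF \<open>n < n'\<close>])
    finally show False using o by (simp add: once_around_def)
  qed
  then have "J' \<le> J" by simp
  have "once_length n J = total_length J n (0, mom J 0)" using once_around_length[OF o(1), of 0] by simp
  also have "\<dots> \<le> real n * gap J' + circ J'"
    using total_length_comparison[OF J(3) \<open>J' \<le> J\<close> J(2), of n 0] o(1)
    by (simp add: once_around_def circ_def action_zero)
  also have "\<dots> + gap J' = real (Suc n) * gap J' + circ J'" by (simp add: algebra_simps)
  also have "\<dots> \<le> once_length n' J'"
    using \<open>n < n'\<close> gap_pos[OF J(3,4)] unfolding once_length_def
    by (intro add_mono mult_right_mono) auto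
  finally show ?thesis by simp
qed

lemma once_length_le: "once_around n J \<Longrightarrow> once_length n J \<le> circ 0"
  using once_around_length[of n J 0] total_length_le_action0[of J n 0]
  by (auto simp: once_around_def circ_def action_zero)

text \<open>Intermediate values in \<open>J\<close>. At \<open>J0\<close> a step turns by at most
  \<open>pi / k\<close>, in total by at most \<open>pi\<close>; at \<open>J1\<close> it turns by at
  least \<open>b / a\<close>, in total by at least \<open>2 pi\<close>. The bound
  \<open>3 \<le> k\<close> gives \<open>sin y \<le> 1 / 2\<close>, hence
  \<open>J0 \<le> J1\<close>.\<close>

lemma once_around_exists:
  assumes k: "3 \<le> k" "2 * pi * a \<le> real k * b"
  shows "\<exists>J. once_around k J"
proof -
  define y where "y = pi / (2 * real k)"
  have y: "0 < y" "y \<le> pi / 6" using k(1) by (auto simp: y_def field_simps)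
  have "sin y \<le> sin (pi / 6)" using y by (intro sin_monotone_2pi_le) auto
  then have sy: "sin y \<le> 1 / 2" by (simp add: sin_30)
  have sy0: "sin y > 0" using y pi_gt_zero by (intro sin_gt_zero) auto
  define J0 where "J0 = sin y / a"
  define J1 where "J1 = 1 / (2 * a)"
  have J0: "0 < J0" "J0 * a = sin y" and J1: "0 < J1" "J1 * a = 1 / 2"
    using a_pos sy0 by (auto simp: J0_def J1_def)
  have le: "J0 \<le> J1" using sy a_pos by (simp add: J0_def J1_def field_simps)
  have 1: "(fwd J0 ^^ k) 0 \<le> 2 * pi"
  proof -
    have "(fwd J0 ^^ k) 0 \<le> 0 + 2 * real k * arcsin (sin y)"
      using fwd_iterate_bounds(2)[of J0 k 0] J0 sy by simp
    also have "arcsin (sin y) = y" using y pi_gt_zero by (intro arcsin_sin) auto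
    also have "0 + 2 * real k * y = pi" using k(1) by (simp add: y_def)
    finally show ?thesis using pi_gt_zero by linarith
  qed
  have 2: "2 * pi \<le> (fwd J1 ^^ k) 0"
  proof -
    have "2 * pi \<le> 2 * real k * (J1 * b)" using k(2) a_pos by (simp add: J1_def field_simps)
    then show ?thesis using fwd_iterate_bounds(1)[of J1 0 k] J1 by simp
  qed
  have "isCont (\<lambda>J. (fwd J ^^ k) 0) J" if "J0 \<le> J \<and> J \<le> J1" for J
  proof -
    have "J * a \<le> J1 * a" using that a_pos by simp
    then have J: "0 < J" "J * a < 1" using that J0 J1 by auto
    obtain D where "((\<lambda>J. (fwd J ^^ k) 0) has_real_derivative D) (at J)"
      by (rule fwd_iterate_has_derivative[OF J, of k 0])
    then show ?thesis by (rule DERIV_isCont)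
  qed
  then obtain J where "J0 \<le> J" "J \<le> J1" "(fwd J ^^ k) 0 = 2 * pi"
    using IVT[of "\<lambda>J. (fwd J ^^ k) 0" J0 "2 * pi" J1] 1 2 le by blast
  moreover from this have "J * a \<le> J1 * a" using a_pos by simp
  ultimately show ?thesis using J0 J1 by (intro exI[of _ J]) (auto simp: once_around_def)
qed

text \<open>Reflection in the major axis turns \<open>d\<close> into \<open>pi - d\<close>: angles
  always advance, so the mirror image of a short chord goes the long way round. The mirrored orbit
  gains a full turn per step, and \<open>p\<close> turns in \<open>n\<close> steps become
  \<open>n - p\<close>.\<close>

lemma step_mirror: "step J (- t, - z) = (2 * pi - fst (step J (t, z)), - snd (step J (t, z)))"
  and chord_mirror: "chord J (- t, - z) = chord J (t, z)"
proof -
  have h: "half J (- t) (- z) = pi - half J t z"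
  proof -
    have "- z / J - (a\<^sup>2 - b\<^sup>2) * (sin (- t) * cos (- t)) = - (z / J - (a\<^sup>2 - b\<^sup>2) * (sin t * cos t))"
      by simp
    moreover have "P (- t) = P t" by (simp add: P_def)
    ultimately have "cot_half J (- t) (- z) = - cot_half J t z"
      unfolding cot_half_def by (simp only: minus_divide_left)
    then show ?thesis by (simp add: half_def arctan_minus)
  qed
  show "chord J (- t, - z) = chord J (t, z)" by (simp add: chord_def h)
  have "- t + (pi - half J t z) = pi - (t + half J t z)" by simp
  then have "next_mom J (- t + (pi - half J t z)) (pi - half J t z) = - next_mom J (t + half J t z) (half J t z)"
    by (simp only: next_mom_def sin_pi_minus cos_pi_minus mult_minus_right minus_add_distrib minus_divide_left)
  then show "step J (- t, - z) = (2 * pi - fst (step J (t, z)), - snd (step J (t, z)))"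
    unfolding step_def split h by simp
qed

lemma iterate_mirror: "(step J ^^ n) (- t, - z) =
   (- fst ((step J ^^ n) (t, z)) + pi * of_int (2 * int n), - snd ((step J ^^ n) (t, z)))"
proof (induction n)
  case (Suc n)
  let ?t = "fst ((step J ^^ n) (t, z))" and ?z = "snd ((step J ^^ n) (t, z))"
  have "(step J ^^ Suc n) (- t, - z) = step J (- ?t + pi * of_int (2 * int n), - ?z)" using Suc by simp
  also have "\<dots> = (2 * pi - fst (step J (?t, ?z)) + pi * of_int (2 * int n), - snd (step J (?t, ?z)))"
    by (simp only: step_shift step_mirror fst_conv snd_conv)
  finally show ?case by (simp add: algebra_simps)
qed simp

lemma total_length_mirror: "total_length J n (- t, - z) = total_length J n (t, z)"
  unfolding total_length_def iterate_mirror chord_shift chord_mirror by simp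

lemma closes_mirror: "closes J n p (t, z) \<Longrightarrow> closes J n (int n - p) (- t, - z)"
  by (simp add: closes_def iterate_mirror algebra_simps)

lemma mom_minus: "mom J (- t) = mom J t"
  by (simp add: mom_def P_def)

lemma isolated_once_around:
  obtains k J \<epsilon> where "2 \<le> k" "once_around k J" "0 < \<epsilon>"
    "\<And>j J' p t z. \<lbrakk>1 \<le> j; level J' (t, z); closes J' j p (t, z);
      \<bar>total_length J' j (t, z) - once_length k J\<bar> \<le> \<epsilon>\<rbrakk> \<Longrightarrow> J' = J"
proof -
  define L where "L = circ 0"
  have L: "L > 0" by (simp add: L_def circ0_pos)
  \<comment> \<open>A chord with \<open>J a > 1 / 2\<close> is longer than \<open>b^2 / a\<close>,
    so an orbit of length at most \<open>L + 1\<close> has at most \<open>N\<close> of them.\<close>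
  define N where "N = nat \<lceil>(L + 1) * a / b\<^sup>2\<rceil>"
  define F where "F = (\<Union>j\<in>{1..N}. closed_lengths j)"
  have finF: "finite F" by (simp add: F_def finite_closed_lengths)
  define K where "K = max 3 (nat \<lceil>2 * pi * a / b\<rceil>)"
  have "\<exists>J. once_around k J" if "K \<le> k" for k
  proof (rule once_around_exists)
    show "3 \<le> k" using that by (simp add: K_def)
    have "2 * pi * a / b \<le> real k" using that unfolding K_def by linarith
    then show "2 * pi * a \<le> real k * b" using b_pos by (simp add: field_simps)
  qed
  then obtain Jf where Jf: "\<And>k. K \<le> k \<Longrightarrow> once_around k (Jf k)" by metis
  define T where "T = (\<lambda>k. once_length k (Jf k))"
  have Jf': "0 < Jf k" "Jf k * a < 1" if "K \<le> k" for k using Jf[OF that] by (auto simp: once_around_def)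
  have T_less: "T k < T k'" if "K \<le> k" "k < k'" for k k'
    using once_length_gap[OF Jf[of k] Jf[of k'] that(2)] gap_pos[OF Jf'[of k']] that by (simp add: T_def)
  have "inj_on T {K..}"
    by (rule linorder_inj_onI) (use T_less in \<open>force+\<close>)
  then have "infinite (T ` {K..})" using finite_imageD infinite_Ici by blast
  then have "\<not> T ` {K..} \<subseteq> F" using finF finite_subset by blast
  then obtain k where k: "K \<le> k" "T k \<notin> F" by blast
  obtain \<delta> where \<delta>: "\<delta> > 0" "\<And>l. l \<in> F \<Longrightarrow> \<delta> \<le> \<bar>l - T k\<bar>"
    using finite_set_avoid[OF finF, of "T k"] k(2) by (metis dist_commute dist_real_def)
  define g where "g = min (gap (Jf k)) (gap (Jf (Suc k)))"
  have g: "0 < g" "g \<le> gap (Jf k)" "g \<le> gap (Jf (Suc k))"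
    using gap_pos[OF Jf'[of k]] gap_pos[OF Jf'[of "Suc k"]] k(1) by (auto simp: g_def)
  \<comment> \<open>\<open>\<delta>\<close> keeps away from the finite set \<open>F\<close>,
    \<open>g\<close> from the neighbouring lengths of one turn, \<open>L / 4\<close> from two or
    more turns, which cost at least \<open>3 L / 2\<close>, and \<open>1\<close> justifies the
    length bound \<open>L + 1\<close> behind \<open>N\<close>.\<close>
  define \<epsilon> where "\<epsilon> = min (min (\<delta> / 2) (g / 2)) (min (L / 4) 1)"
  have \<epsilon>: "0 < \<epsilon>" "\<epsilon> < \<delta>" "\<epsilon> < g" "\<epsilon> \<le> L / 4" "\<epsilon> \<le> 1"
    using \<delta>(1) g(1) L by (auto simp: \<epsilon>_def min_def)
  have TL: "T k \<le> L" using once_length_le[OF Jf[OF k(1)]] by (simp add: T_def L_def)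
  have main: "J' = Jf k" if j: "1 \<le> j" and J': "0 < J'" "J' * a \<le> 1 / 2"
    and cl: "closes J' j p (t, mom J' t)" and len: "\<bar>total_length J' j (t, mom J' t) - T k\<bar> \<le> \<epsilon>" for j J' p t
  proof -
    have J'': "0 < J'" "J' * a < 1" using J' by auto
    have cl0: "closes J' j p (0, mom J' 0)" and
      l0: "total_length J' j (0, mom J' 0) = total_length J' j (t, mom J' t)"
      by (rule closes_elliptic_all[OF J'' cl])+
    have e: "(fwd J' ^^ j) 0 = 2 * pi * of_int p" using cl0 by (simp add: closes_elliptic[OF J''])
    have "(fwd J' ^^ 0) 0 < (fwd J' ^^ j) 0" by (rule fwd_iterate_strict_mono) (use j in auto)
    then have "p > 0" using e by (simp add: zero_less_mult_iff)
    have "\<not> p \<ge> 2"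
    proof
      assume "p \<ge> 2"
      have "(fwd J' ^^ j) 0 = 0 + 2 * pi * real (nat p)" using e \<open>p > 0\<close> by simp
      then have "total_length J' j (0, mom J' 0) = real j * gap J' + real (nat p) * circ J'"
        using action_shift[of J' 0 "nat p"] by (simp add: total_length_elliptic[OF J''] action_zero)
      moreover have "0 \<le> real j * gap J'" using gap_pos[OF J''] by simp
      moreover have "2 * (3 / 4 * L) \<le> real (nat p) * circ J'"
        using circ_lower[OF J'] \<open>p \<ge> 2\<close> L unfolding L_def by (intro mult_mono) auto
      ultimately show False using len l0 TL \<epsilon>(4) L by linarith
    qed
    then have "p = 1" using \<open>p > 0\<close> by linarith
    then have o: "once_around j J'" using e J' by (simp add: once_around_def)
    have lenj: "total_length J' j (t, mom J' t) = once_length j J'" by (rule once_around_length[OF o])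
    have "\<not> j < k"
      using once_length_gap[OF o Jf[OF k(1)]] len lenj \<epsilon>(3) g by (auto simp: T_def)
    moreover have "\<not> k < j"
    proof
      assume "k < j"
      have 1: "T k + gap (Jf (Suc k)) \<le> T (Suc k)"
        using once_length_gap[OF Jf[of k] Jf[of "Suc k"]] k(1) by (simp add: T_def)
      have "T (Suc k) \<le> once_length j J'"
      proof (cases "j = Suc k")
        case True
        then have "J' = Jf (Suc k)" using once_around_unique[OF o] Jf[of j] k(1) by simp
        then show ?thesis by (simp add: T_def True)
      next
        case False
        then show ?thesis
          using once_length_gap[OF Jf[of "Suc k"] o] gap_pos[OF J''] k(1) \<open>k < j\<close> by (simp add: T_def)
      qed
      then show False using 1 len lenj \<epsilon>(3) g by linarith
    qed
    ultimately have "j = k" by simp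
    then show ?thesis using once_around_unique[OF o] Jf[OF k(1)] by simp
  qed
  have "J' = Jf k" if j: "1 \<le> j" and lev: "level J' (t, z)" and cl: "closes J' j p (t, z)"
    and len: "\<bar>total_length J' j (t, z) - T k\<bar> \<le> \<epsilon>" for j J' p t z
  proof -
    have J': "0 < J'" using lev by (simp add: level_def)
    have small: "J' * a \<le> 1 / 2"
    proof (rule ccontr)
      assume "\<not> J' * a \<le> 1 / 2"
      then have h: "1 / 2 < J' * a" by simp
      have "total_length J' j (t, z) \<ge> (\<Sum>i<j. 2 * J' * b\<^sup>2)"
        unfolding total_length_def by (intro sum_mono chord_bounds level_iterate lev)
      then have 1: "real j * (2 * J' * b\<^sup>2) \<le> L + 1" using len TL \<epsilon>(5) by simp
      have "b\<^sup>2 / a \<le> 2 * J' * b\<^sup>2" using h a_pos b_pos by (simp add: field_simps)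
      then have "real j * (b\<^sup>2 / a) \<le> real j * (2 * J' * b\<^sup>2)" by (intro mult_left_mono) auto
      then have "real j * (b\<^sup>2 / a) \<le> L + 1" using 1 by linarith
      then have "real j \<le> (L + 1) * a / b\<^sup>2" using a_pos b_pos by (simp add: field_simps)
      then have "j \<le> N" unfolding N_def by linarith
      then have "total_length J' j (t, z) \<in> F"
        using j lev cl by (auto simp: F_def closed_lengths_def intro!: bexI[of _ j])
      then show False using \<delta>(2) len \<epsilon>(2) by force
    qed
    then have J'': "0 < J'" "J' * a < 1" using J' by auto
    show ?thesis
    proof (cases "z = mom J' t")
      case True
      then show ?thesis using main[OF j J' small] cl len by simp
    next
      case False
      \<comment> \<open>The remaining branch is clockwise; its mirror image has the same level and
        length and falls under \<open>main\<close>.\<close>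
      then have z: "- z = mom J' (- t)" using lev by (simp add: level_mom_iff[OF J''] mom_minus)
      then show ?thesis
        using main[OF j J' small, of "int j - p" "- t"] closes_mirror[OF cl] total_length_mirror[of J' j t z] len
        by simp
    qed
  qed
  moreover have "2 \<le> k" using k(1) by (simp add: K_def)
  ultimately show thesis using that[of k "Jf k" \<epsilon>] Jf[OF k(1)] \<epsilon>(1) by (simp add: T_def)
qed

end

section \<open>Smooth functions\<close>

text \<open>
  Smoothness requires all derivatives at once; it suffices that the derivatives of the generators
  of an algebra of functions lie in that algebra.
\<close>

inductive_set fun_algebra :: "(real \<Rightarrow> real) set \<Rightarrow> (real \<Rightarrow> real) set" for B where
  const: "(\<lambda>_. r) \<in> fun_algebra B"
| base: "f \<in> B \<Longrightarrow> f \<in> fun_algebra B"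
| add: "f \<in> fun_algebra B \<Longrightarrow> g \<in> fun_algebra B \<Longrightarrow> (\<lambda>t. f t + g t) \<in> fun_algebra B"
| mult: "f \<in> fun_algebra B \<Longrightarrow> g \<in> fun_algebra B \<Longrightarrow> (\<lambda>t. f t * g t) \<in> fun_algebra B"

lemma fun_algebra_derivative:
  assumes "\<And>f. f \<in> B \<Longrightarrow> \<exists>f'\<in>fun_algebra B. \<forall>t\<in>S. (f has_real_derivative f' t) (at t)"
    and "f \<in> fun_algebra B"
  shows "\<exists>f'\<in>fun_algebra B. \<forall>t\<in>S. (f has_real_derivative f' t) (at t)"
  using assms(2)
proof induction
  case (const r)
  show ?case by (rule bexI[of _ "\<lambda>_. 0"]) (auto intro: fun_algebra.const)
next
  case (base f)
  then show ?case by (rule assms(1))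
next
  case (add f g)
  then obtain f' g' where "f' \<in> fun_algebra B" "g' \<in> fun_algebra B"
    "\<forall>t\<in>S. (f has_real_derivative f' t) (at t)" "\<forall>t\<in>S. (g has_real_derivative g' t) (at t)" by blast
  then show ?case
    by (intro bexI[of _ "\<lambda>t. f' t + g' t"]) (auto intro!: DERIV_add fun_algebra.add)
next
  case (mult f g)
  then obtain f' g' where *: "f' \<in> fun_algebra B" "g' \<in> fun_algebra B"
    "\<forall>t\<in>S. (f has_real_derivative f' t) (at t)" "\<forall>t\<in>S. (g has_real_derivative g' t) (at t)" by blast
  show ?case
    by (rule bexI[of _ "\<lambda>t. f' t * g t + g' t * f t"])
       (use * mult.hyps in \<open>auto intro!: DERIV_mult fun_algebra.add fun_algebra.mult\<close>)
qed

text \<open>Derivatives are chosen once for the whole algebra, as an operator \<open>D\<close> of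
  the algebra into itself, and the powers of \<open>D\<close> provide all orders at once. The values
  of \<open>D\<close> are derivatives on \<open>S\<close> only.\<close>

lemma smooth_fun_on_algebra:
  assumes B: "\<And>f. f \<in> B \<Longrightarrow> \<exists>f'\<in>fun_algebra B. \<forall>t\<in>S. (f has_real_derivative f' t) (at t)"
    and f: "f \<in> fun_algebra B"
  shows "smooth_fun_on S f"
proof -
  have "\<exists>D. \<forall>g\<in>fun_algebra B. D g \<in> fun_algebra B \<and> (\<forall>t\<in>S. (g has_real_derivative D g t) (at t))"
    using fun_algebra_derivative[OF B] by (intro bchoice) blast
  then obtain D where D: "\<And>g. g \<in> fun_algebra B \<Longrightarrow> D g \<in> fun_algebra B"
    "\<And>g t. g \<in> fun_algebra B \<Longrightarrow> t \<in> S \<Longrightarrow> (g has_real_derivative D g t) (at t)" by blast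
  have mem: "(D ^^ n) f \<in> fun_algebra B" for n by (induction n) (use f D(1) in auto)
  show ?thesis unfolding smooth_fun_on_def
    by (rule exI[of _ "\<lambda>n. (D ^^ n) f"])
       (use D(2)[OF mem] in \<open>simp add: has_real_derivative_iff_has_vector_derivative\<close>)
qed

lemma smooth_fun_on_const: "smooth_fun_on S (\<lambda>_. v)"
  unfolding smooth_fun_on_def
  by (rule exI[of _ "\<lambda>n. case n of 0 \<Rightarrow> (\<lambda>_. v) | Suc _ \<Rightarrow> (\<lambda>_. 0)"]) (auto split: nat.split)

lemma smooth_fun_on_add:
  assumes "smooth_fun_on S f" "smooth_fun_on S g" shows "smooth_fun_on S (\<lambda>t. f t + g t)"
proof -
  obtain F G where "F 0 = f" "\<forall>n. \<forall>t\<in>S. (F n has_vector_derivative F (Suc n) t) (at t)"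
    "G 0 = g" "\<forall>n. \<forall>t\<in>S. (G n has_vector_derivative G (Suc n) t) (at t)"
    using assms unfolding smooth_fun_on_def by blast
  then show ?thesis unfolding smooth_fun_on_def
    by (intro exI[of _ "\<lambda>n t. F n t + G n t"]) (auto intro: has_vector_derivative_add)
qed

lemma smooth_fun_on_scaleR:
  assumes "smooth_fun_on S f" shows "smooth_fun_on S (\<lambda>t. f t *\<^sub>R v)"
proof -
  obtain F where "F 0 = f" "\<forall>n. \<forall>t\<in>S. (F n has_vector_derivative F (Suc n) t) (at t)"
    using assms unfolding smooth_fun_on_def by blast
  then show ?thesis unfolding smooth_fun_on_def
    by (intro exI[of _ "\<lambda>n t. F n t *\<^sub>R v"])
       (auto intro: has_vector_derivative_scaleR[OF _ has_vector_derivative_const, simplified]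
         simp: has_real_derivative_iff_has_vector_derivative)
qed

text \<open>The algebra generated by \<open>s\<close>, the root \<open>R\<close> and
  \<open>1 / R\<close> is closed under differentiation on the open interval, where \<open>R\<close>
  does not vanish. The function is a half ellipse written as a graph.\<close>

lemma smooth_fun_on_sqrt:
  assumes "0 < A"
  shows "smooth_fun_on {s0 - A<..<s0 + A} (\<lambda>s. k + l * sqrt (1 - ((s - s0) / A)\<^sup>2))"
proof (rule smooth_fun_on_algebra)
  define R where "R = (\<lambda>s. sqrt (1 - ((s - s0) / A)\<^sup>2))"
  define B where "B = {\<lambda>s. s, R, \<lambda>s. 1 / R s}"
  have mem: "(\<lambda>s. s) \<in> fun_algebra B" "R \<in> fun_algebra B" "(\<lambda>s. 1 / R s) \<in> fun_algebra B"
    by (auto simp: B_def intro: fun_algebra.base)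
  note I = mem fun_algebra.const fun_algebra.add fun_algebra.mult
  show "(\<lambda>s. k + l * sqrt (1 - ((s - s0) / A)\<^sup>2)) \<in> fun_algebra B"
    using fun_algebra.add[OF fun_algebra.const fun_algebra.mult[OF fun_algebra.const mem(2)], of k l]
    by (simp add: R_def)
  have pos: "0 < 1 - ((s - s0) / A)\<^sup>2" if "s \<in> {s0 - A<..<s0 + A}" for s
  proof -
    have "\<bar>(s - s0) / A\<bar> < 1" using that assms by (simp add: field_simps abs_less_iff)
    then show ?thesis by (simp add: abs_square_less_1)
  qed
  have dR: "(R has_real_derivative (- 1 / A\<^sup>2) * ((s + - s0) * (1 / R s))) (at s)"
    if "s \<in> {s0 - A<..<s0 + A}" for s
  proof -
    have 0: "((\<lambda>s. (s - s0) / A) has_real_derivative 1 / A) (at s)"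
      by (rule DERIV_cong[OF DERIV_cdivide[OF DERIV_diff[OF DERIV_ident DERIV_const]]]) simp
    have 1: "((\<lambda>s. 1 - ((s - s0) / A)\<^sup>2) has_real_derivative 2 * ((- 1 / A\<^sup>2) * (s - s0))) (at s)"
      by (rule derivative_eq_intros 0 refl)+ (use assms in \<open>auto simp: field_simps power2_eq_square\<close>)
    have eq: "inverse q / 2 * (2 * x) = x / q" for q x :: real by (simp add: divide_simps)
    have "(R has_real_derivative (- 1 / A\<^sup>2) * (s - s0) / R s) (at s)"
      unfolding R_def using DERIV_chain2[where f = sqrt, OF DERIV_real_sqrt[OF pos[OF that]] 1]
      by (simp only: eq)
    then show ?thesis by simp
  qed
  have R: "R s > 0" if "s \<in> {s0 - A<..<s0 + A}" for s using pos[OF that] by (simp add: R_def)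
  have dR': "((\<lambda>s. 1 / R s) has_real_derivative
      (- 1) * ((- 1 / A\<^sup>2) * ((s + - s0) * (1 / R s)) * ((1 / R s) * (1 / R s)))) (at s)"
    if "s \<in> {s0 - A<..<s0 + A}" for s
  proof -
    have eq: "(0 * y - 1 * D) / (y * y) = (- 1) * (D * ((1 / y) * (1 / y)))" for y D :: real by simp
    have "R s \<noteq> 0" using R[OF that] by simp
    from DERIV_divide[OF DERIV_const dR[OF that] this, of 1] show ?thesis unfolding eq .
  qed
  fix f assume "f \<in> B"
  then consider "f = (\<lambda>s. s)" | "f = R" | "f = (\<lambda>s. 1 / R s)" by (auto simp: B_def)
  then show "\<exists>f'\<in>fun_algebra B. \<forall>t\<in>{s0 - A<..<s0 + A}. (f has_real_derivative f' t) (at t)"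
  proof cases
    case 1
    then show ?thesis by (intro bexI[of _ "\<lambda>_. 1"]) (auto intro: fun_algebra.const)
  next
    case 2
    have "(\<lambda>s. (- 1 / A\<^sup>2) * ((s + - s0) * (1 / R s))) \<in> fun_algebra B" by (intro I)
    then show ?thesis unfolding 2 by (rule bexI[rotated]) (intro ballI dR)
  next
    case 3
    have "(\<lambda>s. (- 1) * ((- 1 / A\<^sup>2) * ((s + - s0) * (1 / R s)) * ((1 / R s) * (1 / R s)))) \<in> fun_algebra B"
      by (intro I)
    then show ?thesis unfolding 3 by (rule bexI[rotated]) (intro ballI dR')
  qed
qed

text \<open>The reciprocals are generators because differentiating \<open>mom J\<close> and
  \<open>1 / P\<close> produces them. The affine argument \<open>t + r * s\<close> serves both
  tangent curves of arbitrary speed and the period-one parametrization of the circle.\<close>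

definition (in ellipse_axes) ellipse_base :: "real \<Rightarrow> real \<Rightarrow> real \<Rightarrow> (real \<Rightarrow> real) set" where
  "ellipse_base J t r = {\<lambda>s. sin (t + r * s), \<lambda>s. cos (t + r * s), \<lambda>s. mom J (t + r * s),
     \<lambda>s. 1 / mom J (t + r * s), \<lambda>s. 1 / P (t + r * s)}"

lemma (in ellipse_axes) smooth_ellipse_base:
  assumes J: "0 < J" "J * a < 1" and f: "f \<in> fun_algebra (ellipse_base J t r)"
  shows "smooth_fun_on S f"
proof (rule smooth_fun_on_algebra[OF _ f])
  define C where "C = a\<^sup>2 - b\<^sup>2"
  define u where "u = (\<lambda>s. t + r * s)"
  have du: "(u has_real_derivative r) (at s)" for s
    unfolding u_def by (auto intro!: derivative_eq_intros)
  have B: "ellipse_base J t r = {\<lambda>s. sin (u s), \<lambda>s. cos (u s), \<lambda>s. mom J (u s),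
     \<lambda>s. 1 / mom J (u s), \<lambda>s. 1 / P (u s)}" (is "_ = ?B") by (simp add: ellipse_base_def u_def)
  have mem: "(\<lambda>s. sin (u s)) \<in> fun_algebra ?B" "(\<lambda>s. cos (u s)) \<in> fun_algebra ?B"
    "(\<lambda>s. mom J (u s)) \<in> fun_algebra ?B" "(\<lambda>s. 1 / mom J (u s)) \<in> fun_algebra ?B"
    "(\<lambda>s. 1 / P (u s)) \<in> fun_algebra ?B" by (auto intro: fun_algebra.base)
  note I = mem fun_algebra.const fun_algebra.mult
  have m: "mom J x > 0" for x by (rule mom_pos[OF J])
  have d1: "((\<lambda>s. sin (u s)) has_real_derivative r * cos (u s)) (at s)"
    and d2: "((\<lambda>s. cos (u s)) has_real_derivative (- r) * sin (u s)) (at s)" for s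
    by (auto intro!: derivative_eq_intros du)
  have d3: "((\<lambda>s. mom J (u s)) has_real_derivative (C * r) * (sin (u s) * cos (u s) * (1 / mom J (u s)))) (at s)" for s
    by (rule DERIV_cong[OF DERIV_chain2[OF mom_has_derivative[OF J] du]]) (simp add: C_def)
  have d4: "((\<lambda>s. 1 / mom J (u s)) has_real_derivative (- C * r) * (sin (u s) * cos (u s) * (1 / mom J (u s)) *
      ((1 / mom J (u s)) * (1 / mom J (u s))))) (at s)" for s
    by (rule DERIV_cong[OF DERIV_divide[OF DERIV_const d3]]) (use m[of "u s"] in auto)
  have d5: "((\<lambda>s. 1 / P (u s)) has_real_derivative (- 2 * C * r) * (sin (u s) * cos (u s) *
      ((1 / P (u s)) * (1 / P (u s))))) (at s)" for s
    by (rule DERIV_cong[OF DERIV_divide[OF DERIV_const DERIV_chain2[OF P_has_derivative[folded C_def] du]]])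
       (use P_pos[of "u s"] in auto)
  fix f assume "f \<in> ellipse_base J t r"
  then consider "f = (\<lambda>s. sin (u s))" | "f = (\<lambda>s. cos (u s))" | "f = (\<lambda>s. mom J (u s))"
    | "f = (\<lambda>s. 1 / mom J (u s))" | "f = (\<lambda>s. 1 / P (u s))" unfolding B by blast
  then show "\<exists>f'\<in>fun_algebra (ellipse_base J t r). \<forall>t\<in>S. (f has_real_derivative f' t) (at t)"
    unfolding B
  proof cases
    case 1
    show "\<exists>f'\<in>fun_algebra ?B. \<forall>t\<in>S. (f has_real_derivative f' t) (at t)"
      unfolding 1 by (rule bexI[OF _ fun_algebra.mult[OF fun_algebra.const[of r] mem(2)]]) (use d1 in blast)
  next
    case 2
    show "\<exists>f'\<in>fun_algebra ?B. \<forall>t\<in>S. (f has_real_derivative f' t) (at t)"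
      unfolding 2 by (rule bexI[OF _ fun_algebra.mult[OF fun_algebra.const[of "- r"] mem(1)]]) (use d2 in blast)
  next
    case 3
    have "(\<lambda>s. (C * r) * (sin (u s) * cos (u s) * (1 / mom J (u s)))) \<in> fun_algebra ?B" by (intro I)
    then show "\<exists>f'\<in>fun_algebra ?B. \<forall>t\<in>S. (f has_real_derivative f' t) (at t)"
      unfolding 3 by (rule bexI[rotated]) (intro ballI d3)
  next
    case 4
    have "(\<lambda>s. (- C * r) * (sin (u s) * cos (u s) * (1 / mom J (u s)) *
      ((1 / mom J (u s)) * (1 / mom J (u s))))) \<in> fun_algebra ?B" by (intro I)
    then show "\<exists>f'\<in>fun_algebra ?B. \<forall>t\<in>S. (f has_real_derivative f' t) (at t)"
      unfolding 4 by (rule bexI[rotated]) (intro ballI d4)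
  next
    case 5
    have "(\<lambda>s. (- 2 * C * r) * (sin (u s) * cos (u s) *
      ((1 / P (u s)) * (1 / P (u s))))) \<in> fun_algebra ?B" by (intro I)
    then show "\<exists>f'\<in>fun_algebra ?B. \<forall>t\<in>S. (f has_real_derivative f' t) (at t)"
      unfolding 5 by (rule bexI[rotated]) (intro ballI d5)
  qed
qed

section \<open>The billiard map of an ellipse in the plane\<close>

locale ellipse_frame = ellipse_axes a b for a b :: real +
  fixes ctr u1 u2 :: plane
  assumes u11: "u1 \<bullet> u1 = 1" and u22: "u2 \<bullet> u2 = 1" and u12: "u1 \<bullet> u2 = 0"
begin

definition vec2 :: "real \<Rightarrow> real \<Rightarrow> plane" where
  "vec2 x y = x *\<^sub>R u1 + y *\<^sub>R u2"

lemma u21: "u2 \<bullet> u1 = 0"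
  using u12 by (simp add: inner_commute)

text \<open>The matrix with rows \<open>u1\<close> and \<open>u2\<close> has orthonormal rows, so
  its squared determinant is \<open>1\<close>; its columns are then orthonormal too, which gives the
  expansion.\<close>

lemma vec2_coord: "vec2 (v \<bullet> u1) (v \<bullet> u2) = v"
proof -
  define p q r s where "p = u1 $ 1" "q = u1 $ 2" "r = u2 $ 1" "s = u2 $ 2"
  note defs = this
  have e: "p * p + q * q = 1" "r * r + s * s = 1" "p * r + q * s = 0"
    using u11 u22 u12 by (simp_all add: inner_vec_def UNIV_2 defs)
  have d: "(p * s - q * r)\<^sup>2 = 1" using e by algebra
  have "(p * s - q * r)\<^sup>2 * (p * p + r * r) = (p * s - q * r)\<^sup>2" "(p * s - q * r)\<^sup>2 * (q * q + s * s) = (p * s - q * r)\<^sup>2"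
    "(p * s - q * r)\<^sup>2 * (p * q + r * s) = 0"
    using e by algebra+
  then have f: "p * p + r * r = 1" "q * q + s * s = 1" "p * q + r * s = 0" by (simp_all add: d)
  have v: "v \<bullet> u1 = v $ 1 * p + v $ 2 * q" "v \<bullet> u2 = v $ 1 * r + v $ 2 * s"
    by (simp_all add: inner_vec_def UNIV_2 defs)
  have "vec2 (v \<bullet> u1) (v \<bullet> u2) $ 1 = v $ 1" 
    using f by (simp add: vec2_def v defs[symmetric]) algebra
  moreover have "vec2 (v \<bullet> u1) (v \<bullet> u2) $ 2 = v $ 2"
    using f by (simp add: vec2_def v defs[symmetric]) algebra
  ultimately show ?thesis by (simp add: vec_eq_iff forall_2)
qed

lemma vec2_inner: "vec2 x y \<bullet> u1 = x" "vec2 x y \<bullet> u2 = y" "vec2 x y \<bullet> vec2 x' y' = x * x' + y * y'"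
  by (simp_all add: vec2_def inner_add_left inner_add_right u11 u22 u12 u21)

lemma vec2_eq_iff: "vec2 x y = vec2 x' y' \<longleftrightarrow> x = x' \<and> y = y'"
  by (metis vec2_inner(1,2))

lemma vec2_cases: obtains x y where "v = vec2 x y"
  using vec2_coord by metis

lemma vec2_add: "vec2 x y + vec2 x' y' = vec2 (x + x') (y + y')"
  and vec2_diff: "vec2 x y - vec2 x' y' = vec2 (x - x') (y - y')"
  and vec2_scaleR: "r *\<^sub>R vec2 x y = vec2 (r * x) (r * y)"
  and vec2_minus: "- vec2 x y = vec2 (- x) (- y)"
  by (simp_all add: vec2_def algebra_simps)

lemma vec2_norm_sq: "(norm (vec2 x y))\<^sup>2 = x\<^sup>2 + y\<^sup>2"
  unfolding power2_norm_eq_inner vec2_inner by (simp add: power2_eq_square)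

lemma vec2_norm: "norm (vec2 x y) = sqrt (x\<^sup>2 + y\<^sup>2)"
  by (simp add: norm_eq_sqrt_inner vec2_inner power2_eq_square)

section \<open>The ellipse as the boundary of a convex region\<close>

definition quad :: "plane \<Rightarrow> real" where
  "quad v = ((v \<bullet> u1) / a)\<^sup>2 + ((v \<bullet> u2) / b)\<^sup>2"

definition region :: "plane set" where
  "region = {x. quad (x - ctr) < 1}"

definition ell :: "plane set" where
  "ell = {x. quad (x - ctr) = 1}"

definition normalize2 :: "plane \<Rightarrow> plane" where
  "normalize2 v = vec2 ((v \<bullet> u1) / a) ((v \<bullet> u2) / b)"

lemma quad_eq_norm: "quad v = (norm (normalize2 v))\<^sup>2"
  by (simp add: quad_def normalize2_def vec2_norm_sq)

lemma linear_normalize2: "linear normalize2"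
  by (rule linearI) (simp_all add: normalize2_def vec2_add vec2_scaleR inner_add_left add_divide_distrib)

lemma norm_le_quad: "(norm v)\<^sup>2 \<le> a\<^sup>2 * quad v"
proof -
  obtain x y where v: "v = vec2 x y" by (rule vec2_cases)
  have "b\<^sup>2 \<le> a\<^sup>2" using b_pos b_le_a by (simp add: power_mono)
  then have "y\<^sup>2 * 1 \<le> y\<^sup>2 * (a\<^sup>2 / b\<^sup>2)" using b_pos by (intro mult_left_mono) auto
  moreover have "a\<^sup>2 * quad v = x\<^sup>2 + y\<^sup>2 * (a\<^sup>2 / b\<^sup>2)"
    using a_pos by (simp add: v quad_def vec2_inner power_divide distrib_left)
  ultimately show ?thesis by (simp add: v vec2_norm_sq)
qed

lemma cont_quad: "continuous_on S (\<lambda>x. quad (x - ctr))"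
  unfolding quad_def using a_pos b_pos by (intro continuous_intros) auto

lemma solid_ellipse: "{x. quad (x - ctr) \<le> 1} = (\<lambda>v. ctr + v) ` (normalize2 -` cball 0 1)"
proof -
  have "quad v \<le> 1 \<longleftrightarrow> norm (normalize2 v) \<le> 1" for v
    using abs_square_le_1[of "norm (normalize2 v)"] by (simp add: quad_eq_norm)
  then have *: "quad (x - ctr) \<le> 1 \<longleftrightarrow> x - ctr \<in> normalize2 -` cball 0 1" for x
    by simp
  show ?thesis
  proof (intro set_eqI iffI)
    fix x assume "x \<in> {x. quad (x - ctr) \<le> 1}"
    then show "x \<in> (\<lambda>v. ctr + v) ` (normalize2 -` cball 0 1)"
      using * by (intro image_eqI[of _ _ "x - ctr"]) auto
  next
    fix x assume "x \<in> (\<lambda>v. ctr + v) ` (normalize2 -` cball 0 1)"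
    then obtain v where "x = ctr + v" "v \<in> normalize2 -` cball 0 1" by blast
    then show "x \<in> {x. quad (x - ctr) \<le> 1}" using *[of x] by simp
  qed
qed

lemma convex_solid_ellipse: "convex {x. quad (x - ctr) \<le> 1}"
  unfolding solid_ellipse by (intro convex_translation convex_linear_vimage linear_normalize2 convex_cball)

lemma closed_solid_ellipse: "closed {x. quad (x - ctr) \<le> 1}"
  using cont_quad[of UNIV] by (intro closed_Collect_le) auto

lemma open_region: "open region"
  unfolding region_def using cont_quad[of UNIV] by (intro open_Collect_less) auto

lemma ctr_in_region: "ctr \<in> region"
  by (simp add: region_def quad_def)

lemma quad_scaleR: "quad (r *\<^sub>R v) = r\<^sup>2 * quad v"
  by (simp add: quad_def power_divide power_mult_distrib distrib_left)

lemma interior_solid_ellipse: "interior {x. quad (x - ctr) \<le> 1} = region"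
proof
  show "region \<subseteq> interior {x. quad (x - ctr) \<le> 1}"
    by (rule interior_maximal[OF _ open_region]) (auto simp: region_def)
  show "interior {x. quad (x - ctr) \<le> 1} \<subseteq> region"
  proof
    fix x assume x: "x \<in> interior {x. quad (x - ctr) \<le> 1}"
    then obtain e where e: "e > 0" "ball x e \<subseteq> {x. quad (x - ctr) \<le> 1}"
      by (auto simp: mem_interior)
    show "x \<in> region"
    proof (rule ccontr)
      assume "x \<notin> region"
      moreover have "quad (x - ctr) \<le> 1" using x interior_subset by blast
      ultimately have q: "quad (x - ctr) = 1" by (simp add: region_def)
      then have "x \<noteq> ctr" by (auto simp: quad_def)
      \<comment> \<open>Moving \<open>x\<close> radially outward by \<open>e / 2\<close> keeps it in
        the ball but raises \<open>quad\<close> above \<open>1\<close>.\<close>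
      define r where "r = e / (2 * norm (x - ctr))"
      have r: "r > 0" using e \<open>x \<noteq> ctr\<close> by (simp add: r_def)
      let ?y = "x + r *\<^sub>R (x - ctr)"
      have "dist x ?y < e" using e \<open>x \<noteq> ctr\<close> by (simp add: dist_norm r_def)
      then have "quad (?y - ctr) \<le> 1" using e(2) by auto
      moreover have "?y - ctr = (1 + r) *\<^sub>R (x - ctr)" by (simp add: algebra_simps)
      ultimately have "(1 + r)\<^sup>2 \<le> 1" using q by (simp add: quad_scaleR)
      then show False using r by (simp add: abs_square_le_1)
    qed
  qed
qed

lemma frontier_solid_ellipse: "frontier {x. quad (x - ctr) \<le> 1} = ell"
  unfolding frontier_def interior_solid_ellipse closure_closed[OF closed_solid_ellipse] by (auto simp: region_def ell_def)

lemma bounded_solid_ellipse: "bounded {x. quad (x - ctr) \<le> 1}"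
proof -
  have "dist ctr x \<le> a" if "quad (x - ctr) \<le> 1" for x
  proof -
    have "(norm (x - ctr))\<^sup>2 \<le> a\<^sup>2 * quad (x - ctr)" by (rule norm_le_quad)
    also have "\<dots> \<le> a\<^sup>2 * 1" using that by (intro mult_left_mono) auto
    finally have "(norm (x - ctr))\<^sup>2 \<le> a\<^sup>2" by simp
    then have "norm (x - ctr) \<le> a" using a_pos power2_le_imp_le less_imp_le by blast
    then show ?thesis unfolding dist_norm by (subst norm_minus_commute)
  qed
  then show ?thesis unfolding bounded_def by blast
qed

lemma inside_ell: "inside ell = region"
  using inside_frontier_eq_interior[OF bounded_solid_ellipse convex_solid_ellipse] by (simp add: frontier_solid_ellipse interior_solid_ellipse)

lemma frontier_region: "frontier region = ell"
proof -
  have "closure (interior {x. quad (x - ctr) \<le> 1}) = closure {x. quad (x - ctr) \<le> 1}"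
    using ctr_in_region by (intro convex_closure_interior convex_solid_ellipse) (auto simp: interior_solid_ellipse)
  then have "closure region = {x. quad (x - ctr) \<le> 1}"
    by (simp add: interior_solid_ellipse closure_closed closed_solid_ellipse)
  then show ?thesis unfolding frontier_def interior_open[OF open_region] by (auto simp: region_def ell_def)
qed

lemma convex_region: "convex region"
  using convex_interior[OF convex_solid_ellipse] by (simp add: interior_solid_ellipse)

lemma region_properties: "connected region" "bounded region" "starlike region"
proof -
  show "connected region" by (rule convex_connected[OF convex_region])
  show "bounded region" by (rule bounded_subset[OF bounded_solid_ellipse]) (auto simp: region_def)
  show "starlike region" using ctr_in_region convex_region by (intro convex_imp_starlike) auto
qed

section \<open>Tangents and normals of the ellipse\<close>

definition pt :: "real \<Rightarrow> plane" where
  "pt t = ctr + vec2 (a * cos t) (b * sin t)"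

definition vel :: "real \<Rightarrow> plane" where
  "vel t = vec2 (- a * sin t) (b * cos t)"

lemma pt_in_ell: "pt t \<in> ell"
  using a_pos b_pos by (simp add: ell_def pt_def quad_def vec2_inner)

lemma ell_cases:
  assumes "x \<in> ell" obtains t where "x = pt t"
proof -
  have "((x - ctr) \<bullet> u1 / a)\<^sup>2 + ((x - ctr) \<bullet> u2 / b)\<^sup>2 = 1" using assms by (simp add: ell_def quad_def)
  then obtain t where "(x - ctr) \<bullet> u1 / a = cos t" "(x - ctr) \<bullet> u2 / b = sin t"
    using sincos_total_2pi by metis
  then have "(x - ctr) \<bullet> u1 = a * cos t" "(x - ctr) \<bullet> u2 = b * sin t" using a_pos b_pos by (auto simp: field_simps)
  then have "x - ctr = vec2 (a * cos t) (b * sin t)" using vec2_coord by metis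
  then show thesis using that by (simp add: pt_def algebra_simps)
qed

lemma vel_norm_sq: "vel t \<bullet> vel t = P t"
  by (simp add: vel_def vec2_inner P_def power2_eq_square)

lemma vel_nonzero: "vel t \<noteq> 0"
  using vel_norm_sq[of t] P_pos[of t] by auto

lemma pt_has_vector_derivative:
  assumes "(x has_real_derivative x') (at s)"
  shows "((\<lambda>s. pt (x s)) has_vector_derivative x' *\<^sub>R vel (x s)) (at s)"
proof -
  have "((\<lambda>s. a * cos (x s)) has_real_derivative (- a * sin (x s)) * x') (at s)"
    "((\<lambda>s. b * sin (x s)) has_real_derivative (b * cos (x s)) * x') (at s)"
    by (auto intro!: derivative_eq_intros assms)
  then have "((\<lambda>s. (a * cos (x s)) *\<^sub>R u1 + (b * sin (x s)) *\<^sub>R u2) has_vector_derivative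
      ((- a * sin (x s)) * x') *\<^sub>R u1 + ((b * cos (x s)) * x') *\<^sub>R u2) (at s)"
    by (intro has_vector_derivative_add has_vector_derivative_scaleR[OF _ has_vector_derivative_const, simplified])
  moreover have "((- a * sin (x s)) * x') *\<^sub>R u1 + ((b * cos (x s)) * x') *\<^sub>R u2 = x' *\<^sub>R vel (x s)"
    by (simp add: vel_def vec2_def algebra_simps)
  ultimately show ?thesis
    unfolding pt_def vec2_def using has_vector_derivative_add[OF has_vector_derivative_const[of ctr]] by fastforce
qed

lemma coord_has_derivative:
  assumes "(\<gamma> has_vector_derivative v) (at s)"
  shows "((\<lambda>s. (\<gamma> s - ctr) \<bullet> u) has_real_derivative v \<bullet> u) (at s)"
  using bounded_linear.has_vector_derivative[OF bounded_linear_inner_left[of u]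
      has_vector_derivative_diff[OF assms has_vector_derivative_const[of ctr]]]
  by (simp add: has_real_derivative_iff_has_vector_derivative)

lemma smooth_pt: "smooth_fun_on S (\<lambda>s. pt (t + r * s))"
proof -
  obtain J :: real where J: "0 < J" "J * a < 1"
    using a_pos by (intro that[of "1 / (2 * a)"]) auto
  have m: "(\<lambda>s. a * cos (t + r * s)) \<in> fun_algebra (ellipse_base J t r)"
    "(\<lambda>s. b * sin (t + r * s)) \<in> fun_algebra (ellipse_base J t r)"
    by (rule fun_algebra.mult[OF fun_algebra.const fun_algebra.base], simp add: ellipse_base_def)+
  show ?thesis unfolding pt_def vec2_def
    by (intro smooth_fun_on_add smooth_fun_on_const smooth_fun_on_scaleR smooth_ellipse_base[OF J m(1)]
        smooth_ellipse_base[OF J m(2)])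
qed

lemma parallel_vel:
  assumes 0: "cos t * (v \<bullet> u1 / a) + sin t * (v \<bullet> u2 / b) = 0"
  shows "\<exists>r. v = r *\<^sub>R vel t"
proof -
  define r where "r = - sin t * (v \<bullet> u1 / a) + cos t * (v \<bullet> u2 / b)"
  define x where "x = v \<bullet> u1 / a"
  define y where "y = v \<bullet> u2 / b"
  have sc: "(sin t)\<^sup>2 + (cos t)\<^sup>2 = 1" by simp
  have "x = - sin t * r" "y = cos t * r"
    using 0 sc unfolding r_def x_def[symmetric] y_def[symmetric] by algebra+
  then have "v \<bullet> u1 = r * (- a * sin t)" "v \<bullet> u2 = r * (b * cos t)"
    using a_pos b_pos by (auto simp: x_def y_def field_simps)
  then have "v = vec2 (r * (- a * sin t)) (r * (b * cos t))" using vec2_coord by metis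
  then show ?thesis unfolding vel_def vec2_scaleR by blast
qed

lemma velocity_in_ell:
  assumes d: "(\<gamma> has_vector_derivative v) (at s)" and e: "e > 0" and g: "\<And>y. \<bar>y - s\<bar> < e \<Longrightarrow> \<gamma> y \<in> ell"
    and s: "\<gamma> s = pt t"
  shows "\<exists>r. v = r *\<^sub>R vel t"
proof -
  let ?X = "\<lambda>s. (\<gamma> s - ctr) \<bullet> u1" and ?Y = "\<lambda>s. (\<gamma> s - ctr) \<bullet> u2"
  note dX = coord_has_derivative[OF d, of u1] and dY = coord_has_derivative[OF d, of u2]
  have XY: "?X s = a * cos t" "?Y s = b * sin t" by (simp_all add: s pt_def vec2_inner)
  have dA: "((\<lambda>s. (?X s / a)\<^sup>2 + (?Y s / b)\<^sup>2) has_real_derivative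
      2 * (?X s / a) * (v \<bullet> u1 / a) + 2 * (?Y s / b) * (v \<bullet> u2 / b)) (at s)"
    by (rule DERIV_cong[OF DERIV_add[OF DERIV_power[OF DERIV_cdivide[OF dX]] DERIV_power[OF DERIV_cdivide[OF dY]]]])
       (simp add: mult_ac)
  have dB: "((\<lambda>s. (?X s / a)\<^sup>2 + (?Y s / b)\<^sup>2) has_real_derivative 0) (at s)"
  proof (rule iffD1[OF DERIV_cong_ev[OF refl _ refl] DERIV_const])
    have "eventually (\<lambda>y. dist y s < e) (nhds s)" using e by (auto simp: eventually_nhds_metric)
    then show "eventually (\<lambda>s. 1 = (?X s / a)\<^sup>2 + (?Y s / b)\<^sup>2) (nhds s)"
      by eventually_elim (use g in \<open>force simp: ell_def quad_def dist_real_def\<close>)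
  qed
  have "?X s / a = cos t" "?Y s / b = sin t" using XY a_pos b_pos by simp_all
  then have 0: "cos t * (v \<bullet> u1 / a) + sin t * (v \<bullet> u2 / b) = 0"
    using DERIV_unique[OF dA dB] by simp
  then show ?thesis by (rule parallel_vel)
qed

lemma tangent_ell: "tangent_space ell (pt t) = range (\<lambda>r. r *\<^sub>R vel t)"
proof
  show "tangent_space ell (pt t) \<subseteq> range (\<lambda>r. r *\<^sub>R vel t)"
  proof
    fix v assume "v \<in> tangent_space ell (pt t)"
    then obtain \<gamma> e where g: "e > 0" "\<forall>s\<in>{-e<..<e}. \<gamma> s \<in> ell" "\<gamma> 0 = pt t" "(\<gamma> has_vector_derivative v) (at 0)"
      by (auto simp: tangent_space_def)
    then show "v \<in> range (\<lambda>r. r *\<^sub>R vel t)" using velocity_in_ell[OF g(4,1) _ g(3)] by (auto simp: abs_less_iff)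
  qed
  show "range (\<lambda>r. r *\<^sub>R vel t) \<subseteq> tangent_space ell (pt t)"
  proof clarify
    fix r
    have "((\<lambda>s. pt (t + r * s)) has_vector_derivative r *\<^sub>R vel (t + r * 0)) (at 0)"
      by (rule pt_has_vector_derivative) (auto intro!: derivative_eq_intros)
    then show "r *\<^sub>R vel t \<in> tangent_space ell (pt t)"
      unfolding tangent_space_def using smooth_pt[of "{-1<..<1}" t r] pt_in_ell
      by (auto intro!: exI[of _ "\<lambda>s. pt (t + r * s)"] exI[of _ "1::real"])
  qed
qed

definition nrm :: "real \<Rightarrow> plane" where
  "nrm t = vec2 (- b * cos t / sqrt (P t)) (- a * sin t / sqrt (P t))"

lemma nrm_norm: "norm (nrm t) = 1" and nrm_vel: "nrm t \<bullet> vel t = 0"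
proof -
  have P: "P t > 0" by (rule P_pos)
  have "(- b * cos t / sqrt (P t))\<^sup>2 + (- a * sin t / sqrt (P t))\<^sup>2
      = (b\<^sup>2 * (cos t)\<^sup>2 + a\<^sup>2 * (sin t)\<^sup>2) / P t"
    using P by (simp add: power_divide power_mult_distrib add_divide_distrib)
  also have "\<dots> = 1" using P by (simp add: P_def add.commute)
  finally show "norm (nrm t) = 1" using P by (simp add: nrm_def vec2_norm)
  show "nrm t \<bullet> vel t = 0" by (simp add: nrm_def vel_def vec2_inner)
qed

lemma orthogonal_vel:
  assumes "\<nu> \<bullet> vel t = 0" shows "\<nu> = (\<nu> \<bullet> nrm t) *\<^sub>R nrm t"
proof -
  obtain x y where v: "\<nu> = vec2 x y" by (rule vec2_cases)
  have 0: "b * cos t * y = a * sin t * x" using assms unfolding v vel_def vec2_inner by (simp add: algebra_simps)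
  define S where "S = sqrt (P t)"
  have S: "S > 0" "S\<^sup>2 = P t" using P_pos[of t] by (simp_all add: S_def)
  define l where "l = - (b * cos t * x + a * sin t * y)"
  have l: "\<nu> \<bullet> nrm t = l / S" by (simp add: v nrm_def vec2_inner l_def S_def diff_divide_distrib mult_ac)
  have e: "S\<^sup>2 * x = l * (- b * cos t)" "S\<^sup>2 * y = l * (- a * sin t)"
    unfolding S(2) P_def l_def using 0 by algebra+
  have "x = l / S * (- b * cos t / S)" "y = l / S * (- a * sin t / S)"
    using e S(1) by (simp_all add: field_simps power2_eq_square)
  then show ?thesis unfolding l unfolding v nrm_def vec2_scaleR S_def[symmetric] by simp
qed

text \<open>The constant term is \<open>1\<close> because the ray starts on the ellipse, so the rest
  has a factor \<open>s\<close>. The other root is the exit time, and the sign of the linear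
  coefficient separates inward from outward directions.\<close>

lemma quad_along: "quad (pt t + s *\<^sub>R v - ctr) = 1 + s * (2 * (cos t * (v \<bullet> u1 / a) + sin t * (v \<bullet> u2 / b)) + s * quad v)"
proof -
  have sc: "(sin t)\<^sup>2 + (cos t)\<^sup>2 = 1" by simp
  define X where "X = v \<bullet> u1 / a"
  define Y where "Y = v \<bullet> u2 / b"
  have "quad (pt t + s *\<^sub>R v - ctr) = (cos t + s * ((v \<bullet> u1) / a))\<^sup>2 + (sin t + s * ((v \<bullet> u2) / b))\<^sup>2"
    using a_pos b_pos by (simp add: quad_def pt_def inner_add_left vec2_inner add_divide_distrib)
  moreover have "quad v = X\<^sup>2 + Y\<^sup>2" by (simp add: quad_def X_def Y_def)
  ultimately show ?thesis using sc unfolding X_def[symmetric] Y_def[symmetric] by algebra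
qed

text \<open>A unit vector orthogonal to the tangent is \<open>nrm t\<close> or
  \<open>- nrm t\<close>. Along \<open>nrm t\<close> the linear coefficient \<open>N\<close> of
  \<open>quad\<close> is negative, so short segments enter the region; along \<open>- nrm t\<close>
  both the linear and the quadratic term push \<open>quad\<close> upwards, and no point of the ray
  is inside.\<close>

lemma inner_normal_region: "inner_normal region (pt t) = nrm t"
  unfolding inner_normal_def frontier_region tangent_ell
proof (rule the_equality)
  have P: "sqrt (P t) > 0" using P_pos by simp
  define N where "N = 2 * (cos t * (nrm t \<bullet> u1 / a) + sin t * (nrm t \<bullet> u2 / b))"
  define q where "q = quad (nrm t)"
  have N: "N < 0"
  proof -
    have "cos t * (nrm t \<bullet> u1 / a) + sin t * (nrm t \<bullet> u2 / b) = - ((b\<^sup>2 * (cos t)\<^sup>2 + a\<^sup>2 * (sin t)\<^sup>2) / (a * b * sqrt (P t)))"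
      using a_pos b_pos P by (simp add: nrm_def vec2_inner field_simps power2_eq_square)
    also have "\<dots> < 0" using P_pos[of t] a_pos b_pos P by (simp add: P_def add.commute)
    finally show ?thesis by (simp add: N_def)
  qed
  have q0: "q \<ge> 0" by (simp add: q_def quad_def)
  have inward: "\<exists>e>0. \<forall>s\<in>{0<..<e}. pt t + s *\<^sub>R nrm t \<in> region"
  proof (intro exI conjI ballI)
    show "- N / (q + 1) > 0" using N q0 by (intro divide_pos_pos) auto
    fix s assume s: "s \<in> {0<..<- N / (q + 1)}"
    then have "s * (q + 1) < - N" using q0 by (simp add: field_simps)
    moreover have "s * (q + 1) = s * q + s" by (simp add: algebra_simps)
    ultimately have "N + s * q < 0" using s by auto
    then have "s * (N + s * q) < 0" using s by (simp add: mult_pos_neg)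
    then show "pt t + s *\<^sub>R nrm t \<in> region" by (simp add: region_def quad_along N_def q_def)
  qed
  then show "norm (nrm t) = 1 \<and> (\<forall>v\<in>range (\<lambda>r. r *\<^sub>R vel t). nrm t \<bullet> v = 0) \<and>
    (\<exists>e>0. \<forall>s\<in>{0<..<e}. pt t + s *\<^sub>R nrm t \<in> region)"
    by (simp add: nrm_norm nrm_vel)
  fix \<nu> assume v: "norm \<nu> = 1 \<and> (\<forall>v\<in>range (\<lambda>r. r *\<^sub>R vel t). \<nu> \<bullet> v = 0) \<and>
    (\<exists>e>0. \<forall>s\<in>{0<..<e}. pt t + s *\<^sub>R \<nu> \<in> region)"
  have "vel t \<in> range (\<lambda>r. r *\<^sub>R vel t)" by (rule range_eqI[of _ _ 1]) simp
  then have "\<nu> \<bullet> vel t = 0" using v by blast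
  from orthogonal_vel[OF this] obtain l where l: "\<nu> = l *\<^sub>R nrm t" by blast
  then have "\<bar>l\<bar> = 1" using v by (simp add: nrm_norm)
  then have "l = 1 \<or> l = - 1" by linarith
  then consider "\<nu> = nrm t" | "\<nu> = - nrm t" using l by auto
  then show "\<nu> = nrm t"
  proof cases
    case 2
    obtain e where "e > 0" "\<forall>s\<in>{0<..<e}. pt t + s *\<^sub>R \<nu> \<in> region" using v by blast
    then have "pt t + (e / 2) *\<^sub>R \<nu> \<in> region" by auto
    also have "pt t + (e / 2) *\<^sub>R \<nu> = pt t + (- (e / 2)) *\<^sub>R nrm t" by (simp add: 2)
    finally have "quad (pt t + (- (e / 2)) *\<^sub>R nrm t - ctr) < 1" by (simp only: region_def mem_Collect_eq)
    then have "- (e / 2) * (N + - (e / 2) * q) < 0" unfolding quad_along N_def q_def by linarith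
    moreover have "0 \<le> e / 2 * q" using q0 \<open>e > 0\<close> by simp
    then have "N + - (e / 2) * q \<le> 0" using N by linarith
    then have "0 \<le> - (e / 2) * (N + - (e / 2) * q)" using \<open>e > 0\<close> by (intro mult_nonpos_nonpos) auto
    ultimately show ?thesis by linarith
  qed
qed

section \<open>Angle and momentum as coordinates on the co-ball bundle\<close>

definition phase :: "real \<times> real \<Rightarrow> plane \<times> plane" where
  "phase w = (pt (fst w), (snd w / P (fst w)) *\<^sub>R vel (fst w))"

text \<open>The vector \<open>J / sin d\<close> times \<open>vel m\<close> for the midpoint angle
  \<open>m\<close>; it has norm \<open>1\<close> by the midpoint equation.\<close>

definition dir :: "real \<Rightarrow> real \<times> real \<Rightarrow> plane" where
  "dir J = (\<lambda>(t, y). vec2 (- J * a * sin (t + half J t y) / sin (half J t y))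
     (J * b * cos (t + half J t y) / sin (half J t y)))"

lemma level_less: "level J (t, y) \<Longrightarrow> y\<^sup>2 < P t"
  using a_pos b_pos by (auto simp: level_def intro!: add_pos_pos) (metis less_add_same_cancel1 mult_pos_pos zero_less_power)

lemma level_exists:
  assumes "y\<^sup>2 < P t" obtains J where "level J (t, y)"
proof -
  define J where "J = sqrt (P t - y\<^sup>2) / (a * b)"
  have "J > 0" using assms a_pos b_pos by (simp add: J_def)
  moreover have "a\<^sup>2 * b\<^sup>2 * J\<^sup>2 = (a * b * J)\<^sup>2" by (simp add: power_mult_distrib)
  moreover have "a * b * J = sqrt (P t - y\<^sup>2)" using a_pos b_pos by (simp add: J_def)
  ultimately have "level J (t, y)" using assms by (simp add: level_def)
  then show thesis by (rule that)
qed

lemma momentum_norm: "(norm ((y / P t) *\<^sub>R vel t))\<^sup>2 = y\<^sup>2 / P t"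
proof -
  have "(norm ((y / P t) *\<^sub>R vel t))\<^sup>2 = (y / P t) * ((y / P t) * P t)"
    unfolding power2_norm_eq_inner by (simp add: vel_norm_sq)
  then show ?thesis using P_pos[of t] by (simp add: power2_eq_square)
qed

lemma phase_in_coball: "phase (t, y) \<in> coball_bundle region \<longleftrightarrow> y\<^sup>2 < P t"
proof -
  have "norm ((y / P t) *\<^sub>R vel t) < 1 \<longleftrightarrow> (norm ((y / P t) *\<^sub>R vel t))\<^sup>2 < 1"
    by (simp add: abs_square_less_1 del: norm_scaleR)
  also have "\<dots> \<longleftrightarrow> y\<^sup>2 < P t" unfolding momentum_norm using P_pos[of t] by (simp add: field_simps)
  finally show ?thesis by (auto simp: coball_bundle_def phase_def frontier_region pt_in_ell tangent_ell)
qed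

lemma coball_cases:
  assumes "z \<in> coball_bundle region" obtains J t y where "z = phase (t, y)" "level J (t, y)"
proof -
  obtain q \<xi> where z: "z = (q, \<xi>)" by (cases z)
  with assms have q: "q \<in> ell" "\<xi> \<in> tangent_space ell q" by (auto simp: coball_bundle_def frontier_region)
  obtain t where t: "q = pt t" using q(1) by (rule ell_cases)
  obtain r where r: "\<xi> = r *\<^sub>R vel t" using q(2) by (auto simp: t tangent_ell)
  have zp: "z = phase (t, r * P t)" using P_pos[of t] by (simp add: z t r phase_def)
  then have "(r * P t)\<^sup>2 < P t" using assms phase_in_coball by blast
  then show thesis using level_exists that zp by metis
qed

lemma level_coball: "level J w \<Longrightarrow> phase w \<in> coball_bundle region"
  by (cases w) (simp add: phase_in_coball level_less)

lemma pt_eq_iff: "pt t = pt t' \<longleftrightarrow> (\<exists>n::int. t = t' + 2 * pi * of_int n)"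
proof -
  have "pt t = pt t' \<longleftrightarrow> sin t = sin t' \<and> cos t = cos t'"
    using a_pos b_pos by (auto simp: pt_def vec2_eq_iff)
  then show ?thesis by (simp add: sin_cos_eq_iff)
qed

lemma vel_shift: "vel (t + 2 * pi * of_int n) = vel t"
  unfolding vel_def by (simp only: sin_add cos_add sin_int_2pin cos_int_2pin) simp

lemma phase_eq_iff: "phase (t, y) = phase (t', y') \<longleftrightarrow> y = y' \<and> (\<exists>n::int. t = t' + 2 * pi * of_int n)"
proof -
  have "(y / P t') *\<^sub>R vel t' = (y' / P t') *\<^sub>R vel t' \<longleftrightarrow> y = y'"
    using vel_nonzero[of t'] P_pos[of t'] by auto
  then show ?thesis by (auto simp: phase_def pt_eq_iff vel_shift P_shift_2pi)
qed

lemma dir_norm: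
  assumes "level J (t, y)" shows "norm (dir J (t, y)) = 1"
proof -
  define d where "d = half J t y"
  have s: "sin d > 0" using sin_half_pos by (simp add: d_def)
  have "(- J * a * sin (t + d) / sin d)\<^sup>2 + (J * b * cos (t + d) / sin d)\<^sup>2 = J\<^sup>2 * P (t + d) / (sin d)\<^sup>2"
    by (simp add: P_def power_divide power_mult_distrib add_divide_distrib distrib_left mult_ac)
  also have "\<dots> = 1" using level_mid[OF assms] s by (simp add: d_def)
  finally show ?thesis by (simp add: dir_def vec2_norm d_def)
qed

text \<open>Two descriptions of the ray: by the covector and the inner normal, the latter with
  weight \<open>a b J / sqrt (P t)\<close>, and by the midpoint of the chord. They are compared
  after multiplication by \<open>P t\<close>, where the definition of \<open>cot_half\<close>
  becomes the polynomial relation \<open>PX\<close>.\<close>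

lemma inward_phase:
  assumes "level J (t, y)" shows "inward_vector region (phase (t, y)) = dir J (t, y)"
proof -
  have J: "J > 0" and e: "y\<^sup>2 + a\<^sup>2 * b\<^sup>2 * J\<^sup>2 = P t" using assms by (auto simp: level_def)
  have P: "P t > 0" by (rule P_pos)
  define d where "d = half J t y"
  define X where "X = cot_half J t y"
  have s: "sin d > 0" using sin_half_pos by (simp add: d_def)
  have "sin (t + d) = sin d * (X * sin t + cos t)" "cos (t + d) = sin d * (X * cos t - sin t)"
    using sin_mid cos_mid by (simp_all add: d_def X_def)
  then have dir: "dir J (t, y) = vec2 (- J * a * (X * sin t + cos t)) (J * b * (X * cos t - sin t))"
    using s by (simp add: dir_def d_def[symmetric] mult.assoc)
  have PX: "J * (P t * X) = y - J * (a\<^sup>2 - b\<^sup>2) * (sin t * cos t)"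
    using cot_half_eq[OF assms] J by (simp add: X_def field_simps)
  have "1 - (norm ((y / P t) *\<^sub>R vel t))\<^sup>2 = (a * b * J)\<^sup>2 / P t"
    unfolding momentum_norm using e P by (simp add: field_simps power_mult_distrib)
  then have sq: "sqrt (1 - (norm ((y / P t) *\<^sub>R vel t))\<^sup>2) = a * b * J / sqrt (P t)"
    using a_pos b_pos J by (simp add: real_sqrt_divide)
  have rr: "sqrt (P t) * sqrt (P t) = P t" using P by simp
  have "inward_vector region (phase (t, y)) = (y / P t) *\<^sub>R vel t + (a * b * J / sqrt (P t)) *\<^sub>R nrm t"
    unfolding inward_vector_def phase_def by (simp only: fst_conv snd_conv prod.case sq inner_normal_region)
  also have "\<dots> = vec2 ((- a * y * sin t - a * b\<^sup>2 * J * cos t) / P t) ((b * y * cos t - a\<^sup>2 * b * J * sin t) / P t)"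
    unfolding vel_def nrm_def vec2_scaleR vec2_add vec2_eq_iff using P
    by (simp add: rr power2_eq_square add_divide_distrib diff_divide_distrib mult_ac)
  also have "\<dots> = dir J (t, y)"
  proof -
    have sc: "(sin t)\<^sup>2 + (cos t)\<^sup>2 = 1" by simp
    have "- a * y * sin t - a * b\<^sup>2 * J * cos t = P t * (- J * a * (X * sin t + cos t))"
      using PX sc P_def[of t] by algebra
    moreover have "b * y * cos t - a\<^sup>2 * b * J * sin t = P t * (J * b * (X * cos t - sin t))"
      using PX sc P_def[of t] by algebra
    ultimately show ?thesis using P unfolding dir vec2_eq_iff by simp
  qed
  finally show ?thesis .
qed

lemma pt_step:
  assumes "level J (t, y)"
  shows "pt (fst (step J (t, y))) = pt t + chord J (t, y) *\<^sub>R dir J (t, y)"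
proof -
  have J: "J > 0" using assms by (auto simp: level_def)
  define d where "d = half J t y"
  define m where "m = t + d"
  have s: "sin d > 0" using sin_half_pos by (simp add: d_def)
  have eq: "fst (step J (t, y)) = m + d" "t = m - d" by (simp_all add: step_def m_def d_def)
  have "chord J (t, y) *\<^sub>R dir J (t, y) = vec2 (- 2 * a * sin m * sin d) (2 * b * cos m * sin d)"
    using s J by (simp add: chord_def dir_def vec2_scaleR d_def[symmetric] m_def[symmetric] vec2_eq_iff power2_eq_square)
  moreover have "pt (m + d) = pt (m - d) + vec2 (- 2 * a * sin m * sin d) (2 * b * cos m * sin d)"
    unfolding pt_def by (simp add: vec2_add vec2_eq_iff add.assoc cos_add cos_diff sin_add sin_diff algebra_simps)
  ultimately show ?thesis unfolding eq(1) using eq(2) by simp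
qed

lemma quad_pos: "v \<noteq> 0 \<Longrightarrow> quad v > 0"
  using norm_le_quad[of v] a_pos by (metis less_le_trans linorder_not_le mult_nonneg_nonpos zero_le_power2 zero_less_norm_iff zero_less_power)

lemma chord_pos: "level J w \<Longrightarrow> 0 < chord J w"
proof -
  assume "level J w"
  moreover from this have "0 < 2 * J * b\<^sup>2" using b_pos by (cases w) (simp add: level_def)
  ultimately show ?thesis using chord_bounds(1) less_le_trans by blast
qed

lemma chord_quad:
  assumes lev: "level J (t, y)"
  defines "v \<equiv> dir J (t, y)"
  shows "2 * (cos t * (v \<bullet> u1 / a) + sin t * (v \<bullet> u2 / b)) + chord J (t, y) * quad v = 0"
proof -
  let ?c = "chord J (t, y)"
  have "pt t + ?c *\<^sub>R v \<in> ell" using pt_step[OF lev] pt_in_ell by (metis v_def)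
  then have "?c * (2 * (cos t * (v \<bullet> u1 / a) + sin t * (v \<bullet> u2 / b)) + ?c * quad v) = 0"
    using quad_along[of t ?c v] by (simp add: ell_def)
  moreover have "?c \<noteq> 0" using chord_pos[OF lev] by simp
  ultimately show ?thesis by (metis mult_eq_0_iff)
qed

lemma exit_time_phase:
  assumes lev: "level J (t, y)"
  shows "exit_time region (pt t) (dir J (t, y)) = chord J (t, y)"
proof -
  let ?c = "chord J (t, y)" and ?v = "dir J (t, y)"
  have q: "quad ?v > 0" using dir_norm[OF lev] by (intro quad_pos) auto
  have "{s. s > 0 \<and> pt t + s *\<^sub>R ?v \<in> ell} = {?c}"
  proof (intro set_eqI iffI)
    fix s assume "s \<in> {s. s > 0 \<and> pt t + s *\<^sub>R ?v \<in> ell}"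
    then have s: "s > 0" "quad (pt t + s *\<^sub>R ?v - ctr) = 1" by (auto simp: ell_def)
    then have "s * (2 * (cos t * (?v \<bullet> u1 / a) + sin t * (?v \<bullet> u2 / b)) + s * quad ?v) = 0"
      unfolding quad_along by simp
    then have "2 * (cos t * (?v \<bullet> u1 / a) + sin t * (?v \<bullet> u2 / b)) + s * quad ?v = 0" using s(1) by (metis mult_eq_0_iff less_irrefl)
    then have "s * quad ?v = ?c * quad ?v" using chord_quad[OF lev] by linarith
    then show "s \<in> {?c}" using q by simp
  next
    fix s assume "s \<in> {?c}"
    then show "s \<in> {s. s > 0 \<and> pt t + s *\<^sub>R ?v \<in> ell}"
      using chord_pos[OF lev] pt_step[OF lev] pt_in_ell by (metis (mono_tags) mem_Collect_eq singletonD)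
  qed
  then show ?thesis by (simp add: exit_time_def frontier_region)
qed

lemma tangential_part: "v - (v \<bullet> nrm t) *\<^sub>R nrm t = (v \<bullet> vel t / P t) *\<^sub>R vel t"
proof -
  have P: "P t > 0" by (rule P_pos)
  let ?w = "v - (v \<bullet> vel t / P t) *\<^sub>R vel t"
  have "?w \<bullet> vel t = 0" using P by (simp add: inner_diff_left vel_norm_sq)
  then have 1: "?w = (?w \<bullet> nrm t) *\<^sub>R nrm t" by (rule orthogonal_vel)
  have 2: "?w \<bullet> nrm t = v \<bullet> nrm t"
    using nrm_vel[of t] by (simp add: inner_diff_left inner_commute[of "vel t"])
  show ?thesis using 1 unfolding 2 by (simp add: algebra_simps)
qed

lemma dir_vel:
  assumes "level J (t, y)"
  shows "dir J (t, y) \<bullet> vel (fst (step J (t, y))) = snd (step J (t, y))"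
proof -
  have J: "J > 0" using assms by (auto simp: level_def)
  define d where "d = half J t y"
  define m where "m = t + d"
  have s: "sin d > 0" using sin_half_pos by (simp add: d_def)
  have Pm: "J\<^sup>2 * P m = (sin d)\<^sup>2" using level_mid[OF assms] by (simp add: m_def d_def)
  have eq: "fst (step J (t, y)) = m + d" "snd (step J (t, y)) = next_mom J m d"
    by (simp_all add: step_def m_def d_def)
  have "dir J (t, y) \<bullet> vel (m + d) = (J / sin d) * (a\<^sup>2 * (sin m * sin (m + d)) + b\<^sup>2 * (cos m * cos (m + d)))"
    unfolding dir_def vel_def using s
    by (simp add: vec2_inner d_def[symmetric] m_def[symmetric] power2_eq_square add_divide_distrib distrib_left mult_ac)
  also have "a\<^sup>2 * (sin m * sin (m + d)) + b\<^sup>2 * (cos m * cos (m + d)) =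
      P m * cos d + (a\<^sup>2 - b\<^sup>2) * (sin m * cos m) * sin d"
    unfolding sin_add cos_add P_def by algebra
  also have "P m = (sin d)\<^sup>2 / J\<^sup>2" using Pm J by (simp add: field_simps)
  also have "(J / sin d) * ((sin d)\<^sup>2 / J\<^sup>2 * cos d + (a\<^sup>2 - b\<^sup>2) * (sin m * cos m) * sin d) = next_mom J m d"
    using s J by (simp add: next_mom_def field_simps power2_eq_square)
  finally show ?thesis by (simp add: eq)
qed

lemma billiard_phase:
  assumes "level J w" shows "billiard_map region (phase w) = phase (step J w)"
proof -
  obtain t y where w: "w = (t, y)" by (cases w)
  have lev: "level J (t, y)" using assms w by simp
  have "fst (phase (t, y)) = pt t" by (simp add: phase_def)
  then have "billiard_map region (phase (t, y)) =
     (pt (fst (step J (t, y))), dir J (t, y) - (dir J (t, y) \<bullet> nrm (fst (step J (t, y)))) *\<^sub>R nrm (fst (step J (t, y))))"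
    unfolding billiard_map_def Let_def inward_phase[OF lev]
    by (simp only: exit_time_phase[OF lev] pt_step[OF lev, symmetric] inner_normal_region)
  also have "\<dots> = phase (step J (t, y))"
    unfolding tangential_part dir_vel[OF lev] by (simp add: phase_def)
  finally show ?thesis by (simp add: w)
qed

lemma billiard_iterate: "level J w \<Longrightarrow> (billiard_map region ^^ n) (phase w) = phase ((step J ^^ n) w)"
  by (induction n) (simp_all add: billiard_phase level_iterate)

lemma closes_iff_phase:
  "phase ((step J ^^ k) w) = phase w \<longleftrightarrow> (\<exists>p. closes J k p w)"
proof -
  obtain t y where w: "w = (t, y)" by (cases w)
  obtain t' y' where w': "(step J ^^ k) w = (t', y')" by (cases "(step J ^^ k) w")
  show ?thesis unfolding closes_def w' unfolding w phase_eq_iff by auto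
qed

lemma periodic_iff:
  assumes "level J w"
  shows "periodic_point region k (phase w) \<longleftrightarrow> 1 \<le> k \<and> (\<exists>p. closes J k p w)"
  unfolding periodic_point_def billiard_iterate[OF assms] closes_iff_phase
  using level_coball[OF level_iterate[OF assms]] by blast

lemma dist_step:
  assumes "level J w" shows "dist (fst (phase w)) (fst (phase (step J w))) = chord J w"
proof -
  obtain t y where w: "w = (t, y)" by (cases w)
  have lev: "level J (t, y)" using assms w by simp
  have "dist (pt t) (pt (fst (step J (t, y)))) = chord J (t, y)"
    unfolding pt_step[OF lev] using dir_norm[OF lev] chord_pos[OF lev] by (simp add: dist_norm)
  then show ?thesis by (simp add: w phase_def)
qed

lemma orbit_length_phase: "level J w \<Longrightarrow> orbit_length region k (phase w) = total_length J k w"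
  unfolding orbit_length_def total_length_def billiard_iterate
  using dist_step[OF level_iterate] by (simp add: billiard_phase level_iterate)

lemma trajectory_phase:
  assumes "level J w"
  shows "trajectory region (phase w) = (\<Union>i. open_segment (pt (fst ((step J ^^ i) w))) (pt (fst ((step J ^^ Suc i) w)))
     \<times> {dir J ((step J ^^ i) w)})"
proof -
  have "inward_vector region (phase ((step J ^^ i) w)) = dir J ((step J ^^ i) w)" for i
    using inward_phase[of J "fst ((step J ^^ i) w)" "snd ((step J ^^ i) w)"] level_iterate[OF assms, of i] by simp
  then show ?thesis unfolding trajectory_def billiard_iterate[OF assms] by (simp add: phase_def)
qed

text \<open>Run backwards the chord has midpoint angle \<open>m + pi\<close> and half-angle
  \<open>pi - d\<close>, since angles always advance; it ends at \<open>t + 2 pi\<close>, the same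
  point of the plane.\<close>

lemma reverse_step:
  assumes "level J (t, y)"
  defines "t2 \<equiv> fst (step J (t, y))" and "y2 \<equiv> snd (step J (t, y))"
  shows "pt (fst (step J (t2, - y2))) = pt t" and "dir J (t2, - y2) = - dir J (t, y)"
proof -
  have J: "J > 0" using assms(1) by (auto simp: level_def)
  define d where "d = half J t y"
  define m where "m = t + d"
  have t2: "t2 = m + d" and y2: "y2 = next_mom J m d" by (simp_all add: t2_def y2_def step_def m_def d_def)
  have Pm: "J\<^sup>2 * P m = (sin d)\<^sup>2" using level_mid[OF assms(1)] by (simp add: m_def d_def)
  have d: "0 < d" "d < pi" using half_pos half_less_pi by (auto simp: d_def)
  have mp: "t2 + (pi - d) = m + pi" by (simp add: t2)
  have h: "half J t2 (- y2) = pi - d"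
  proof (rule half_eqI[OF J])
    show "J\<^sup>2 * P (t2 + (pi - d)) = (sin (pi - d))\<^sup>2" using Pm by (simp add: mp P_def)
    show "- y2 = sin (pi - d) * cos (pi - d) / J - J * (a\<^sup>2 - b\<^sup>2) * (sin (t2 + (pi - d)) * cos (t2 + (pi - d)))"
      unfolding mp by (simp add: y2 next_mom_def)
  qed (use d in auto)
  have "fst (step J (t2, - y2)) = t2 + 2 * (pi - d)" by (simp only: step_def prod.case h fst_conv)
  then have "fst (step J (t2, - y2)) = t + 2 * pi * of_int 1" by (simp add: t2 m_def)
  then show "pt (fst (step J (t2, - y2))) = pt t" unfolding pt_eq_iff by blast
  show "dir J (t2, - y2) = - dir J (t, y)"
    unfolding dir_def prod.case h mp vec2_minus
    by (simp add: vec2_eq_iff d_def[symmetric] m_def[symmetric])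
qed

end

section \<open>Clean invariant circles\<close>

lemma vector_derivative_compose:
  assumes "(f has_derivative D) (at (g s))" "(g has_vector_derivative v) (at s)"
  shows "((\<lambda>s. f (g s)) has_vector_derivative D v) (at s)"
proof -
  have "((\<lambda>s. f (g s)) has_derivative (\<lambda>h. D (h *\<^sub>R v))) (at s)"
    using has_derivative_compose[OF assms(2)[unfolded has_vector_derivative_def] assms(1)] .
  moreover have "linear D" using assms(1) by (rule has_derivative_linear)
  ultimately show ?thesis by (simp add: has_vector_derivative_def linear_cmul)
qed

lemma has_vector_derivative_fst: "(g has_vector_derivative v) F \<Longrightarrow> ((\<lambda>s. fst (g s)) has_vector_derivative fst v) F"
  by (rule bounded_linear.has_vector_derivative[OF bounded_linear_fst])

lemma has_vector_derivative_snd: "(g has_vector_derivative v) F \<Longrightarrow> ((\<lambda>s. snd (g s)) has_vector_derivative snd v) F"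
  by (rule bounded_linear.has_vector_derivative[OF bounded_linear_snd])

lemma smooth_fun_on_subset:
  assumes "smooth_fun_on S f" "S' \<subseteq> S" shows "smooth_fun_on S' f"
proof -
  obtain F where "F 0 = f" "\<forall>n. \<forall>t\<in>S. (F n has_vector_derivative F (Suc n) t) (at t)"
    using assms(1) unfolding smooth_fun_on_def by blast
  then show ?thesis using assms(2) unfolding smooth_fun_on_def by (intro exI[of _ F]) auto
qed

lemma smooth_fun_on_derivative:
  "smooth_fun_on S f \<Longrightarrow> s \<in> S \<Longrightarrow> \<exists>v. (f has_vector_derivative v) (at s)"
  unfolding smooth_fun_on_def by metis

lemma sqrt_differentiable: "f differentiable (at x) \<Longrightarrow> 0 < f x \<Longrightarrow> (\<lambda>x. sqrt (f x)) differentiable (at x)"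
  unfolding differentiable_def using has_derivative_real_sqrt by blast

context ellipse_frame
begin

section \<open>Smoothness of the invariant circle\<close>

lemma smooth_phase:
  assumes J: "0 < J" "J * a < 1"
  shows "smooth_fun_on S (\<lambda>s. phase (t + r * s, mom J (t + r * s)))"
proof -
  let ?B = "ellipse_base J t r"
  have base: "(\<lambda>s. sin (t + r * s)) \<in> fun_algebra ?B" "(\<lambda>s. cos (t + r * s)) \<in> fun_algebra ?B"
    "(\<lambda>s. mom J (t + r * s)) \<in> fun_algebra ?B" "(\<lambda>s. 1 / P (t + r * s)) \<in> fun_algebra ?B"
    by (rule fun_algebra.base, simp add: ellipse_base_def)+
  note I = base fun_algebra.const fun_algebra.mult
  have m1: "(\<lambda>s. a * cos (t + r * s)) \<in> fun_algebra ?B" by (intro I)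
  have m2: "(\<lambda>s. b * sin (t + r * s)) \<in> fun_algebra ?B" by (intro I)
  have m3: "(\<lambda>s. (- a) * (mom J (t + r * s) * (1 / P (t + r * s)) * sin (t + r * s))) \<in> fun_algebra ?B" by (intro I)
  have m4: "(\<lambda>s. b * (mom J (t + r * s) * (1 / P (t + r * s)) * cos (t + r * s))) \<in> fun_algebra ?B" by (intro I)
  note sm = smooth_ellipse_base[OF J]
  have "smooth_fun_on S (\<lambda>s. (ctr, 0) + (a * cos (t + r * s)) *\<^sub>R (u1, 0) + (b * sin (t + r * s)) *\<^sub>R (u2, 0)
     + ((- a) * (mom J (t + r * s) * (1 / P (t + r * s)) * sin (t + r * s))) *\<^sub>R (0, u1)
     + (b * (mom J (t + r * s) * (1 / P (t + r * s)) * cos (t + r * s))) *\<^sub>R (0, u2))"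
    by (intro smooth_fun_on_add smooth_fun_on_const smooth_fun_on_scaleR sm[OF m1] sm[OF m2] sm[OF m3] sm[OF m4])
  moreover have "phase (x, mom J x) = (ctr, 0) + (a * cos x) *\<^sub>R (u1, 0) + (b * sin x) *\<^sub>R (u2, 0)
     + ((- a) * (mom J x * (1 / P x) * sin x)) *\<^sub>R (0, u1)
     + (b * (mom J x * (1 / P x) * cos x)) *\<^sub>R (0, u2)" for x
    by (simp add: phase_def pt_def vel_def vec2_def scaleR_add_right scaleR_diff_right mult_ac)
  ultimately show ?thesis by simp
qed

definition invariant_circle :: "real \<Rightarrow> (plane \<times> plane) set" where
  "invariant_circle J = range (\<lambda>t. phase (t, mom J t))"

lemma phase_curve_derivative:
  assumes J: "0 < J" "J * a < 1"
  obtains E where "((\<lambda>s. phase (t + r * s, mom J (t + r * s))) has_vector_derivative E) (at s)"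
    "fst E = r *\<^sub>R vel (t + r * s)"
proof -
  obtain E where E: "((\<lambda>s. phase (t + r * s, mom J (t + r * s))) has_vector_derivative E) (at s)"
    using smooth_fun_on_derivative[OF smooth_phase[OF J, of UNIV]] by blast
  have "((\<lambda>s. pt (t + r * s)) has_vector_derivative fst E) (at s)"
    using has_vector_derivative_fst[OF E] by (simp add: phase_def)
  moreover have "((\<lambda>s. pt (t + r * s)) has_vector_derivative r *\<^sub>R vel (t + r * s)) (at s)"
    by (rule pt_has_vector_derivative) (auto intro!: derivative_eq_intros)
  ultimately have "fst E = r *\<^sub>R vel (t + r * s)" by (rule vector_derivative_unique_at)
  then show thesis using that E by blast
qed

lemma mom_shift: "mom J (t + 2 * pi * of_int n) = mom J t"
  by (simp add: mom_def P_shift_2pi)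

lemma smooth_circle_invariant:
  assumes J: "0 < J" "J * a < 1"
  shows "smooth_circle (invariant_circle J)"
  unfolding smooth_circle_def
proof (intro exI conjI allI)
  let ?c = "\<lambda>s. phase (0 + 2 * pi * s, mom J (0 + 2 * pi * s))"
  show "smooth_fun_on UNIV ?c" by (rule smooth_phase[OF J])
  show "vector_derivative ?c (at s) \<noteq> 0" for s
  proof -
    obtain E where "(?c has_vector_derivative E) (at s)" "fst E = (2 * pi) *\<^sub>R vel (0 + 2 * pi * s)"
      by (rule phase_curve_derivative[OF J])
    moreover from this have "fst E \<noteq> 0" using vel_nonzero by simp
    ultimately show ?thesis by (auto simp: vector_derivative_at)
  qed
  show "?c s = ?c t \<longleftrightarrow> s - t \<in> \<int>" for s t
  proof
    assume "?c s = ?c t"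
    then obtain n :: int where "2 * pi * s = 2 * pi * t + 2 * pi * of_int n" by (auto simp: phase_eq_iff)
    then have "2 * pi * (s - t) = 2 * pi * of_int n" by (simp add: algebra_simps)
    then have "s - t = of_int n" by simp
    then show "s - t \<in> \<int>" by simp
  next
    assume "s - t \<in> \<int>"
    then obtain n where "s - t = of_int n" by (rule Ints_cases)
    then have "s = t + of_int n" by simp
    then have "0 + 2 * pi * s = (0 + 2 * pi * t) + 2 * pi * of_int n" by (simp add: algebra_simps)
    then show "?c s = ?c t" unfolding phase_eq_iff using mom_shift by metis
  qed
  show "range ?c = invariant_circle J"
  proof -
    have "phase (x, mom J x) \<in> range ?c" for x by (rule range_eqI[of _ _ "x / (2 * pi)"]) simp
    then show ?thesis unfolding invariant_circle_def by blast
  qed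
qed

text \<open>Half the gradient of \<open>quad\<close>: at a point of the ellipse an outer normal, and
  \<open>polar v \<bullet> w\<close> is the bilinear form that belongs to
  \<open>quad\<close>.\<close>

definition polar :: "plane \<Rightarrow> plane" where
  "polar v = vec2 (v \<bullet> u1 / a\<^sup>2) (v \<bullet> u2 / b\<^sup>2)"

definition conormal :: "plane \<Rightarrow> plane" where
  "conormal v = (- 1 / sqrt (polar v \<bullet> polar v)) *\<^sub>R polar v"

definition out_dir :: "plane \<times> plane \<Rightarrow> plane" where
  "out_dir z = snd z + sqrt (1 - snd z \<bullet> snd z) *\<^sub>R conormal (fst z - ctr)"

text \<open>The step along the ray is the nonzero root in \<open>quad_along\<close>, with both
  coefficients expressed by \<open>polar\<close>.\<close>

definition hit :: "plane \<times> plane \<Rightarrow> plane" where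
  "hit z = fst z + (- 2 * (polar (fst z - ctr) \<bullet> out_dir z) / (polar (out_dir z) \<bullet> out_dir z)) *\<^sub>R out_dir z"

text \<open>The extension of the billiard map to an open set of the ambient space, which makes its
  differential accessible.\<close>

definition ext :: "plane \<times> plane \<Rightarrow> plane \<times> plane" where
  "ext z = (hit z, out_dir z - (out_dir z \<bullet> conormal (hit z - ctr)) *\<^sub>R conormal (hit z - ctr))"

lemma conormal_pt: "conormal (pt t - ctr) = nrm t" and polar_pt: "polar (pt t - ctr) = vec2 (cos t / a) (sin t / b)"
proof -
  show p: "polar (pt t - ctr) = vec2 (cos t / a) (sin t / b)"
    using a_pos b_pos by (simp add: polar_def pt_def vec2_inner power2_eq_square)
  have "vec2 (cos t / a) (sin t / b) \<bullet> vec2 (cos t / a) (sin t / b) = P t / (a * b)\<^sup>2"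
    using a_pos b_pos unfolding vec2_inner P_def by (simp add: field_simps power2_eq_square)
  then have q: "sqrt (polar (pt t - ctr) \<bullet> polar (pt t - ctr)) = sqrt (P t) / (a * b)"
    using a_pos b_pos unfolding p by (simp add: real_sqrt_divide)
  have "sqrt (P t) > 0" using P_pos by simp
  then show "conormal (pt t - ctr) = nrm t"
    unfolding conormal_def q unfolding p nrm_def vec2_scaleR vec2_eq_iff
    using a_pos b_pos by (simp add: field_simps)
qed

lemma ext_phase:
  assumes lev: "level J (t, y)"
  shows "out_dir (phase (t, y)) = dir J (t, y)" and "hit (phase (t, y)) = pt (fst (step J (t, y)))"
    and "ext (phase (t, y)) = phase (step J (t, y))"
proof -
  have e: "fst (phase (t, y)) = pt t" by (simp add: phase_def)
  show o: "out_dir (phase (t, y)) = dir J (t, y)"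
  proof -
    have "out_dir (phase (t, y)) = inward_vector region (phase (t, y))"
      unfolding out_dir_def e conormal_pt
      by (simp add: inward_vector_def phase_def inner_normal_region power2_norm_eq_inner del: inner_scaleR_left inner_scaleR_right)
    then show ?thesis using inward_phase[OF lev] by simp
  qed
  let ?v = "dir J (t, y)"
  have q: "quad ?v > 0" using dir_norm[OF lev] by (intro quad_pos) auto
  have 1: "polar (pt t - ctr) \<bullet> ?v = cos t * (?v \<bullet> u1 / a) + sin t * (?v \<bullet> u2 / b)"
    unfolding polar_pt by (subst vec2_coord[of ?v, symmetric]) (simp add: vec2_inner)
  have 2: "polar ?v \<bullet> ?v = quad ?v"
  proof -
    have "polar ?v \<bullet> vec2 (?v \<bullet> u1) (?v \<bullet> u2) = quad ?v"
      by (simp add: polar_def vec2_inner quad_def power_divide power2_eq_square)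
    then show ?thesis by (simp add: vec2_coord)
  qed
  have "- 2 * (polar (pt t - ctr) \<bullet> ?v) / (polar ?v \<bullet> ?v) = chord J (t, y)"
    unfolding 1 2 using chord_quad[OF lev] q by (simp add: field_simps)
  then show h: "hit (phase (t, y)) = pt (fst (step J (t, y)))"
    unfolding hit_def o e by (simp add: pt_step[OF lev])
  show "ext (phase (t, y)) = phase (step J (t, y))"
    unfolding ext_def h o conormal_pt tangential_part dir_vel[OF lev] by (simp add: phase_def)
qed

lemma polar_linear: "bounded_linear polar"
  by (rule linear_conv_bounded_linear[THEN iffD1], rule linearI)
     (simp_all add: polar_def vec2_add vec2_scaleR inner_add_left add_divide_distrib)

lemma polar_differentiable: "f differentiable F \<Longrightarrow> (\<lambda>x. polar (f x)) differentiable F"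
  unfolding differentiable_def using bounded_linear.has_derivative[OF polar_linear] by blast

lemma conormal_differentiable:
  assumes "f differentiable (at x)" "polar (f x) \<noteq> 0"
  shows "(\<lambda>x. conormal (f x)) differentiable (at x)"
  unfolding conormal_def
  by (intro differentiable_scaleR differentiable_divide differentiable_const sqrt_differentiable
      differentiable_inner polar_differentiable assms) (use assms in auto)

lemma polar_pt_nonzero: "polar (pt t - ctr) \<noteq> 0"
proof
  assume "polar (pt t - ctr) = 0"
  then have "conormal (pt t - ctr) = 0" by (simp add: conormal_def)
  then show False using conormal_pt[of t] nrm_norm[of t] by simp
qed

text \<open>Away from the glancing set every radicand is positive and every denominator nonzero:
  \<open>1 - |\<xi>|^2\<close>, the gradient of \<open>quad\<close> at both ends of the chord, and
  \<open>quad\<close> of the direction.\<close>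

lemma ext_differentiable:
  assumes lev: "level J w"
  shows "ext differentiable (at (phase w))"
proof -
  obtain t y where w: "w = (t, y)" by (cases w)
  have lev: "level J (t, y)" using assms w by simp
  let ?z = "phase (t, y)"
  have f: "fst differentiable (at ?z)" "snd differentiable (at ?z)"
    by (auto intro: bounded_linear_imp_differentiable bounded_linear_fst bounded_linear_snd)
  have e: "fst ?z = pt t" "snd ?z = (y / P t) *\<^sub>R vel t" by (simp_all add: phase_def)
  have "snd ?z \<bullet> snd ?z < 1"
    using phase_in_coball[of t y] level_less[OF lev] momentum_norm[of y t] P_pos[of t]
    unfolding e power2_norm_eq_inner by simp
  then have s: "0 < 1 - snd ?z \<bullet> snd ?z" by simp
  have d1: "(\<lambda>z. fst z - ctr) differentiable (at ?z)" by (intro derivative_intros f)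
  have d2: "(\<lambda>z. conormal (fst z - ctr)) differentiable (at ?z)"
    using d1 polar_pt_nonzero by (intro conormal_differentiable) (auto simp: e)
  have d3: "out_dir differentiable (at ?z)" unfolding out_dir_def[abs_def]
    by (intro differentiable_add differentiable_scaleR sqrt_differentiable differentiable_diff differentiable_const
       differentiable_inner f d2 s)
  have "polar (dir J (t, y)) \<bullet> dir J (t, y) \<noteq> 0"
  proof -
    let ?v = "dir J (t, y)"
    have "polar ?v \<bullet> vec2 (?v \<bullet> u1) (?v \<bullet> u2) = quad ?v"
      by (simp add: polar_def vec2_inner quad_def power_divide power2_eq_square)
    moreover have "quad ?v > 0" using dir_norm[OF lev] by (intro quad_pos) auto
    ultimately show ?thesis by (simp add: vec2_coord)
  qed
  then have d4: "hit differentiable (at ?z)" unfolding hit_def[abs_def]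
    by (intro differentiable_add differentiable_scaleR differentiable_divide differentiable_mult differentiable_const
       differentiable_inner polar_differentiable f d1 d3) (simp add: ext_phase[OF lev])
  have d5: "(\<lambda>z. conormal (hit z - ctr)) differentiable (at ?z)"
    using polar_pt_nonzero by (intro conormal_differentiable differentiable_diff d4 differentiable_const) (simp add: ext_phase[OF lev])
  have d6: "(\<lambda>z. out_dir z - (out_dir z \<bullet> conormal (hit z - ctr)) *\<^sub>R conormal (hit z - ctr)) differentiable (at ?z)"
    by (intro differentiable_diff differentiable_scaleR differentiable_inner d3 d5)
  obtain D1 D2 where "(hit has_derivative D1) (at ?z)"
    "((\<lambda>z. out_dir z - (out_dir z \<bullet> conormal (hit z - ctr)) *\<^sub>R conormal (hit z - ctr)) has_derivative D2) (at ?z)"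
    using d4 d6 unfolding differentiable_def by blast
  from has_derivative_Pair[OF this] have "ext differentiable (at ?z)"
    unfolding differentiable_def ext_def[abs_def] by blast
  then show ?thesis by (simp add: w)
qed

lemma ext_iterate: "level J w \<Longrightarrow> (ext ^^ n) (phase w) = phase ((step J ^^ n) w)"
proof (induction n)
  case (Suc n)
  then show ?case
    using ext_phase(3)[of J "fst ((step J ^^ n) w)" "snd ((step J ^^ n) w)"] level_iterate[of J w n] by simp
qed simp

lemma ext_iterate_differentiable:
  assumes "level J w" shows "(ext ^^ n) differentiable (at (phase w))"
proof (induction n)
  case 0
  show ?case by (simp add: id_def)
next
  case (Suc n)
  have "ext differentiable (at ((ext ^^ n) (phase w)))"
    unfolding ext_iterate[OF assms] by (rule ext_differentiable[OF level_iterate[OF assms]])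
  then show ?case using differentiable_chain_at[OF Suc] by (simp add: o_def)
qed

lemma ext_eq_billiard:
  assumes "z \<in> coball_bundle region" shows "(billiard_map region ^^ n) z = (ext ^^ n) z"
proof -
  obtain J t y where "z = phase (t, y)" "level J (t, y)" using assms by (rule coball_cases)
  then show ?thesis by (simp add: billiard_iterate ext_iterate)
qed

lemma polar_vel_iff: "polar (pt t - ctr) \<bullet> v = 0 \<longleftrightarrow> (\<exists>r. v = r *\<^sub>R vel t)"
proof
  have 1: "polar (pt t - ctr) \<bullet> v = cos t * (v \<bullet> u1 / a) + sin t * (v \<bullet> u2 / b)" for v
    unfolding polar_pt by (subst vec2_coord[of v, symmetric]) (simp add: vec2_inner)
  assume "polar (pt t - ctr) \<bullet> v = 0"
  then show "\<exists>r. v = r *\<^sub>R vel t" using parallel_vel 1 by simp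
next
  assume "\<exists>r. v = r *\<^sub>R vel t"
  then show "polar (pt t - ctr) \<bullet> v = 0"
    using a_pos b_pos by (auto simp: polar_pt vel_def vec2_inner vec2_scaleR)
qed

text \<open>On the bundle \<open>fst z\<close> lies on the ellipse and
  \<open>polar (fst z - ctr) \<bullet> snd z = 0\<close>. Differentiated along a curve, these
  equations confine its velocity to a two-dimensional space; this takes the place of a chart of the
  bundle.\<close>

lemma bundle_velocity:
  assumes d: "(\<gamma> has_vector_derivative w) (at 0)" and e: "e > 0"
    and g: "\<And>s. s \<in> {-e<..<e} \<Longrightarrow> \<gamma> s \<in> coball_bundle region" and 0: "\<gamma> 0 = phase (t, y)"
  shows "\<exists>r. fst w = r *\<^sub>R vel t"
    and "polar (fst w) \<bullet> snd (phase (t, y)) + polar (pt t - ctr) \<bullet> snd w = 0"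
proof -
  have mem: "fst (\<gamma> s) \<in> ell" "polar (fst (\<gamma> s) - ctr) \<bullet> snd (\<gamma> s) = 0" if s: "s \<in> {-e<..<e}" for s
  proof -
    obtain J t y where "\<gamma> s = phase (t, y)" using g[OF s] by (rule coball_cases)
    then show "fst (\<gamma> s) \<in> ell" "polar (fst (\<gamma> s) - ctr) \<bullet> snd (\<gamma> s) = 0"
      using polar_vel_iff[of t] by (auto simp: phase_def pt_in_ell simp del: inner_scaleR_right)
  qed
  have d1: "((\<lambda>s. fst (\<gamma> s)) has_vector_derivative fst w) (at 0)" by (rule has_vector_derivative_fst[OF d])
  have d2: "((\<lambda>s. snd (\<gamma> s)) has_vector_derivative snd w) (at 0)" by (rule has_vector_derivative_snd[OF d])
  show "\<exists>r. fst w = r *\<^sub>R vel t"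
    by (rule velocity_in_ell[OF d1 e]) (use mem(1) 0 in \<open>auto simp: phase_def abs_less_iff\<close>)
  have d3: "((\<lambda>s. polar (fst (\<gamma> s) - ctr)) has_vector_derivative polar (fst w)) (at 0)"
    using bounded_linear.has_vector_derivative[OF polar_linear has_vector_derivative_diff[OF d1 has_vector_derivative_const]]
    by simp
  have "((\<lambda>s. polar (fst (\<gamma> s) - ctr) \<bullet> snd (\<gamma> s)) has_vector_derivative
      polar (fst (\<gamma> 0) - ctr) \<bullet> snd w + polar (fst w) \<bullet> snd (\<gamma> 0)) (at 0)"
    by (rule bounded_bilinear.has_vector_derivative[OF bounded_bilinear_inner d3 d2])
  moreover have "((\<lambda>s. polar (fst (\<gamma> s) - ctr) \<bullet> snd (\<gamma> s)) has_vector_derivative 0) (at 0)"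
    by (rule has_vector_derivative_transform_within_open[OF has_vector_derivative_const, of "{-e<..<e}"])
       (use e mem(2) in auto)
  ultimately have "polar (fst (\<gamma> 0) - ctr) \<bullet> snd w + polar (fst w) \<bullet> snd (\<gamma> 0) = 0"
    by (rule vector_derivative_unique_at)
  then show "polar (fst w) \<bullet> snd (phase (t, y)) + polar (pt t - ctr) \<bullet> snd w = 0"
    by (simp add: 0 phase_def add.commute)
qed

lemma invariant_circle_subset:
  assumes "0 < J" "J * a < 1" shows "invariant_circle J \<subseteq> coball_bundle region"
  using level_coball[OF level_mom_pos[OF assms]] by (auto simp: invariant_circle_def)

text \<open>Tangent vectors of the bundle are combinations of \<open>E\<close>, along the circle,
  and \<open>E2\<close>, the derivative in \<open>J\<close> at a fixed angle. The differential
  \<open>D\<close> fixes \<open>E\<close>, since the circle consists of fixed points. It gives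
  \<open>D E2\<close> the base component \<open>Dk *\<^sub>R vel t\<close> with
  \<open>Dk > 0\<close>, while \<open>E2\<close> itself has base component \<open>0\<close>; so no
  nonzero multiple of \<open>E2\<close> is fixed.\<close>

lemma clean_invariant_circle:
  assumes J: "0 < J" "J * a < 1" and k: "k \<ge> 1" and cl: "\<And>t. closes J k p (t, mom J t)"
  shows "clean_fixed_set (coball_bundle region) (billiard_map region ^^ k) (invariant_circle J)"
  unfolding clean_fixed_set_def
proof (intro conjI ballI)
  let ?M = "coball_bundle region"
  show sub: "invariant_circle J \<subseteq> ?M" by (rule invariant_circle_subset[OF J])
  have fix_ph: "(ext ^^ k) (phase (t, mom J t)) = phase (t, mom J t)" for t
    unfolding ext_iterate[OF level_mom_pos[OF J]] closes_iff_phase using cl by blast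
  have fix_ext: "(ext ^^ k) z = z" if "z \<in> invariant_circle J" for z
    using that fix_ph by (auto simp: invariant_circle_def)
  show "(billiard_map region ^^ k) z = z" if "z \<in> invariant_circle J" for z
    using ext_eq_billiard[of z k] fix_ext[OF that] sub that by auto
  fix z assume z: "z \<in> invariant_circle J"
  then obtain t where zt: "z = phase (t, mom J t)" by (auto simp: invariant_circle_def)
  obtain D where D: "((ext ^^ k) has_derivative D) (at z)"
    using ext_iterate_differentiable[OF level_mom_pos[OF J]] unfolding differentiable_def zt by blast
  then have linD: "linear D" by (rule has_derivative_linear)
  have DM: "((billiard_map region ^^ k) has_derivative D) (at z within ?M)"
    by (rule has_derivative_transform[OF _ ext_eq_billiard has_derivative_at_withinI[OF D]]) (use z sub in auto)
  obtain E where E: "((\<lambda>s. phase (t + 1 * s, mom J (t + 1 * s))) has_vector_derivative E) (at 0)"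
    "fst E = 1 *\<^sub>R vel (t + 1 * 0)" by (rule phase_curve_derivative[OF J])
  have E': "((\<lambda>s. phase (t + s, mom J (t + s))) has_vector_derivative E) (at 0)" "fst E = vel t"
    using E by simp_all
  have DE: "D E = E"
  proof -
    have "((\<lambda>s. (ext ^^ k) (phase (t + s, mom J (t + s)))) has_vector_derivative D E) (at 0)"
      by (rule vector_derivative_compose[OF _ E'(1)]) (use D zt in simp)
    then show ?thesis unfolding fix_ph using E'(1) vector_derivative_unique_at by blast
  qed
  have Ecurve: "r *\<^sub>R E \<in> tangent_space (invariant_circle J) z" for r
  proof -
    have "((\<lambda>s. phase (t + r * s, mom J (t + r * s))) has_vector_derivative r *\<^sub>R E) (at 0)"
      using vector_diff_chain_at[of "\<lambda>s. r * s" r 0 "\<lambda>s. phase (t + s, mom J (t + s))" E] E'(1)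
        has_vector_derivative_mult_right[OF has_vector_derivative_id, of r "at 0"]
      by (simp add: o_def id_def)
    then show ?thesis unfolding tangent_space_def
      using smooth_phase[OF J, of "{-1<..<1}" t r]
      by (auto simp: zt invariant_circle_def intro!: exI[of _ "\<lambda>s. phase (t + r * s, mom J (t + r * s))"] exI[of _ "1::real"])
  qed
  obtain m' where m': "((\<lambda>J. mom J t) has_real_derivative m') (at J)" "m' \<noteq> 0"
  proof -
    have pos: "0 < P t - a\<^sup>2 * b\<^sup>2 * J\<^sup>2"
      using mom_radicand[of J t] mom_radicand_pos[OF J] by linarith
    have 1: "((\<lambda>J. P t - a\<^sup>2 * b\<^sup>2 * J\<^sup>2) has_real_derivative - (2 * a\<^sup>2 * b\<^sup>2 * J)) (at J)"
      by (rule derivative_eq_intros refl)+ simp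
    show thesis
      by (rule that[OF DERIV_chain2[where f = sqrt, OF DERIV_real_sqrt[OF pos] 1, folded mom_def]])
         (use pos J a_pos b_pos mom_pos[OF J, of t] in auto)
  qed
  define E2 where "E2 = ((0 :: plane), (m' / P t) *\<^sub>R vel t)"
  have dE2: "((\<lambda>J. phase (t, mom J t)) has_vector_derivative E2) (at J)"
  proof -
    have "((\<lambda>J. mom J t / P t) has_real_derivative m' / P t) (at J)" by (rule DERIV_cdivide[OF m'(1)])
    then have "((\<lambda>J. (mom J t / P t) *\<^sub>R vel t) has_vector_derivative (m' / P t) *\<^sub>R vel t) (at J)"
      by (rule has_vector_derivative_scaleR[OF _ has_vector_derivative_const, simplified])
    then show ?thesis unfolding phase_def E2_def by (auto intro!: has_vector_derivative_Pair)
  qed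
  obtain Dk where Dk: "((\<lambda>J. (fwd J ^^ k) t) has_real_derivative Dk) (at J)" "Dk > 0"
    using fwd_iterate_has_derivative[OF J, of k t] k by metis
  have fDE2: "fst (D E2) = Dk *\<^sub>R vel t"
  proof -
    have "((\<lambda>J. (ext ^^ k) (phase (t, mom J t))) has_vector_derivative D E2) (at J)"
      by (rule vector_derivative_compose[OF _ dE2]) (use D zt in simp)
    then have "((\<lambda>J. fst ((ext ^^ k) (phase (t, mom J t)))) has_vector_derivative fst (D E2)) (at J)"
      by (rule has_vector_derivative_fst)
    then have "((\<lambda>J. pt ((fwd J ^^ k) t)) has_vector_derivative fst (D E2)) (at J)"
    proof (rule has_vector_derivative_transform_within_open)
      show "open {0<..<1 / a}" "J \<in> {0<..<1 / a}" using J elliptic_iff by auto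
      fix J' assume "J' \<in> {0<..<1 / a}"
      then have J': "0 < J'" "J' * a < 1" using elliptic_iff by auto
      show "fst ((ext ^^ k) (phase (t, mom J' t))) = pt ((fwd J' ^^ k) t)"
        using ext_iterate[OF level_mom_pos[OF J'], of k t] iterate_elliptic[OF J'] by (simp add: phase_def)
    qed
    moreover have "((\<lambda>J. pt ((fwd J ^^ k) t)) has_vector_derivative Dk *\<^sub>R vel ((fwd J ^^ k) t)) (at J)"
      by (rule pt_has_vector_derivative[OF Dk(1)])
    moreover have "vel ((fwd J ^^ k) t) = vel t" using cl[of t] by (simp add: closes_elliptic[OF J] vel_shift)
    ultimately show ?thesis using vector_derivative_unique_at by metis
  qed
  show "\<exists>D. ((billiard_map region ^^ k) has_derivative D) (at z within ?M) \<and>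
      {v \<in> tangent_space ?M z. D v - v = 0} = tangent_space (invariant_circle J) z"
  proof (intro exI conjI set_eqI iffI)
    show "((billiard_map region ^^ k) has_derivative D) (at z within ?M)" by (rule DM)
    fix v assume "v \<in> tangent_space (invariant_circle J) z"
    then obtain \<gamma> e where g: "e > 0" "smooth_fun_on {-e<..<e} \<gamma>" "\<forall>s\<in>{-e<..<e}. \<gamma> s \<in> invariant_circle J"
      "\<gamma> 0 = z" "(\<gamma> has_vector_derivative v) (at 0)" by (auto simp: tangent_space_def)
    have "((\<lambda>s. (ext ^^ k) (\<gamma> s)) has_vector_derivative D v) (at 0)"
      by (rule vector_derivative_compose[OF _ g(5)]) (use D g(4) in simp)
    then have "(\<gamma> has_vector_derivative D v) (at 0)"
      by (rule has_vector_derivative_transform_within_open[of _ _ _ "{-e<..<e}"]) (use g fix_ext in auto)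
    then have "D v = v" using g(5) by (rule vector_derivative_unique_at)
    moreover have "v \<in> tangent_space ?M z" using g sub unfolding tangent_space_def by blast
    ultimately show "v \<in> {v \<in> tangent_space ?M z. D v - v = 0}" by simp
  next
    fix w assume "w \<in> {v \<in> tangent_space ?M z. D v - v = 0}"
    then have Dw: "D w = w" and "w \<in> tangent_space ?M z" by auto
    then obtain \<gamma> e where g: "e > 0" "\<forall>s\<in>{-e<..<e}. \<gamma> s \<in> ?M" "\<gamma> 0 = z" "(\<gamma> has_vector_derivative w) (at 0)"
      by (auto simp: tangent_space_def)
    have w: "\<exists>r. fst w = r *\<^sub>R vel t" "polar (fst w) \<bullet> snd z + polar (pt t - ctr) \<bullet> snd w = 0"
      using bundle_velocity[OF g(4,1), of t "mom J t"] g(2,3) zt by auto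
    have e: "polar (fst E) \<bullet> snd z + polar (pt t - ctr) \<bullet> snd E = 0"
      using bundle_velocity(2)[OF E'(1), of 1 t "mom J t"] invariant_circle_subset[OF J] zt
      by (auto simp: invariant_circle_def)
    obtain r where r: "fst w = r *\<^sub>R vel t" using w(1) by blast
    \<comment> \<open>Without its component along \<open>E\<close> the vector has base component
      \<open>0\<close>, and the linearized bundle equation then makes it a multiple of
      \<open>E2\<close>.\<close>
    define w' where "w' = w - r *\<^sub>R E"
    have fw: "fst w' = 0" by (simp add: w'_def r E'(2))
    have "polar (pt t - ctr) \<bullet> snd w' = (polar (fst w) \<bullet> snd z + polar (pt t - ctr) \<bullet> snd w)
        - r * (polar (fst E) \<bullet> snd z + polar (pt t - ctr) \<bullet> snd E)"
      by (simp add: w'_def r E'(2) inner_diff_right linear_cmul[OF bounded_linear.linear[OF polar_linear]] algebra_simps)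
    then have "polar (pt t - ctr) \<bullet> snd w' = 0" using w(2) e by simp
    then obtain q where q: "snd w' = q *\<^sub>R vel t" using polar_vel_iff by blast
    have "w' = (q * P t / m') *\<^sub>R E2"
      using fw q m'(2) P_pos[of t] by (simp add: E2_def prod_eq_iff)
    moreover have "D w' = w'" by (simp add: w'_def linear_diff[OF linD] linear_cmul[OF linD] Dw DE)
    ultimately have "fst w' = (q * P t / m') *\<^sub>R (Dk *\<^sub>R vel t)"
      using fDE2 linear_cmul[OF linD] by (metis fst_scaleR)
    then have "q * P t / m' = 0" using fw vel_nonzero[of t] Dk(2) by simp
    then have "q = 0" using m'(2) P_pos[of t] by simp
    then have "w' = 0" using fw q by (simp add: prod_eq_iff)
    then have "w = r *\<^sub>R E" by (simp add: w'_def)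
    then show "w \<in> tangent_space (invariant_circle J) z" using Ecurve by simp
  qed
qed

end

section \<open>Smoothness of the boundary and admissibility\<close>

context ellipse_frame
begin

text \<open>Stated for an arbitrary principal frame, so that the axes can be used in either order:
  at every boundary point one coordinate is nonzero, and the boundary is a graph over the other
  axis.\<close>

lemma graph_near_point:
  assumes w: "w1 \<bullet> w1 = 1" "w2 \<bullet> w2 = 1" "w1 \<bullet> w2 = 0" and A: "0 < A" "0 < B"
    and q: "\<And>v. quad v = ((v \<bullet> w1) / A)\<^sup>2 + ((v \<bullet> w2) / B)\<^sup>2"
    and p: "p \<in> ell" "(p - ctr) \<bullet> w2 \<noteq> 0"
  shows "\<exists>u n r. \<exists>f :: real \<Rightarrow> real. norm u = 1 \<and> norm n = 1 \<and> u \<bullet> n = 0 \<and> r > 0 \<and>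
     smooth_fun_on {p \<bullet> u - r<..<p \<bullet> u + r} f \<and>
     region \<inter> ball p r = {x \<in> ball p r. f (x \<bullet> u) < x \<bullet> n}"
proof -
  define X where "X = (\<lambda>x. (x - ctr) \<bullet> w1)"
  define Y where "Y = (\<lambda>x. (x - ctr) \<bullet> w2)"
  define \<sigma> where "\<sigma> = sgn (Y p)"
  have \<sigma>: "\<sigma> = 1 \<or> \<sigma> = - 1" "\<sigma> * Y p = \<bar>Y p\<bar>" "Y p \<noteq> 0"
    using p(2) by (auto simp: \<sigma>_def Y_def sgn_if)
  have pq: "(X p / A)\<^sup>2 + (Y p / B)\<^sup>2 = 1" using p(1) by (simp add: ell_def q X_def Y_def)
  moreover have "0 < (Y p / B)\<^sup>2" using \<sigma>(3) A by simp
  ultimately have "(X p / A)\<^sup>2 < 1" by linarith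
  then have Xp: "\<bar>X p\<bar> < A" using A by (simp add: abs_square_less_1)
  \<comment> \<open>\<open>A - \<bar>X p\<bar>\<close> keeps the abscissa in the open domain of the
    root, and \<open>\<bar>Y p\<bar>\<close> keeps \<open>Y\<close> from changing sign on the
    ball.\<close>
  define r where "r = min \<bar>Y p\<bar> (A - \<bar>X p\<bar>)"
  have r: "r > 0" "r \<le> \<bar>Y p\<bar>" "r \<le> A - \<bar>X p\<bar>" using \<sigma>(3) Xp by (auto simp: r_def)
  define n where "n = - \<sigma> *\<^sub>R w2"
  define f where "f = (\<lambda>s. ctr \<bullet> n + (- B) * sqrt (1 - ((s - ctr \<bullet> w1) / A)\<^sup>2))"
  have lip: "\<bar>X x - X p\<bar> < r" "\<bar>Y x - Y p\<bar> < r" if "x \<in> ball p r" for x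
  proof -
    have n1: "norm w1 = 1" "norm w2 = 1" using w by (simp_all add: norm_eq_sqrt_inner)
    have "X x - X p = (x - p) \<bullet> w1" "Y x - Y p = (x - p) \<bullet> w2" by (simp_all add: X_def Y_def inner_diff_left)
    moreover have "norm (x - p) < r" using that by (simp add: dist_norm norm_minus_commute)
    ultimately show "\<bar>X x - X p\<bar> < r" "\<bar>Y x - Y p\<bar> < r"
      using Cauchy_Schwarz_ineq2[of "x - p" w1] Cauchy_Schwarz_ineq2[of "x - p" w2] by (simp_all add: n1)
  qed
  have "norm w1 = 1" "norm n = 1" "w1 \<bullet> n = 0"
    using w \<sigma>(1) by (auto simp: n_def norm_eq_sqrt_inner)
  moreover have "smooth_fun_on {p \<bullet> w1 - r<..<p \<bullet> w1 + r} f"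
  proof (rule smooth_fun_on_subset)
    show "smooth_fun_on {ctr \<bullet> w1 - A<..<ctr \<bullet> w1 + A} f" unfolding f_def by (rule smooth_fun_on_sqrt[OF A(1)])
    have "p \<bullet> w1 = ctr \<bullet> w1 + X p" by (simp add: X_def inner_diff_left)
    then show "{p \<bullet> w1 - r<..<p \<bullet> w1 + r} \<subseteq> {ctr \<bullet> w1 - A<..<ctr \<bullet> w1 + A}" using r(3) by auto
  qed
  moreover have "region \<inter> ball p r = {x \<in> ball p r. f (x \<bullet> w1) < x \<bullet> n}"
  proof -
    have "x \<in> region \<longleftrightarrow> f (x \<bullet> w1) < x \<bullet> n" if x: "x \<in> ball p r" for x
    proof -
      have "\<sigma> * Y x > 0"
      proof -
        have "\<bar>\<sigma> * Y x - \<sigma> * Y p\<bar> < r" using lip(2)[OF x] \<sigma>(1) by auto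
        then show ?thesis using \<sigma>(2) r(2) by linarith
      qed
      then have y: "0 < \<sigma> * Y x / B" using A by simp
      have y2: "(\<sigma> * Y x / B)\<^sup>2 = (Y x / B)\<^sup>2" using \<sigma>(1) by auto
      have "f (x \<bullet> w1) < x \<bullet> n \<longleftrightarrow> \<sigma> * Y x < B * sqrt (1 - (X x / A)\<^sup>2)"
        by (simp add: f_def n_def X_def Y_def inner_diff_left algebra_simps)
      also have "\<dots> \<longleftrightarrow> \<sigma> * Y x / B < sqrt (1 - (X x / A)\<^sup>2)" using A by (simp add: field_simps)
      also have "\<dots> \<longleftrightarrow> (\<sigma> * Y x / B)\<^sup>2 < 1 - (X x / A)\<^sup>2"
      proof -
        have "sqrt ((\<sigma> * Y x / B)\<^sup>2) = \<sigma> * Y x / B" using y by (simp only: real_sqrt_abs abs_of_pos)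
        then show ?thesis by (metis real_sqrt_less_iff)
      qed
      also have "\<dots> \<longleftrightarrow> x \<in> region" unfolding y2 by (auto simp: region_def q X_def Y_def)
      finally show ?thesis by simp
    qed
    then show ?thesis by blast
  qed
  ultimately show ?thesis using r(1) by blast
qed

lemma smooth_boundary_region: "smooth_boundary region"
  unfolding smooth_boundary_def frontier_region
proof
  fix p assume p: "p \<in> ell"
  show "\<exists>u n r. \<exists>f :: real \<Rightarrow> real. norm u = 1 \<and> norm n = 1 \<and> u \<bullet> n = 0 \<and> r > 0 \<and>
     smooth_fun_on {p \<bullet> u - r<..<p \<bullet> u + r} f \<and>
     region \<inter> ball p r = {x \<in> ball p r. f (x \<bullet> u) < x \<bullet> n}"
  proof (cases "(p - ctr) \<bullet> u2 = 0")
    case False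
    show ?thesis by (rule graph_near_point[OF u11 u22 u12 a_pos b_pos quad_def p False])
  next
    case True
    then have "(p - ctr) \<bullet> u1 \<noteq> 0" using p by (auto simp: ell_def quad_def)
    moreover have "quad v = ((v \<bullet> u2) / b)\<^sup>2 + ((v \<bullet> u1) / a)\<^sup>2" for v by (simp add: quad_def)
    ultimately show ?thesis by (intro graph_near_point[OF u22 u11 u21 b_pos a_pos _ p])
  qed
qed

text \<open>Each segment is reversed on its own: the counterclockwise orbit from its end point with
  the opposite momentum has it as first segment. As the family is a union over the whole circle, no
  single reversed orbit needs to be followed through all segments.\<close>

lemma reversed_trajectory:
  assumes J: "0 < J" "J * a < 1"
  shows "trajectory region (phase (t, - mom J t)) \<subseteq> reversed (trajectory_family region (invariant_circle J))"
proof
  fix e assume e: "e \<in> trajectory region (phase (t, - mom J t))"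
  have lev: "level J (t, - mom J t)" using J by (simp add: level_mom_iff)
  obtain i x where i: "e = (x, dir J ((step J ^^ i) (t, - mom J t)))"
    "x \<in> open_segment (pt (fst ((step J ^^ i) (t, - mom J t)))) (pt (fst ((step J ^^ Suc i) (t, - mom J t))))"
    using e unfolding trajectory_phase[OF lev] by auto
  have neg: "level J (s, y) \<Longrightarrow> y < 0 \<Longrightarrow> snd (step J (s, y)) < 0" for s y
    using mom_product_pos[OF _ J(2), of s y] by (auto simp: zero_less_mult_iff)
  have "snd ((step J ^^ j) (t, - mom J t)) < 0" for j
  proof (induction j)
    case 0
    show ?case using mom_pos[OF J] by simp
  next
    case (Suc j)
    show ?case
      using neg[of "fst ((step J ^^ j) (t, - mom J t))" "snd ((step J ^^ j) (t, - mom J t))"] Suc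
        level_iterate[OF lev, of j] by simp
  qed
  note neg = this
  obtain s y where w: "(step J ^^ i) (t, - mom J t) = (s, y)" by (cases "(step J ^^ i) (t, - mom J t)")
  obtain s2 y2 where w2: "step J (s, y) = (s2, y2)" by (cases "step J (s, y)")
  have levw: "level J (s, y)" using level_iterate[OF lev, of i] w by simp
  have "level J (s2, y2)" using level_step[OF levw] w2 by simp
  moreover have "y2 < 0" using neg[of "Suc i"] w w2 by simp
  ultimately have y2: "- y2 = mom J s2" using mom_pos[OF J, of s2] by (auto simp: level_mom_iff[OF J])
  have lev2: "level J (s2, mom J s2)" by (rule level_mom_pos[OF J])
  have x: "x \<in> open_segment (pt s) (pt s2)" using i(2) w w2 by simp
  have rev: "pt (fst (step J (s2, mom J s2))) = pt s" "dir J (s2, mom J s2) = - dir J (s, y)"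
    using reverse_step[OF levw] by (simp_all add: w2 y2)
  have "(x, - dir J (s, y)) \<in> trajectory region (phase (s2, mom J s2))"
    unfolding trajectory_phase[OF lev2] using x rev
    by (intro UN_I[of 0]) (auto simp: open_segment_commute)
  then have "(x, - dir J (s, y)) \<in> trajectory_family region (invariant_circle J)"
    by (auto simp: trajectory_family_def invariant_circle_def)
  then show "e \<in> reversed (trajectory_family region (invariant_circle J))"
    unfolding reversed_def i(1) w by (intro image_eqI[of _ _ "(x, - dir J (s, y))"]) auto
qed

lemma admissible_family_exists: "\<exists>k T \<Lambda>. admissible_family region k T \<Lambda>"
proof -
  obtain k J \<epsilon> where k: "2 \<le> k" and o: "once_around k J" and \<epsilon>: "0 < \<epsilon>"
    and iso: "\<And>j J' p t z. \<lbrakk>1 \<le> j; level J' (t, z); closes J' j p (t, z);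
      \<bar>total_length J' j (t, z) - once_length k J\<bar> \<le> \<epsilon>\<rbrakk> \<Longrightarrow> J' = J"
    using isolated_once_around by metis
  have J: "0 < J" "J * a < 1" using o by (auto simp: once_around_def)
  note lev = level_mom_pos[OF J]
  note cl = once_around_closes[OF o] and len = once_around_length[OF o]
  let ?\<Lambda> = "invariant_circle J" and ?T = "once_length k J"
  have bil: "billiard_map region (phase (t, mom J t)) = phase (fwd J t, mom J (fwd J t))" for t
    using billiard_phase[OF lev] by (simp add: step_elliptic(1)[OF J])
  have fixed: "(billiard_map region ^^ k) z = z" if zm: "z \<in> ?\<Lambda>" for z
  proof -
    obtain t where z: "z = phase (t, mom J t)" using zm by (auto simp: invariant_circle_def)
    show ?thesis unfolding z billiard_iterate[OF lev] closes_iff_phase using cl by blast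
  qed
  have into: "billiard_map region ` ?\<Lambda> \<subseteq> ?\<Lambda>" using bil by (auto simp: invariant_circle_def)
  \<comment> \<open>Every point is the \<open>k\<close>-th iterate of itself, hence the image of its
    own iterate of order \<open>k - 1\<close>.\<close>
  have "?\<Lambda> \<subseteq> billiard_map region ` ?\<Lambda>"
  proof
    fix z assume z: "z \<in> ?\<Lambda>"
    have it: "(billiard_map region ^^ n) z \<in> ?\<Lambda>" for n by (induction n) (use z into in auto)
    obtain m where m: "k = Suc m" using k by (cases k) auto
    have "z = billiard_map region ((billiard_map region ^^ m) z)" using fixed[OF z] by (simp add: m)
    then show "z \<in> billiard_map region ` ?\<Lambda>" using it by blast
  qed
  with into have inv: "billiard_map region ` ?\<Lambda> = ?\<Lambda>" by blast
  have per: "periodic_point region k z \<and> orbit_length region k z = ?T" if zm: "z \<in> ?\<Lambda>" for z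
  proof -
    obtain t where z: "z = phase (t, mom J t)" using zm by (auto simp: invariant_circle_def)
    show ?thesis unfolding z periodic_iff[OF lev] orbit_length_phase[OF lev] using cl len k by auto
  qed
  have isolated: "trajectory region z \<subseteq> trajectory_family region ?\<Lambda> \<union> reversed (trajectory_family region ?\<Lambda>)"
    if z: "periodic_point region j z" "orbit_length region j z \<in> {?T - \<epsilon>..?T + \<epsilon>}" for j z
  proof -
    have "(billiard_map region ^^ 0) z \<in> coball_bundle region" using z(1) unfolding periodic_point_def by blast
    then have "z \<in> coball_bundle region" by simp
    then obtain J' t y where zp: "z = phase (t, y)" and lev': "level J' (t, y)" by (rule coball_cases)
    obtain p where "1 \<le> j" "closes J' j p (t, y)" using z(1) unfolding zp periodic_iff[OF lev'] by blast
    moreover have "\<bar>total_length J' j (t, y) - ?T\<bar> \<le> \<epsilon>"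
      using z(2) unfolding zp orbit_length_phase[OF lev'] by (auto simp: abs_le_iff)
    ultimately have "J' = J" using iso lev' by blast
    then have "y = mom J t \<or> y = - mom J t" using lev' level_mom_iff[OF J] by blast
    then show ?thesis
    proof
      assume "y = mom J t"
      then have "z \<in> ?\<Lambda>" by (simp add: zp invariant_circle_def)
      then show ?thesis by (auto simp: trajectory_family_def)
    next
      assume "y = - mom J t"
      then show ?thesis using reversed_trajectory[OF J, of t] by (auto simp: zp)
    qed
  qed
  \<comment> \<open>From \<open>|\<xi>|^2 = 1 - a^2 b^2 J^2 / P t\<close> and
    \<open>P t \<le> a^2\<close>.\<close>
  have glancing: "\<forall>(q, \<xi>)\<in>?\<Lambda>. norm \<xi> \<le> sqrt (1 - b\<^sup>2 * J\<^sup>2)"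
  proof -
    have "norm ((mom J t / P t) *\<^sub>R vel t) \<le> sqrt (1 - b\<^sup>2 * J\<^sup>2)" for t
    proof (rule real_le_rsqrt)
      have P: "0 < P t" "P t \<le> a\<^sup>2" by (rule P_pos, rule P_le)
      have "(norm ((mom J t / P t) *\<^sub>R vel t))\<^sup>2 = 1 - a\<^sup>2 * (b\<^sup>2 * J\<^sup>2) / P t"
        unfolding momentum_norm mom_sq[OF J] using P by (simp add: diff_divide_distrib mult.assoc)
      moreover have "b\<^sup>2 * J\<^sup>2 * P t \<le> b\<^sup>2 * J\<^sup>2 * a\<^sup>2" using P by (intro mult_left_mono) auto
      then have "b\<^sup>2 * J\<^sup>2 \<le> a\<^sup>2 * (b\<^sup>2 * J\<^sup>2) / P t" using P by (simp add: field_simps)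
      ultimately show "(norm ((mom J t / P t) *\<^sub>R vel t))\<^sup>2 \<le> 1 - b\<^sup>2 * J\<^sup>2" by linarith
    qed
    then show ?thesis by (auto simp: invariant_circle_def phase_def simp del: norm_scaleR)
  qed
  have "b\<^sup>2 * J\<^sup>2 > 0" using J b_pos by simp
  then have "sqrt (1 - b\<^sup>2 * J\<^sup>2) < 1" by simp
  moreover have "clean_fixed_set (coball_bundle region) (billiard_map region ^^ k) ?\<Lambda>"
    by (rule clean_invariant_circle[OF J _ cl]) (use k in simp)
  ultimately have "admissible_family region k ?T ?\<Lambda>"
    unfolding admissible_family_def
    using k smooth_circle_invariant[OF J] invariant_circle_subset[OF J] inv per isolated \<epsilon> glancing by blast
  then show ?thesis by blast
qed

end

section \<open>From the focal definition of an ellipse to its principal axes\<close>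

lemma focal_sum_iff:
  fixes A e X Y :: real
  assumes "0 \<le> e" "e < A"
  shows "sqrt ((X + e)\<^sup>2 + Y\<^sup>2) + sqrt ((X - e)\<^sup>2 + Y\<^sup>2) = 2 * A \<longleftrightarrow>
    (X / A)\<^sup>2 + (Y / sqrt (A\<^sup>2 - e\<^sup>2))\<^sup>2 = 1"
proof -
  have A: "A > 0" using assms by simp
  have b: "A\<^sup>2 - e\<^sup>2 > 0" using assms by (simp add: power_strict_mono)
  define r1 where "r1 = sqrt ((X + e)\<^sup>2 + Y\<^sup>2)"
  define r2 where "r2 = sqrt ((X - e)\<^sup>2 + Y\<^sup>2)"
  have r: "r1 \<ge> 0" "r2 \<ge> 0" "r1\<^sup>2 = (X + e)\<^sup>2 + Y\<^sup>2" "r2\<^sup>2 = (X - e)\<^sup>2 + Y\<^sup>2"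
    by (simp_all add: r1_def r2_def)
  have iff: "(X / A)\<^sup>2 + (Y / sqrt (A\<^sup>2 - e\<^sup>2))\<^sup>2 = 1 \<longleftrightarrow> (A\<^sup>2 - e\<^sup>2) * X\<^sup>2 + A\<^sup>2 * Y\<^sup>2 = A\<^sup>2 * (A\<^sup>2 - e\<^sup>2)"
  proof -
    define B where "B = A\<^sup>2 - e\<^sup>2"
    have B: "B > 0" using b by (simp add: B_def)
    have "(X / A)\<^sup>2 + (Y / sqrt B)\<^sup>2 = (B * X\<^sup>2 + A\<^sup>2 * Y\<^sup>2) / (A\<^sup>2 * B)"
      using A B by (simp add: power_divide field_simps)
    also have "\<dots> = 1 \<longleftrightarrow> B * X\<^sup>2 + A\<^sup>2 * Y\<^sup>2 = A\<^sup>2 * B" using A B by auto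
    finally show ?thesis by (simp only: B_def)
  qed
  have "r1 + r2 = 2 * A \<longleftrightarrow> (A\<^sup>2 - e\<^sup>2) * X\<^sup>2 + A\<^sup>2 * Y\<^sup>2 = A\<^sup>2 * (A\<^sup>2 - e\<^sup>2)"
  proof
    assume s: "r1 + r2 = 2 * A"
    \<comment> \<open>The formula for the focal radii: \<open>r1^2 - r2^2 = 4 e X\<close> and
      \<open>r1 + r2 = 2 A\<close> give \<open>A r1 = A^2 + e X\<close>.\<close>
    have "A * (A * r1) = A * (A\<^sup>2 + e * X)" using s r(3,4) by algebra
    then have "A * r1 = A\<^sup>2 + e * X" using A by simp
    then show "(A\<^sup>2 - e\<^sup>2) * X\<^sup>2 + A\<^sup>2 * Y\<^sup>2 = A\<^sup>2 * (A\<^sup>2 - e\<^sup>2)" using r(3) by algebra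
  next
    assume q: "(A\<^sup>2 - e\<^sup>2) * X\<^sup>2 + A\<^sup>2 * Y\<^sup>2 = A\<^sup>2 * (A\<^sup>2 - e\<^sup>2)"
    have "A\<^sup>2 * Y\<^sup>2 \<ge> 0" by simp
    then have "(A\<^sup>2 - e\<^sup>2) * X\<^sup>2 \<le> (A\<^sup>2 - e\<^sup>2) * A\<^sup>2" using q by (simp only: mult.commute[of "A\<^sup>2" "A\<^sup>2 - e\<^sup>2"])
    then have "X\<^sup>2 \<le> A\<^sup>2" using b by simp
    then have "\<bar>X\<bar> \<le> A" using A abs_le_square_iff[of X A] by simp
    then have "\<bar>e * X\<bar> \<le> A * A" using assms unfolding abs_mult by (intro mult_mono) auto
    \<comment> \<open>These signs allow the focal radii to be recovered from their squares.\<close>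
    then have p: "0 \<le> A\<^sup>2 + e * X" "0 \<le> A\<^sup>2 - e * X" by (auto simp: abs_le_iff power2_eq_square)
    have "(A * r1)\<^sup>2 = (A\<^sup>2 + e * X)\<^sup>2" "(A * r2)\<^sup>2 = (A\<^sup>2 - e * X)\<^sup>2" using q r(3,4) by algebra+
    then have "A * r1 = A\<^sup>2 + e * X" "A * r2 = A\<^sup>2 - e * X"
      using p r A by (auto intro: power2_eq_imp_eq)
    then have "A * (r1 + r2) = A * (2 * A)" by algebra
    then show "r1 + r2 = 2 * A" using A by simp
  qed
  then show ?thesis unfolding iff r1_def r2_def .
qed

lemma is_ellipse_frame:
  assumes "is_ellipse E"
  obtains a b ctr u1 u2 where "ellipse_frame a b u1 u2" "E = ellipse_frame.ell a b ctr u1 u2"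
proof -
  obtain f1 f2 A where d: "dist f1 f2 < 2 * A" and E: "E = {x. dist x f1 + dist x f2 = 2 * A}"
    using assms by (auto simp: is_ellipse_def)
  define e where "e = dist f1 f2 / 2"
  define ctr where "ctr = (1 / 2) *\<^sub>R (f1 + f2)"
  have e: "0 \<le> e" "e < A" using d by (auto simp: e_def)
  obtain u1 :: plane where u1: "norm u1 = 1" "f2 - f1 = (2 * e) *\<^sub>R u1"
  proof (cases "f1 = f2")
    case True
    \<comment> \<open>With coinciding foci any direction can be the first axis.\<close>
    then show ?thesis using that[of "axis 1 1"] by (simp add: e_def norm_axis_1)
  next
    case False
    then show ?thesis using that[of "(1 / norm (f2 - f1)) *\<^sub>R (f2 - f1)"]
      by (simp add: e_def dist_norm norm_minus_commute)
  qed
  define u2 :: plane where "u2 = vector [- u1 $ 2, u1 $ 1]"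
  have i: "u1 $ 1 * u1 $ 1 + u1 $ 2 * u1 $ 2 = 1"
    using u1(1) by (simp add: norm_eq_sqrt_inner inner_vec_def UNIV_2)
  have frame: "ellipse_frame A (sqrt (A\<^sup>2 - e\<^sup>2)) u1 u2"
  proof unfold_locales
    show "0 < sqrt (A\<^sup>2 - e\<^sup>2)" using e by (simp add: power_strict_mono)
    show "sqrt (A\<^sup>2 - e\<^sup>2) \<le> A" using e by (intro real_le_lsqrt) auto
    show "u1 \<bullet> u1 = 1" "u2 \<bullet> u2 = 1" "u1 \<bullet> u2 = 0"
      using i by (simp_all add: u2_def inner_vec_def UNIV_2)
  qed
  interpret ellipse_frame A "sqrt (A\<^sup>2 - e\<^sup>2)" ctr u1 u2 by (rule frame)
  have "x \<in> E \<longleftrightarrow> x \<in> ell" for x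
  proof -
    define X where "X = (x - ctr) \<bullet> u1"
    define Y where "Y = (x - ctr) \<bullet> u2"
    have x: "x - ctr = vec2 X Y" by (simp add: X_def Y_def vec2_coord)
    have half: "(1 / 2) *\<^sub>R (f2 - f1) = vec2 e 0" by (simp add: u1(2) vec2_def)
    have "x - f1 = (x - ctr) + (1 / 2) *\<^sub>R (f2 - f1)" "x - f2 = (x - ctr) - (1 / 2) *\<^sub>R (f2 - f1)"
      by (simp_all add: vec_eq_iff ctr_def field_simps)
    then have "x - f1 = vec2 (X + e) Y" "x - f2 = vec2 (X - e) Y"
      unfolding half x vec2_add vec2_diff by simp_all
    then have d: "dist x f1 = sqrt ((X + e)\<^sup>2 + Y\<^sup>2)" "dist x f2 = sqrt ((X - e)\<^sup>2 + Y\<^sup>2)"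
      by (simp_all only: dist_norm vec2_norm)
    have "x \<in> E \<longleftrightarrow> (X / A)\<^sup>2 + (Y / sqrt (A\<^sup>2 - e\<^sup>2))\<^sup>2 = 1"
      unfolding focal_sum_iff[OF e, of X Y, symmetric] E mem_Collect_eq d by (rule refl)
    then show ?thesis unfolding X_def Y_def ell_def quad_def mem_Collect_eq .
  qed
  then show thesis using that[OF frame, of ctr] by blast
qed

theorem proposition7p1p1:
  fixes E \<Omega> :: "plane set"
  assumes "is_ellipse E" and "\<Omega> = inside E"
  shows "open \<Omega> \<and> connected \<Omega> \<and> bounded \<Omega> \<and> starlike \<Omega> \<and> smooth_boundary \<Omega> \<and>
    (\<exists>k T \<Lambda>. admissible_family \<Omega> k T \<Lambda>)"
proof -
  obtain a b ctr u1 u2 where frame: "ellipse_frame a b u1 u2" and E: "E = ellipse_frame.ell a b ctr u1 u2"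
    by (rule is_ellipse_frame[OF assms(1)])
  interpret ellipse_frame a b ctr u1 u2 by (rule frame)
  have "\<Omega> = region" unfolding assms(2) E by (rule inside_ell)
  then show ?thesis
    using open_region region_properties smooth_boundary_region admissible_family_exists by simp
qed

end
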